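(* Let $M$ be an untwisted hyperbolic punctured torus bundle. Then $\pi_1(M)$ admits a non-standard bi-ordering.
   Context: A bi-ordering of a group is a strict total order on its elements that is invariant under left and right multiplication. A subset $P$ of a group $H$ is a positive cone if $P\cdot P\subset P$, $H=P\sqcup P^{-1}\sqcup\{1\}$ and $g^{-1}Pg=P$ for all $g\in H$; bi-orderings correspond to positive cones via $P=\{g : 1<g\}$. For a free group $G$ of finite rank let $G_1=G$, $G_n=[G_{n-1},G]$ for $n>1$, and $A_n=G_n/G_{n+1}$ (a free abelian group). Since $\bigcap_n G_n=\{1\}$, for each $g\neq1$ there is a unique $n(g)$ with $g\in G_{n(g)}\setminus G_{n(g)+1}$; let $[g]_n$ denote the class of $g\in G_n$ in $A_n$. A bi-ordering of $G$ is standard if there are positive cones $P_n$ of $A_n$ ($n\ge1$) such that its positive cone is $\{g\in G: g\neq1,\ [g]_{n(g)}\in P_{n(g)}\}$. Let $T$ be a compact oriented torus with one boundary component (the punctured torus), $x\in\partial T$ a base point and $G=\pi_1(T,x)$, a free group of rank 2. The punctured torus bundle with monodromy $h$, where $h\colon T\to T$ is an orientation-preserving homeomorphism fixing $\partial T$ pointwise, is $M=T\times[0,1]/((y,1)\sim(h(y),0))$. Let $h_*\in\mathrm{Aut}(G)$ be the induced automorphism and $h_+\in \mathrm{SL}(2,\mathbb{Z})$ the induced map on $H_1(T;\mathbb{Z})\cong\mathbb{Z}^2$. Then $\pi_1(M)\cong G\rtimes_{h_*}\mathbb{Z}$, and $G$ is regarded as the subgroup $G\times\{0\}$. The bundle is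 hyperbolic if $h$ is pseudo-Anosov (equivalently $|\mathrm{tr}\,h_+|>2$); a hyperbolic bundle is untwisted if the eigenvalues of $h_+$ are positive (equivalently $\mathrm{tr}\,h_+>2$) and twisted if they are negative. A bi-ordering of $\pi_1(M)$ is standard if its restriction to $G$ (a bi-ordering of $G$ invariant under $h_*$) is a standard bi-ordering of the free group $G$, and non-standard otherwise. *)

theory Defs
  imports "HOL-Analysis.Analysis" "HOL-Algebra.Coset" "HOL-Algebra.Generated_Groups" "HOL-Homology.Homology"
begin

section \<open>Bi-orderings and standard bi-orderings\<close>

definition bi_ordering :: "('g, 'm) monoid_scheme \<Rightarrow> ('g \<times> 'g) set \<Rightarrow> bool" where
  "bi_ordering H r \<longleftrightarrow>
     r \<subseteq> carrier H \<times> carrier H \<and> strict_linear_order_on (carrier H) r \<and>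
     (\<forall>a\<in>carrier H. \<forall>b\<in>carrier H. \<forall>c\<in>carrier H.
        (b, c) \<in> r \<longrightarrow> (a \<otimes>\<^bsub>H\<^esub> b, a \<otimes>\<^bsub>H\<^esub> c) \<in> r \<and> (b \<otimes>\<^bsub>H\<^esub> a, c \<otimes>\<^bsub>H\<^esub> a) \<in> r)"

definition positive_cone :: "('g, 'm) monoid_scheme \<Rightarrow> 'g set \<Rightarrow> bool" where
  "positive_cone H P \<longleftrightarrow>
     P <#>\<^bsub>H\<^esub> P \<subseteq> P \<and>
     carrier H = P \<union> m_inv H ` P \<union> {\<one>\<^bsub>H\<^esub>} \<and>
     P \<inter> m_inv H ` P = {} \<and> \<one>\<^bsub>H\<^esub> \<notin> P \<and> \<one>\<^bsub>H\<^esub> \<notin> m_inv H ` P \<and>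
     (\<forall>g\<in>carrier H. (\<lambda>p. inv\<^bsub>H\<^esub> g \<otimes>\<^bsub>H\<^esub> p \<otimes>\<^bsub>H\<^esub> g) ` P = P)"

definition order_cone :: "('g, 'm) monoid_scheme \<Rightarrow> ('g \<times> 'g) set \<Rightarrow> 'g set" where
  "order_cone H r = {g \<in> carrier H. (\<one>\<^bsub>H\<^esub>, g) \<in> r}"

definition commutator_subgroup :: "('g, 'm) monoid_scheme \<Rightarrow> 'g set \<Rightarrow> 'g set \<Rightarrow> 'g set" where
  "commutator_subgroup H A B = generate H
     {a \<otimes>\<^bsub>H\<^esub> b \<otimes>\<^bsub>H\<^esub> inv\<^bsub>H\<^esub> a \<otimes>\<^bsub>H\<^esub> inv\<^bsub>H\<^esub> b | a b. a \<in> A \<and> b \<in> B}"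

text \<open>The lower central series is indexed from 1, as usual; the value at 0 is not used.\<close>

fun lcs :: "('g, 'm) monoid_scheme \<Rightarrow> nat \<Rightarrow> 'g set" where
  "lcs H 0 = carrier H"
| "lcs H (Suc 0) = carrier H"
| "lcs H (Suc (Suc n)) = commutator_subgroup H (lcs H (Suc n)) (carrier H)"

definition lcs_quotient :: "('g, 'm) monoid_scheme \<Rightarrow> nat \<Rightarrow> 'g set monoid" where
  "lcs_quotient H n = H\<lparr>carrier := lcs H n\<rparr> Mod lcs H (Suc n)"

definition lcs_depth :: "('g, 'm) monoid_scheme \<Rightarrow> 'g \<Rightarrow> nat" where
  "lcs_depth H g = (THE n. n \<ge> 1 \<and> g \<in> lcs H n - lcs H (Suc n))"

text \<open>Used for free groups, in which every non-trivial element has a well-defined depth.\<close>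

definition standard_bi_ordering :: "('g, 'm) monoid_scheme \<Rightarrow> ('g \<times> 'g) set \<Rightarrow> bool" where
  "standard_bi_ordering H r \<longleftrightarrow> bi_ordering H r \<and>
     (\<exists>P. (\<forall>n\<ge>1. positive_cone (lcs_quotient H n) (P n)) \<and>
          order_cone H r =
            {g \<in> carrier H. g \<noteq> \<one>\<^bsub>H\<^esub> \<and>
               lcs H (Suc (lcs_depth H g)) #>\<^bsub>H\<^esub> g \<in> P (lcs_depth H g)})"


section \<open>The fundamental group\<close>

definition loops :: "'a topology \<Rightarrow> 'a \<Rightarrow> (real \<Rightarrow> 'a) set" where
  "loops X x = {p. pathin X p \<and> p 0 = x \<and> p 1 = x}"

definition loop_homotopic :: "'a topology \<Rightarrow> 'a \<Rightarrow> (real \<Rightarrow> 'a) \<Rightarrow> (real \<Rightarrow> 'a) \<Rightarrow> bool" where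
  "loop_homotopic X x = homotopic_with (\<lambda>p. p 0 = x \<and> p 1 = x) (top_of_set {0..1}) X"

definition loop_class :: "'a topology \<Rightarrow> 'a \<Rightarrow> (real \<Rightarrow> 'a) \<Rightarrow> (real \<Rightarrow> 'a) set" where
  "loop_class X x p = {q. loop_homotopic X x p q}"

text \<open>The library's path concatenation requires the points to form a type of class
  \<open>topological_space\<close>; here spaces are arbitrary elements of type \<open>'a topology\<close>.\<close>

definition loop_concat :: "(real \<Rightarrow> 'a) \<Rightarrow> (real \<Rightarrow> 'a) \<Rightarrow> real \<Rightarrow> 'a" where
  "loop_concat p q = (\<lambda>t. if t \<le> 1/2 then p (2 * t) else q (2 * t - 1))"

definition fundamental_group :: "'a topology \<Rightarrow> 'a \<Rightarrow> (real \<Rightarrow> 'a) set monoid" where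
  "fundamental_group X x =
     \<lparr>carrier = loop_class X x ` loops X x,
      mult = (\<lambda>a b. \<Union>p\<in>a. \<Union>q\<in>b. loop_class X x (loop_concat p q)),
      one = loop_class X x (\<lambda>_. x)\<rparr>"

definition fundamental_induced ::
    "'b topology \<Rightarrow> 'b \<Rightarrow> ('a \<Rightarrow> 'b) \<Rightarrow> (real \<Rightarrow> 'a) set \<Rightarrow> (real \<Rightarrow> 'b) set" where
  "fundamental_induced Y y f a = (\<Union>p\<in>a. loop_class Y y (f \<circ> p))"


section \<open>Punctured torus bundles\<close>

definition std_torus :: "(complex \<times> complex) set" where
  "std_torus = sphere 0 1 \<times> sphere 0 1"

text \<open>An open disc in the torus whose closure is a closed disc: in angular coordinates, the
  square \<open>(-\<pi>/2, \<pi>/2) \<times> (-\<pi>/2, \<pi>/2)\<close>.\<close>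

definition std_disc :: "(complex \<times> complex) set" where
  "std_disc = {(z, w) \<in> std_torus. Re z > 0 \<and> Re w > 0}"

text \<open>\<open>T\<close> is a compact torus with one boundary component, and \<open>B\<close> is its boundary.\<close>

definition punctured_torus :: "'a topology \<Rightarrow> 'a set \<Rightarrow> bool" where
  "punctured_torus T B \<longleftrightarrow> B \<subseteq> topspace T \<and>
     (\<exists>f. homeomorphic_map T (top_of_set (std_torus - std_disc)) f \<and>
          f ` B = closure std_disc - std_disc)"

text \<open>The induced map on \<open>H\<^sub>2(T, B)\<close>, an infinite cyclic group generated by a fundamental class, is
  the identity exactly if \<open>h\<close> preserves orientation.\<close>

definition monodromy :: "'a topology \<Rightarrow> 'a set \<Rightarrow> ('a \<Rightarrow> 'a) \<Rightarrow> bool" where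
  "monodromy T B h \<longleftrightarrow> homeomorphic_map T T h \<and> (\<forall>y\<in>B. h y = y) \<and>
     (\<forall>c\<in>carrier (relative_homology_group 2 T B). hom_induced 2 T B T B h c = c)"

text \<open>The fibres of the quotient map are the classes of the equivalence relation generated by
  \<open>(y, 1) \<sim> (h y, 0)\<close>.\<close>

definition mapping_torus ::
    "'a topology \<Rightarrow> ('a \<Rightarrow> 'a) \<Rightarrow> 'b topology \<Rightarrow> ('a \<times> real \<Rightarrow> 'b) \<Rightarrow> bool" where
  "mapping_torus T h M q \<longleftrightarrow>
     quotient_map (prod_topology T (top_of_set {0..1})) M q \<and>
     (\<forall>y\<in>topspace T. \<forall>y'\<in>topspace T. \<forall>t\<in>{0..1}. \<forall>t'\<in>{0..1}.
        q (y, t) = q (y', t') \<longleftrightarrow>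
          (y, t) = (y', t') \<or> (t = 1 \<and> t' = 0 \<and> y' = h y) \<or> (t = 0 \<and> t' = 1 \<and> y = h y'))"

text \<open>The image of \<open>\<pi>\<^sub>1(T, x)\<close> in \<open>\<pi>\<^sub>1(M, q (x, 0))\<close> under the inclusion of the fibre over 0.\<close>

definition fibre_subgroup ::
    "'a topology \<Rightarrow> 'a \<Rightarrow> 'b topology \<Rightarrow> ('a \<times> real \<Rightarrow> 'b) \<Rightarrow> (real \<Rightarrow> 'b) set set" where
  "fibre_subgroup T x M q =
     fundamental_induced M (q (x, 0)) (\<lambda>y. q (y, 0)) ` carrier (fundamental_group T x)"

definition H1_basis :: "'a topology \<Rightarrow> (2 \<Rightarrow> 'a chain set) \<Rightarrow> bool" where
  "H1_basis T e \<longleftrightarrow> (\<forall>i. e i \<in> carrier (homology_group 1 T)) \<and>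
     (\<forall>c\<in>carrier (homology_group 1 T). \<exists>!k :: int \<times> int.
        c = e 1 [^]\<^bsub>homology_group 1 T\<^esub> fst k \<otimes>\<^bsub>homology_group 1 T\<^esub> e 2 [^]\<^bsub>homology_group 1 T\<^esub> snd k)"

text \<open>\<open>A\<close> is the matrix, in some basis, of the map induced by \<open>h\<close> on \<open>H\<^sub>1(T; \<int>)\<close>.\<close>

definition H1_matrix :: "'a topology \<Rightarrow> ('a \<Rightarrow> 'a) \<Rightarrow> int^2^2 \<Rightarrow> bool" where
  "H1_matrix T h A \<longleftrightarrow> (\<exists>e. H1_basis T e \<and>
     (\<forall>j. hom_induced 1 T {} T {} h (e j) =
        e 1 [^]\<^bsub>homology_group 1 T\<^esub> (A $ 1 $ j) \<otimes>\<^bsub>homology_group 1 T\<^esub> e 2 [^]\<^bsub>homology_group 1 T\<^esub> (A $ 2 $ j)))"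

definition eigenvalue_of :: "int^2^2 \<Rightarrow> complex \<Rightarrow> bool" where
  "eigenvalue_of A z \<longleftrightarrow>
     (\<exists>v :: complex^2. v \<noteq> 0 \<and> (\<chi> i j. of_int (A $ i $ j)) *v v = z *s v)"

text \<open>A mapping class of the punctured torus is pseudo-Anosov if and only if its action on
  \<open>H\<^sub>1\<close> has trace of absolute value greater than 2.\<close>

definition hyperbolic_monodromy :: "int^2^2 \<Rightarrow> bool" where
  "hyperbolic_monodromy A \<longleftrightarrow> \<bar>trace A\<bar> > 2"

definition untwisted_monodromy :: "int^2^2 \<Rightarrow> bool" where
  "untwisted_monodromy A \<longleftrightarrow> (\<forall>z. eigenvalue_of A z \<longrightarrow> z \<in> \<real> \<and> Re z > 0)"


section \<open>Standard bi-orderings of the fundamental group of a bundle\<close>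

definition standard_bundle_ordering ::
    "'a topology \<Rightarrow> 'a \<Rightarrow> 'b topology \<Rightarrow> ('a \<times> real \<Rightarrow> 'b) \<Rightarrow> ((real \<Rightarrow> 'b) set \<times> (real \<Rightarrow> 'b) set) set \<Rightarrow> bool" where
  "standard_bundle_ordering T x M q r \<longleftrightarrow>
     standard_bi_ordering
       ((fundamental_group M (q (x, 0)))\<lparr>carrier := fibre_subgroup T x M q\<rparr>)
       (Restr r (fibre_subgroup T x M q))"

end

theory Submission
  imports Defs "HOL-Complex_Analysis.Winding_Numbers"
begin

text \<open>
  The fundamental group of the bundle is an extension of the integers by the free group \<open>G\<close> of the
  fibre, so it suffices to find a positive cone of \<open>G\<close> that is invariant under the monodromy and not
  standard. Since both eigenvalues of the action on homology are positive, there are independent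
  characters \<open>p\<^sub>1, p\<^sub>2 : G \<rightarrow> \<real>\<close> that the monodromy multiplies by positive factors.

  Compare first by \<open>p\<^sub>1\<close>. An element of the kernel of \<open>p\<^sub>1\<close> is compared next by the sign, for large
  \<open>s\<close>, of \<open>D\<^sub>s(g)\<close>, where \<open>D\<^sub>s\<close> is a non-principal crossed homomorphism for the action of \<open>G\<close> on
  \<open>\<real>\<close> through \<open>exp (s p\<^sub>1)\<close>; this sign exists because \<open>D\<^sub>s(g)\<close> is a sum of terms \<open>c exp (s k)\<close>.
  On the kernel of \<open>p\<^sub>1\<close> the crossed homomorphisms modulo the principal ones form a line, and the
  monodromy turns \<open>D\<^sub>s\<close> into a positive multiple of some \<open>D\<^sub>t\<close>, so the sign is preserved. The
  remaining elements are compared by the leading coefficient of a Magnus expansion in variables dual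
  to \<open>p\<^sub>1, p\<^sub>2\<close>, on which the monodromy acts by positive scaling.

  Let \<open>c\<close> be the commutator of the generators and \<open>x\<close> an element with \<open>p\<^sub>1(x) > 0\<close>. A standard
  order would give \<open>[c, x] c\<close> and \<open>c\<close>, which agree modulo the third term of the lower central
  series, the same sign; but \<open>D\<^sub>s([c, x] c) = (2 - exp (s p\<^sub>1(x))) D\<^sub>s(c)\<close>.
\<close>

section \<open>Homotopy of paths relative to the endpoints\<close>

text \<open>The delicate point is that the factor relating \<open>D s \<circ> f\<close> to
  \<open>D (l1 * s)\<close> on the kernel of the first character is positive, not merely nonzero.
  Its denominator \<open>D (l1 * s) cc\<close> is a sum of squares. Its numerator
  \<open>D s (f cc)\<close> never vanishes for positive \<open>s\<close>, because \<open>f\<close>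
  is onto, and near \<open>s = 0\<close> it behaves like
  \<open>l1 * l2 * ((p1 a)^2 + (p1 b)^2) * s^2\<close>; so both eigenvalues have to be positive.
  Since the parameter changes from \<open>s\<close> to \<open>l1 * s\<close>, the sign is taken for
  large \<open>s\<close> and not at one fixed \<open>s\<close>.

  Conjugation by an arbitrary element of the bundle group, inside or outside \<open>G\<close>, is
  treated in one way: it is an automorphism of \<open>G\<close> that scales both characters by
  positive factors. Invariance of the cone is thus a single statement.

  The topology supplies three facts: \<open>G\<close> is free on two explicit loops,
  \<open>G\<close> is the kernel of an integer-valued winding on the bundle group, and characters of
  \<open>G\<close> are determined by functionals on first homology. The last one turns left
  eigenvectors of the homology matrix into characters.\<close>

definition path_homotopic :: "'a topology \<Rightarrow> (real \<Rightarrow> 'a) \<Rightarrow> (real \<Rightarrow> 'a) \<Rightarrow> bool" where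
  "path_homotopic X p q \<longleftrightarrow>
     homotopic_with (\<lambda>r. r 0 = p 0 \<and> r 1 = p 1) (top_of_set {0..1}) X p q"

definition path_reverse :: "(real \<Rightarrow> 'a) \<Rightarrow> real \<Rightarrow> 'a" where
  "path_reverse p = (\<lambda>t. p (1 - t))"

lemma path_homotopic_imp:
  assumes "path_homotopic X p q"
  shows "pathin X p" "pathin X q" "q 0 = p 0" "q 1 = p 1"
proof -
  have "continuous_map (top_of_set {0..1}) X p \<and> continuous_map (top_of_set {0..1}) X q"
    using assms unfolding path_homotopic_def by (rule homotopic_with_imp_continuous_maps)
  then show "pathin X p" "pathin X q" by (auto simp: pathin_def)
  show "q 0 = p 0" "q 1 = p 1"
    using homotopic_with_imp_property[OF assms[unfolded path_homotopic_def]] by auto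
qed

lemma path_homotopic_refl: "pathin X p \<Longrightarrow> path_homotopic X p p"
  by (simp add: path_homotopic_def pathin_def)

lemma path_homotopic_sym: "path_homotopic X p q \<Longrightarrow> path_homotopic X q p"
  using path_homotopic_imp[of X p q]
  by (auto simp: path_homotopic_def homotopic_with_sym)

lemma path_homotopic_trans [trans]:
  "path_homotopic X p q \<Longrightarrow> path_homotopic X q r \<Longrightarrow> path_homotopic X p r"
  using path_homotopic_imp[of X p q] unfolding path_homotopic_def
  by (auto intro: homotopic_with_trans)

lemma path_homotopic_eq:
  assumes "pathin X p" "\<And>t. 0 \<le> t \<Longrightarrow> t \<le> 1 \<Longrightarrow> q t = p t"
  shows "path_homotopic X p q"
  unfolding path_homotopic_def
  by (rule homotopic_with_equal) (use assms in \<open>auto simp: pathin_def\<close>)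

lemma path_homotopic_square:
  fixes X :: "'a topology" and H :: "real \<times> real \<Rightarrow> 'a"
  assumes H: "continuous_map (top_of_set ({0..1} \<times> {0..1})) X H"
    and "\<And>t. t \<in> {0..1} \<Longrightarrow> H (0, t) = p t" "\<And>t. t \<in> {0..1} \<Longrightarrow> H (1, t) = q t"
    and "\<And>u. u \<in> {0..1} \<Longrightarrow> H (u, 0) = p 0" "\<And>u. u \<in> {0..1} \<Longrightarrow> H (u, 1) = p 1"
  shows "path_homotopic X p q"
  unfolding path_homotopic_def
proof (subst homotopic_with)
  show "\<And>h k :: real \<Rightarrow> 'a. (\<And>x. x \<in> topspace (top_of_set {0..1}) \<Longrightarrow> h x = k x) \<Longrightarrow>
           (h 0 = p 0 \<and> h 1 = p 1) = (k 0 = p 0 \<and> k 1 = p 1)"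
    subgoal premises h for h k using h[of 0] h[of 1] by simp
    done
  show "\<exists>h :: real \<times> real \<Rightarrow> 'a. continuous_map (prod_topology (top_of_set {0..1}) (top_of_set {0..1})) X h \<and>
        (\<forall>x\<in>topspace (top_of_set {0..1}). h (0, x) = p x) \<and>
        (\<forall>x\<in>topspace (top_of_set {0..1}). h (1, x) = q x) \<and>
        (\<forall>t\<in>{0..1}. h (t, 0) = p 0 \<and> h (t, 1) = p 1)"
    by (rule exI[of _ H]) (use assms in auto)
qed

lemma path_homotopic_square_ex:
  fixes X :: "'a topology"
  assumes "path_homotopic X p q"
  obtains H :: "real \<times> real \<Rightarrow> 'a" where "continuous_map (top_of_set ({0..1} \<times> {0..1})) X H"
    "\<And>t. H (0, t) = p t" "\<And>t. H (1, t) = q t"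
    "\<And>u. u \<in> {0..1} \<Longrightarrow> H (u, 0) = p 0" "\<And>u. u \<in> {0..1} \<Longrightarrow> H (u, 1) = p 1"
proof -
  obtain h :: "real \<times> real \<Rightarrow> 'a" where "continuous_map (top_of_set ({0..1} \<times> {0..1})) X h"
    "\<And>t. h (0, t) = p t" "\<And>t. h (1, t) = q t"
    "\<And>u. u \<in> {0..1} \<Longrightarrow> h (u, 0) = p 0 \<and> h (u, 1) = p 1"
    using assms unfolding path_homotopic_def homotopic_with_def prod_topology_subtopology_eu by blast
  then show thesis by (intro that[of h]) blast+
qed

lemma path_homotopic_map:
  assumes "continuous_map X Y f" "path_homotopic X p q"
  shows "path_homotopic Y (f \<circ> p) (f \<circ> q)"
  unfolding path_homotopic_def
  by (rule homotopic_with_compose_continuous_map_left[OF assms(2)[unfolded path_homotopic_def] assms(1)])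
     auto

lemma path_homotopic_of_homotopic_paths:
  assumes "continuous_map (top_of_set C) X F" "homotopic_paths C r r'"
  shows "path_homotopic X (F \<circ> r) (F \<circ> r')"
  unfolding path_homotopic_def
  by (rule homotopic_with_compose_continuous_map_left[OF assms(2)[unfolded homotopic_paths_def] assms(1)])
     (auto simp: pathstart_def pathfinish_def)

lemma path_homotopic_simply_connected:
  fixes C :: "'c::real_normed_vector set"
  assumes "continuous_map (top_of_set C) X F" "simply_connected C"
    and "continuous_on {0..1} r" "r \<in> {0..1} \<rightarrow> C"
    and "continuous_on {0..1} r'" "r' \<in> {0..1} \<rightarrow> C"
    and "r 0 = r' 0" "r 1 = r' 1"
  shows "path_homotopic X (F \<circ> r) (F \<circ> r')"
proof (rule path_homotopic_of_homotopic_paths[OF assms(1)])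
  show "homotopic_paths C r r'"
    using assms(2-) unfolding simply_connected_eq_homotopic_paths
    by (auto simp: path_def path_image_def pathstart_def pathfinish_def image_subset_iff_funcset)
qed

text \<open>Both reparametrisations are paths in the convex set \<open>{0..1}\<close> with common
  endpoints, hence homotopic there, and \<open>p\<close> carries the homotopy to \<open>X\<close>.
  The group laws for loop classes are instances.\<close>

lemma path_homotopic_reparam:
  assumes "pathin X p" "continuous_on {0..1} f" "f \<in> {0..1} \<rightarrow> {0..1}"
    "continuous_on {0..1} g" "g \<in> {0..1} \<rightarrow> {0..1}" "f 0 = g 0" "f 1 = g 1"
  shows "path_homotopic X (p \<circ> f) (p \<circ> g)"
  by (rule path_homotopic_simply_connected[of "{0..1::real}"])
     (use assms in \<open>auto simp: pathin_def convex_imp_simply_connected\<close>)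

text \<open>Paths are total functions on the reals whose values outside the unit interval are
  irrelevant, so the equations are asked for on \<open>{0..1}\<close> alone.\<close>

lemma path_homotopic_reparam':
  assumes "pathin X p" "continuous_on {0..1} f" "f \<in> {0..1} \<rightarrow> {0..1}"
    "continuous_on {0..1} g" "g \<in> {0..1} \<rightarrow> {0..1}" "f 0 = g 0" "f 1 = g 1"
    "\<And>t. 0 \<le> t \<Longrightarrow> t \<le> 1 \<Longrightarrow> q t = p (f t)" "\<And>t. 0 \<le> t \<Longrightarrow> t \<le> 1 \<Longrightarrow> r t = p (g t)"
  shows "path_homotopic X q r"
proof -
  have h: "path_homotopic X (p \<circ> f) (p \<circ> g)"
    using assms by (intro path_homotopic_reparam) auto
  have "path_homotopic X q (p \<circ> f)"
    by (rule path_homotopic_sym, rule path_homotopic_eq)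
       (use assms(8) path_homotopic_imp(1)[OF h] in auto)
  also note h
  also have "path_homotopic X (p \<circ> g) r"
    by (rule path_homotopic_eq) (use assms(9) path_homotopic_imp(2)[OF h] in auto)
  finally show ?thesis .
qed

lemma path_homotopic_concat:
  assumes "path_homotopic X p p'" "path_homotopic X q q'" "p 1 = q 0"
  shows "path_homotopic X (loop_concat p q) (loop_concat p' q')"
proof -
  obtain H :: "real \<times> real \<Rightarrow> 'a" where H: "continuous_map (top_of_set ({0..1} \<times> {0..1})) X H"
    "\<And>t. H (0, t) = p t" "\<And>t. H (1, t) = p' t"
    "\<And>u. u \<in> {0..1} \<Longrightarrow> H (u, 0) = p 0" "\<And>u. u \<in> {0..1} \<Longrightarrow> H (u, 1) = p 1"
    using path_homotopic_square_ex[OF assms(1)] by metis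
  obtain J :: "real \<times> real \<Rightarrow> 'a" where J: "continuous_map (top_of_set ({0..1} \<times> {0..1})) X J"
    "\<And>t. J (0, t) = q t" "\<And>t. J (1, t) = q' t"
    "\<And>u. u \<in> {0..1} \<Longrightarrow> J (u, 0) = q 0" "\<And>u. u \<in> {0..1} \<Longrightarrow> J (u, 1) = q 1"
    using path_homotopic_square_ex[OF assms(2)] by metis
  define K where "K = (\<lambda>z::real\<times>real. if snd z \<le> 1/2 then H (fst z, 2 * snd z) else J (fst z, 2 * snd z - 1))"
  have "continuous_map (top_of_set ({0..1} \<times> {0..1})) X K"
    unfolding K_def
  proof (rule continuous_map_cases_le)
    show "continuous_map (top_of_set ({0..1} \<times> {0..1})) euclideanreal (snd :: real\<times>real\<Rightarrow>real)"
      by (auto intro!: continuous_intros)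
    show "continuous_map (top_of_set ({0..1} \<times> {0..1})) euclideanreal (\<lambda>z::real\<times>real. 1/2)"
      by (auto intro!: continuous_intros)
    show "continuous_map (subtopology (top_of_set ({0..1} \<times> {0..1}))
             {x \<in> topspace (top_of_set ({0..1} \<times> {0..1})). snd x \<le> 1/2}) X (\<lambda>z::real\<times>real. H (fst z, 2 * snd z))"
      unfolding subtopology_subtopology
      by (rule continuous_map_compose[OF _ H(1), unfolded o_def]) (auto intro!: continuous_intros)
    show "continuous_map (subtopology (top_of_set ({0..1} \<times> {0..1}))
             {x \<in> topspace (top_of_set ({0..1} \<times> {0..1})). 1/2 \<le> snd x}) X (\<lambda>z::real\<times>real. J (fst z, 2 * snd z - 1))"
      unfolding subtopology_subtopology
      by (rule continuous_map_compose[OF _ J(1), unfolded o_def]) (auto intro!: continuous_intros)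
    fix z :: "real \<times> real" assume "z \<in> topspace (top_of_set ({0..1} \<times> {0..1}))" and *: "snd z = 1/2"
    then have "fst z \<in> {0..1}" by auto
    moreover have "2 * snd z = 1" "2 * snd z - 1 = 0" using * by auto
    ultimately show "H (fst z, 2 * snd z) = J (fst z, 2 * snd z - 1)"
      using H(5) J(4) assms(3) by metis
  qed
  then show ?thesis
    by (rule path_homotopic_square) (use H J in \<open>auto simp: K_def loop_concat_def\<close>)
qed

lemma pathin_concat: "pathin X p \<Longrightarrow> pathin X q \<Longrightarrow> p 1 = q 0 \<Longrightarrow> pathin X (loop_concat p q)"
  using path_homotopic_concat path_homotopic_refl path_homotopic_imp(1) by metis

lemma loop_concat_ends [simp]: "loop_concat p q 0 = p 0" "loop_concat p q 1 = q 1"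
  by (auto simp: loop_concat_def)

lemma path_reverse_ends [simp]: "path_reverse p 0 = p 1" "path_reverse p 1 = p 0"
  by (auto simp: path_reverse_def)

lemma path_reverse_reverse [simp]: "path_reverse (path_reverse p) = p"
  by (auto simp: path_reverse_def)

lemma path_homotopic_reverse:
  assumes "path_homotopic X p q"
  shows "path_homotopic X (path_reverse p) (path_reverse q)"
proof -
  have "homotopic_with (\<lambda>r. r 0 = p 1 \<and> r 1 = p 0) (top_of_set {0..1}) X (p \<circ> (\<lambda>t. 1 - t)) (q \<circ> (\<lambda>t. 1 - t))"
    by (rule homotopic_with_compose_continuous_map_right[OF assms[unfolded path_homotopic_def]])
       (auto intro!: continuous_intros)
  then show ?thesis by (simp add: path_homotopic_def path_reverse_def o_def)
qed

lemma pathin_reverse: "pathin X p \<Longrightarrow> pathin X (path_reverse p)"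
  using path_homotopic_reverse path_homotopic_refl path_homotopic_imp(1) by metis

lemma map_loop_concat: "f \<circ> loop_concat p q = loop_concat (f \<circ> p) (f \<circ> q)"
  by (auto simp: loop_concat_def)

lemma map_path_reverse: "f \<circ> path_reverse p = path_reverse (f \<circ> p)"
  by (auto simp: path_reverse_def)

lemma pathin_map: "continuous_map X Y f \<Longrightarrow> pathin X p \<Longrightarrow> pathin Y (f \<circ> p)"
  by (auto simp: pathin_def intro: continuous_map_compose)

lemma pathin_in: "pathin X p \<Longrightarrow> 0 \<le> t \<Longrightarrow> t \<le> 1 \<Longrightarrow> p t \<in> topspace X"
  by (auto simp: pathin_def continuous_map_def)

lemma path_homotopic_assoc:
  assumes "pathin X p" "pathin X q" "pathin X r" "p 1 = q 0" "q 1 = r 0"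
  shows "path_homotopic X (loop_concat (loop_concat p q) r) (loop_concat p (loop_concat q r))"
proof (rule path_homotopic_reparam')
  show "pathin X (loop_concat p (loop_concat q r))"
    using assms by (auto intro!: pathin_concat)
  \<comment> \<open>The minimum of three lines of slopes 2, 1 and 1/2 maps the breakpoints 1/4, 1/2,
    1 of the left bracketing to the breakpoints 1/2, 3/4, 1 of the right one.\<close>
  show "continuous_on {0..1} (\<lambda>t. min (2 * t) (min (t + 1/4) (t/2 + 1/2)) :: real)"
    "continuous_on {0..1} (\<lambda>t. t :: real)"
    by (auto intro!: continuous_intros)
  fix t :: real assume t: "0 \<le> t" "t \<le> 1"
  consider "t \<le> 1/4" | "1/4 < t" "t \<le> 1/2" | "1/2 < t" by linarith
  then show "loop_concat (loop_concat p q) r t = loop_concat p (loop_concat q r) (min (2 * t) (min (t + 1/4) (t/2 + 1/2)))"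
  proof cases
    case 1
    then have "min (2 * t) (min (t + 1/4) (t/2 + 1/2)) = 2 * t" by auto
    then show ?thesis using 1 by (simp add: loop_concat_def)
  next
    case 2
    then have "min (2 * t) (min (t + 1/4) (t/2 + 1/2)) = t + 1/4" by auto
    then show ?thesis using 2 by (simp add: loop_concat_def algebra_simps)
  next
    case 3
    then have "min (2 * t) (min (t + 1/4) (t/2 + 1/2)) = t/2 + 1/2" by auto
    then show ?thesis using 3 by (simp add: loop_concat_def algebra_simps)
  qed
qed auto

lemma path_homotopic_rid:
  assumes "pathin X p" shows "path_homotopic X (loop_concat p (\<lambda>_. p 1)) p"
proof (rule path_homotopic_reparam'[of X p "\<lambda>t. min (2*t) 1" "\<lambda>t. t"])
  show "loop_concat p (\<lambda>_. p 1) t = p (min (2*t) 1)" for t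
    by (simp add: loop_concat_def min_def)
qed (use assms in \<open>auto intro!: continuous_intros\<close>)

lemma path_homotopic_lid:
  assumes "pathin X p" shows "path_homotopic X (loop_concat (\<lambda>_. p 0) p) p"
proof (rule path_homotopic_reparam'[of X p "\<lambda>t. max (2*t-1) 0" "\<lambda>t. t"])
  show "loop_concat (\<lambda>_. p 0) p t = p (max (2*t-1) 0)" for t
    by (simp add: loop_concat_def max_def)
qed (use assms in \<open>auto intro!: continuous_intros\<close>)

lemma path_homotopic_rinv:
  assumes "pathin X p" shows "path_homotopic X (loop_concat p (path_reverse p)) (\<lambda>_. p 0)"
\<comment> \<open>The concatenation runs along \<open>p\<close> to the parameter
  \<open>min (2*t) (2-2*t)\<close>, out and back, which is compared with staying at 0.\<close>
proof (rule path_homotopic_reparam'[of X p "\<lambda>t. min (2*t) (2-2*t)" "\<lambda>t. 0"])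
  fix t :: real assume t: "0 \<le> t" "t \<le> 1"
  then show "loop_concat p (path_reverse p) t = p (min (2*t) (2-2*t))"
    by (cases "t \<le> 1/2") (auto simp: loop_concat_def path_reverse_def min_def algebra_simps)
qed (use assms in \<open>auto intro!: continuous_intros\<close>)

lemma path_homotopic_linv:
  assumes "pathin X p" shows "path_homotopic X (loop_concat (path_reverse p) p) (\<lambda>_. p 1)"
  using path_homotopic_rinv[OF pathin_reverse[OF assms]] by simp

lemma pathin_const_iff: "pathin X (\<lambda>_. y) \<longleftrightarrow> y \<in> topspace X"
  by (auto simp: pathin_def)

text \<open>The two routes from the corner (0,0) to the corner (1,1) along the edges are homotopic
  in the convex square. This yields the relation between the stable letter and the fibre
  group.\<close>

lemma path_homotopic_square_edges:
  fixes H :: "real \<times> real \<Rightarrow> 'a"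
  assumes H: "continuous_map (top_of_set ({0..1} \<times> {0..1})) X H"
  shows "path_homotopic X (loop_concat (\<lambda>t. H (t, 0)) (\<lambda>t. H (1, t))) (loop_concat (\<lambda>t. H (0, t)) (\<lambda>t. H (t, 1)))"
proof -
  have "path_homotopic X (H \<circ> (\<lambda>t. (min (2*t) 1, max 0 (2*t-1)))) (H \<circ> (\<lambda>t. (max 0 (2*t-1), min (2*t) 1)))"
    by (rule path_homotopic_simply_connected[OF H])
       (auto intro!: continuous_intros convex_imp_simply_connected convex_Times)
  moreover have "H \<circ> (\<lambda>t. (min (2*t) 1, max 0 (2*t-1))) = loop_concat (\<lambda>t. H (t, 0)) (\<lambda>t. H (1, t))" (is "?l = ?r")
  proof
    fix t :: real
    consider "t < 1/2" | "t = 1/2" | "t > 1/2" by linarith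
    then show "?l t = ?r t" by cases (auto simp: loop_concat_def)
  qed
  moreover have "H \<circ> (\<lambda>t. (max 0 (2*t-1), min (2*t) 1)) = loop_concat (\<lambda>t. H (0, t)) (\<lambda>t. H (t, 1))" (is "?l = ?r")
  proof
    fix t :: real
    consider "t < 1/2" | "t = 1/2" | "t > 1/2" by linarith
    then show "?l t = ?r t" by cases (auto simp: loop_concat_def)
  qed
  ultimately show ?thesis by metis
qed

section \<open>The fundamental group\<close>

lemma loop_class_eq: "p \<in> loops X x \<Longrightarrow> loop_class X x p = {q. path_homotopic X p q}"
  by (auto simp: loop_class_def loop_homotopic_def path_homotopic_def loops_def)

lemma loop_class_eq_iff:
  assumes "p \<in> loops X x" "q \<in> loops X x"
  shows "loop_class X x p = loop_class X x q \<longleftrightarrow> path_homotopic X p q"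
proof -
  have "path_homotopic X q q" using assms by (auto simp: loops_def path_homotopic_refl)
  then show ?thesis using assms
    by (auto simp: loop_class_eq set_eq_iff dest: path_homotopic_trans path_homotopic_sym)
qed

lemma loops_concat: "p \<in> loops X x \<Longrightarrow> q \<in> loops X x \<Longrightarrow> loop_concat p q \<in> loops X x"
  by (auto simp: loops_def intro!: pathin_concat)

lemma loops_reverse: "p \<in> loops X x \<Longrightarrow> path_reverse p \<in> loops X x"
  by (auto simp: loops_def intro!: pathin_reverse)

lemma loops_const: "x \<in> topspace X \<Longrightarrow> (\<lambda>_. x) \<in> loops X x"
  by (auto simp: loops_def pathin_const_iff)

lemma loops_homotopic: "p \<in> loops X x \<Longrightarrow> path_homotopic X p q \<Longrightarrow> q \<in> loops X x"
  using path_homotopic_imp by (fastforce simp: loops_def)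

lemma fundamental_group_carrier: "carrier (fundamental_group X x) = loop_class X x ` loops X x"
  by (simp add: fundamental_group_def)

lemma fundamental_group_one: "\<one>\<^bsub>fundamental_group X x\<^esub> = loop_class X x (\<lambda>_. x)"
  by (simp add: fundamental_group_def)

lemma loop_class_self: "p \<in> loops X x \<Longrightarrow> p \<in> loop_class X x p"
  by (auto simp: loop_class_eq loops_def path_homotopic_refl)

text \<open>The product is defined as a union over all pairs of representatives; concatenation
  respects homotopy, so all members of that union are the same class.\<close>

lemma fundamental_group_mult:
  assumes "p \<in> loops X x" "q \<in> loops X x"
  shows "loop_class X x p \<otimes>\<^bsub>fundamental_group X x\<^esub> loop_class X x q = loop_class X x (loop_concat p q)"
proof -
  have "loop_class X x (loop_concat p' q') = loop_class X x (loop_concat p q)"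
    if "p' \<in> loop_class X x p" "q' \<in> loop_class X x q" for p' q'
  proof -
    have h: "path_homotopic X p p'" "path_homotopic X q q'"
      using that assms by (auto simp: loop_class_eq)
    then have "p' \<in> loops X x" "q' \<in> loops X x"
      using loops_homotopic[OF assms(1) h(1)] loops_homotopic[OF assms(2) h(2)] by auto
    moreover have "path_homotopic X (loop_concat p q) (loop_concat p' q')"
      using h assms by (intro path_homotopic_concat) (auto simp: loops_def)
    ultimately show ?thesis
      using assms by (subst loop_class_eq_iff) (auto intro: loops_concat path_homotopic_sym)
  qed
  then have "(\<Union>p'\<in>loop_class X x p. \<Union>q'\<in>loop_class X x q. loop_class X x (loop_concat p' q')) =
      (\<Union>p'\<in>loop_class X x p. \<Union>q'\<in>loop_class X x q. loop_class X x (loop_concat p q))"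
    by (intro SUP_cong refl) simp
  also have "\<dots> = loop_class X x (loop_concat p q)"
    using loop_class_self[OF assms(1)] loop_class_self[OF assms(2)] by (auto simp: SUP_constant)
  finally show ?thesis
    by (simp add: fundamental_group_def)
qed

lemma fundamental_group_group:
  assumes "x \<in> topspace X" shows "group (fundamental_group X x)"
proof (rule groupI)
  let ?G = "fundamental_group X x"
  fix a b c assume "a \<in> carrier ?G" "b \<in> carrier ?G" "c \<in> carrier ?G"
  then obtain p q r where l: "p \<in> loops X x" "q \<in> loops X x" "r \<in> loops X x"
    and e: "a = loop_class X x p" "b = loop_class X x q" "c = loop_class X x r"
    by (auto simp: fundamental_group_carrier)
  show "a \<otimes>\<^bsub>?G\<^esub> b \<in> carrier ?G"
    using l by (auto simp: e fundamental_group_mult fundamental_group_carrier intro: loops_concat)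
  show "a \<otimes>\<^bsub>?G\<^esub> b \<otimes>\<^bsub>?G\<^esub> c = a \<otimes>\<^bsub>?G\<^esub> (b \<otimes>\<^bsub>?G\<^esub> c)"
    using l by (simp add: e fundamental_group_mult loops_concat loop_class_eq_iff)
       (auto simp: loops_def intro!: path_homotopic_assoc)
next
  let ?G = "fundamental_group X x"
  show "\<one>\<^bsub>?G\<^esub> \<in> carrier ?G"
    using assms by (auto simp: fundamental_group_one fundamental_group_carrier intro: loops_const)
  fix a assume "a \<in> carrier ?G"
  then obtain p where l: "p \<in> loops X x" and e: "a = loop_class X x p"
    by (auto simp: fundamental_group_carrier)
  show "\<one>\<^bsub>?G\<^esub> \<otimes>\<^bsub>?G\<^esub> a = a"
    using l assms path_homotopic_lid[of X p]
    by (simp add: e fundamental_group_one fundamental_group_mult loops_concat loop_class_eq_iff loops_const)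
       (auto simp: loops_def)
  have "loop_class X x (path_reverse p) \<otimes>\<^bsub>?G\<^esub> a = \<one>\<^bsub>?G\<^esub>"
    using l assms path_homotopic_linv[of X p]
    by (simp add: e fundamental_group_one fundamental_group_mult loops_concat loop_class_eq_iff loops_const loops_reverse)
       (auto simp: loops_def)
  then show "\<exists>y\<in>carrier ?G. y \<otimes>\<^bsub>?G\<^esub> a = \<one>\<^bsub>?G\<^esub>"
    using l by (auto simp: fundamental_group_carrier intro: loops_reverse)
qed

lemma fundamental_group_inv:
  assumes "p \<in> loops X x"
  shows "inv\<^bsub>fundamental_group X x\<^esub> loop_class X x p = loop_class X x (path_reverse p)"
proof -
  let ?G = "fundamental_group X x"
  have x: "x \<in> topspace X" using assms pathin_in[of X p 0] by (auto simp: loops_def)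
  interpret group ?G by (rule fundamental_group_group[OF x])
  have "loop_class X x (path_reverse p) \<otimes>\<^bsub>?G\<^esub> loop_class X x p = \<one>\<^bsub>?G\<^esub>"
    using assms x path_homotopic_linv[of X p]
    by (simp add: fundamental_group_one fundamental_group_mult loops_concat loop_class_eq_iff loops_const loops_reverse)
       (auto simp: loops_def)
  then show ?thesis
    using assms by (intro inv_equality) (auto simp: fundamental_group_carrier loops_reverse)
qed

lemma fundamental_induced_class:
  assumes "continuous_map X Y f" "p \<in> loops X x"
  shows "fundamental_induced Y (f x) f (loop_class X x p) = loop_class Y (f x) (f \<circ> p)"
proof -
  have fl: "f \<circ> q \<in> loops Y (f x)" if "q \<in> loops X x" for q
    using that assms(1) by (auto simp: loops_def intro: pathin_map)
  have "loop_class Y (f x) (f \<circ> q) = loop_class Y (f x) (f \<circ> p)" if "q \<in> loop_class X x p" for q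
  proof -
    have h: "path_homotopic X p q" using that assms by (auto simp: loop_class_eq)
    have "q \<in> loops X x" by (rule loops_homotopic[OF assms(2) h])
    then show ?thesis
      using fl assms path_homotopic_map[OF assms(1) path_homotopic_sym[OF h]] by (simp add: loop_class_eq_iff)
  qed
  then have "(\<Union>q\<in>loop_class X x p. loop_class Y (f x) (f \<circ> q)) =
      (\<Union>q\<in>loop_class X x p. loop_class Y (f x) (f \<circ> p))"
    by (intro SUP_cong refl) simp
  also have "\<dots> = loop_class Y (f x) (f \<circ> p)"
    using loop_class_self[OF assms(2)] by (auto simp: SUP_constant)
  finally show ?thesis
    by (simp add: fundamental_induced_def)
qed

lemma map_loops: "continuous_map X Y f \<Longrightarrow> p \<in> loops X x \<Longrightarrow> f \<circ> p \<in> loops Y (f x)"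
  by (auto simp: loops_def intro: pathin_map)

lemma fundamental_induced_hom:
  assumes "continuous_map X Y f"
  shows "fundamental_induced Y (f x) f \<in> hom (fundamental_group X x) (fundamental_group Y (f x))"
  by (rule homI) (use assms in \<open>auto simp: fundamental_group_carrier fundamental_induced_class
      fundamental_group_mult loops_concat map_loops map_loop_concat\<close>)

lemma fundamental_induced_comp:
  assumes "continuous_map X Y f" "continuous_map Y Z g" "c \<in> carrier (fundamental_group X x)"
  shows "fundamental_induced Z (g (f x)) g (fundamental_induced Y (f x) f c) =
         fundamental_induced Z (g (f x)) (g \<circ> f) c"
  using assms continuous_map_compose[OF assms(1,2)]
    fundamental_induced_class[of X Z "g \<circ> f"]
  by (auto simp: fundamental_group_carrier fundamental_induced_class map_loops o_assoc)

lemma fundamental_induced_id: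
  assumes "\<And>y. y \<in> topspace X \<Longrightarrow> f y = y" "x \<in> topspace X" "c \<in> carrier (fundamental_group X x)"
  shows "fundamental_induced X x f c = c"
proof -
  obtain p where p: "p \<in> loops X x" "c = loop_class X x p"
    using assms(3) by (auto simp: fundamental_group_carrier)
  have c: "continuous_map X X f"
    by (rule continuous_map_eq[of X X id]) (use assms in auto)
  have "path_homotopic X p (f \<circ> p)"
    by (rule path_homotopic_eq) (use p assms in \<open>auto simp: loops_def intro: pathin_in\<close>)
  then have "loop_class X x (f \<circ> p) = loop_class X x p"
    using p loops_homotopic[OF p(1)] by (simp add: loop_class_eq_iff path_homotopic_sym)
  then show ?thesis
    using fundamental_induced_class[OF c p(1)] assms p by simp
qed

section \<open>Paths as loops, via a choice of paths from the base point\<close>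

text \<open>One path from the base point to every point, chosen without any continuity in the
  endpoint. Closing up with these paths turns an arbitrary path into a loop, so that
  \<open>lp\<close> is multiplicative on all composable paths; the constant choice at
  \<open>x\<close> makes \<open>lp\<close> of a loop its own class.\<close>

locale spanning_paths =
  fixes X :: "'a topology" and x :: 'a and k :: "'a \<Rightarrow> real \<Rightarrow> 'a"
  assumes base: "x \<in> topspace X"
    and k_path: "\<And>y. y \<in> topspace X \<Longrightarrow> pathin X (k y) \<and> k y 0 = x \<and> k y 1 = y"
    and k_base: "k x = (\<lambda>_. x)"
begin

abbreviation "PI \<equiv> fundamental_group X x"

definition close_up :: "(real \<Rightarrow> 'a) \<Rightarrow> (real \<Rightarrow> 'a)" where
  "close_up r = loop_concat (k (r 0)) (loop_concat r (path_reverse (k (r 1))))"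

definition lp :: "(real \<Rightarrow> 'a) \<Rightarrow> (real \<Rightarrow> 'a) set" where
  "lp r = loop_class X x (close_up r)"

sublocale PI: group PI by (rule fundamental_group_group[OF base])

lemma close_up_loops: "pathin X r \<Longrightarrow> close_up r \<in> loops X x"
  using k_path pathin_in[of X r 0] pathin_in[of X r 1]
  by (auto simp: close_up_def loops_def intro!: pathin_concat pathin_reverse)

lemma lp_carrier [simp]: "pathin X r \<Longrightarrow> lp r \<in> carrier PI"
  by (auto simp: lp_def fundamental_group_carrier close_up_loops)

lemma lp_homotopic:
  assumes "path_homotopic X r s" shows "lp r = lp s"
proof -
  note i = path_homotopic_imp[OF assms]
  have k: "pathin X (k (r 0))" "pathin X (path_reverse (k (r 1)))" "k (r 0) 1 = r 0" "k (r 1) 1 = r 1"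
    using k_path pathin_in[OF i(1), of 0] pathin_in[OF i(1), of 1] by (auto intro: pathin_reverse)
  have "path_homotopic X (close_up r) (close_up s)"
    unfolding close_up_def i(3,4) using k assms
    by (auto intro!: path_homotopic_concat path_homotopic_refl)
  then show ?thesis
    using close_up_loops i by (simp add: lp_def loop_class_eq_iff)
qed

text \<open>Since \<open>r 1 = s 0\<close>, the path that closes up \<open>r\<close> is the reverse
  of the path that opens \<open>s\<close>, and the two cancel in the middle.\<close>

lemma lp_concat:
  assumes r: "pathin X r" and s: "pathin X s" and rs: "r 1 = s 0"
  shows "lp (loop_concat r s) = lp r \<otimes>\<^bsub>PI\<^esub> lp s"
proof -
  define a where "a = k (r 0)"
  define c where "c = k (r 1)"
  define e where "e = path_reverse (k (s 1))"
  have p: "pathin X a" "pathin X c" "pathin X (path_reverse c)" "pathin X e"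
    and q: "a 0 = x" "a 1 = r 0" "c 0 = x" "c 1 = r 1" "e 0 = s 1" "e 1 = x"
    using k_path pathin_in[OF r, of 0] pathin_in[OF r, of 1] pathin_in[OF s, of 1]
    by (auto simp: a_def c_def e_def intro: pathin_reverse)
  let ?D = "loop_concat s e"
  have D: "pathin X ?D" using p q s by (auto intro: pathin_concat)
  have 1: "path_homotopic X (loop_concat (loop_concat r (path_reverse c)) (loop_concat c ?D)) (loop_concat r ?D)"
  proof -
    have "path_homotopic X (loop_concat (loop_concat r (path_reverse c)) (loop_concat c ?D))
        (loop_concat r (loop_concat (path_reverse c) (loop_concat c ?D)))"
      using p q r s rs D by (intro path_homotopic_assoc) (auto intro: pathin_concat)
    also have "path_homotopic X \<dots> (loop_concat r (loop_concat (loop_concat (path_reverse c) c) ?D))"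
      using p q r s rs D
      by (intro path_homotopic_concat path_homotopic_refl path_homotopic_sym[OF path_homotopic_assoc])
         (auto intro: pathin_concat)
    also have "path_homotopic X \<dots> (loop_concat r (loop_concat (\<lambda>_. c 1) ?D))"
      using p q r s rs D
      by (intro path_homotopic_concat path_homotopic_refl path_homotopic_linv) auto
    also have "path_homotopic X \<dots> (loop_concat r ?D)"
      using p q r s rs D path_homotopic_lid[OF D]
      by (intro path_homotopic_concat[OF path_homotopic_refl]) auto
    finally show ?thesis .
  qed
  have "path_homotopic X (loop_concat (close_up r) (close_up s))
      (loop_concat a (loop_concat (loop_concat r (path_reverse c)) (loop_concat c ?D)))"
    unfolding close_up_def a_def[symmetric] c_def[symmetric] rs[symmetric] e_def[symmetric]
    using p q r s rs D by (intro path_homotopic_assoc) (auto intro: pathin_concat)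
  also have "path_homotopic X \<dots> (loop_concat a (loop_concat r ?D))"
    using p q r s rs 1 by (intro path_homotopic_concat[OF path_homotopic_refl]) auto
  also have "path_homotopic X \<dots> (loop_concat a (loop_concat (loop_concat r s) e))"
    using p q r s rs
    by (intro path_homotopic_concat path_homotopic_refl path_homotopic_sym[OF path_homotopic_assoc]) auto
  also have "\<dots> = close_up (loop_concat r s)"
    by (simp add: close_up_def a_def e_def)
  finally have "path_homotopic X (loop_concat (close_up r) (close_up s)) (close_up (loop_concat r s))" .
  then show ?thesis
    unfolding lp_def using close_up_loops r s rs
    by (simp add: fundamental_group_mult loop_class_eq_iff loops_concat pathin_concat path_homotopic_sym)
qed

lemma lp_loop:
  assumes "p \<in> loops X x" shows "lp p = loop_class X x p"
proof -
  have r: "path_reverse (\<lambda>_. x) = (\<lambda>_. x)" by (simp add: path_reverse_def)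
  have p: "pathin X p" "p 0 = x" "p 1 = x" using assms by (auto simp: loops_def)
  have 2: "path_homotopic X (loop_concat p (\<lambda>_. x)) p"
    using path_homotopic_rid[OF p(1)] p by simp
  have "path_homotopic X (close_up p) (loop_concat (\<lambda>_. x) p)"
    using p 2 base by (simp add: close_up_def k_base r)
       (intro path_homotopic_concat[OF path_homotopic_refl], auto simp: pathin_const_iff)
  also have "path_homotopic X \<dots> p" using path_homotopic_lid[OF p(1)] p by simp
  finally show ?thesis
    using close_up_loops assms p by (simp add: lp_def loop_class_eq_iff)
qed

lemma lp_const: assumes "y \<in> topspace X" shows "lp (\<lambda>_. y) = \<one>\<^bsub>PI\<^esub>"
proof -
  have c: "pathin X (\<lambda>_. y)" using assms by (simp add: pathin_const_iff)
  have "loop_concat (\<lambda>_. y) (\<lambda>_. y) = (\<lambda>_. y)" by (auto simp: loop_concat_def)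
  then have "lp (\<lambda>_. y) \<otimes>\<^bsub>PI\<^esub> lp (\<lambda>_. y) = lp (\<lambda>_. y)"
    using lp_concat[OF c c] by simp
  then show ?thesis using PI.l_cancel_one[of "lp (\<lambda>_. y)" "lp (\<lambda>_. y)"] c by simp
qed

lemma lp_reverse:
  assumes "pathin X r" shows "lp (path_reverse r) = inv\<^bsub>PI\<^esub> lp r"
proof -
  have "lp (path_reverse r) \<otimes>\<^bsub>PI\<^esub> lp r = lp (loop_concat (path_reverse r) r)"
    using assms by (simp add: lp_concat pathin_reverse)
  also have "\<dots> = \<one>\<^bsub>PI\<^esub>"
    using lp_homotopic[OF path_homotopic_linv[OF assms]] lp_const pathin_in[OF assms, of 1] by simp
  finally show ?thesis using assms by (metis PI.inv_equality lp_carrier pathin_reverse)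
qed

lemma lp_k: assumes "y \<in> topspace X" shows "lp (k y) = \<one>\<^bsub>PI\<^esub>"
proof -
  note k = k_path[OF assms]
  have r: "path_reverse (\<lambda>_. x) = (\<lambda>_. x)" by (simp add: path_reverse_def)
  have kr: "pathin X (path_reverse (k y))" using k by (simp add: pathin_reverse)
  have 1: "path_homotopic X (loop_concat (k y) (path_reverse (k y))) (\<lambda>_. x)"
    using path_homotopic_rinv[of X "k y"] k by simp
  have l: "loop_concat (k y) (path_reverse (k y)) \<in> loops X x" using k kr by (auto simp: loops_def intro!: pathin_concat)
  have "path_homotopic X (close_up (k y)) (loop_concat (k y) (path_reverse (k y)))"
    using path_homotopic_lid[of X "loop_concat (k y) (path_reverse (k y))"] l k
    by (simp add: close_up_def k_base loops_def)
  then have "path_homotopic X (close_up (k y)) (\<lambda>_. x)" using 1 by (rule path_homotopic_trans)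
  then show ?thesis unfolding lp_def fundamental_group_one
    using close_up_loops k base by (subst loop_class_eq_iff) (auto intro: loops_const)
qed

end

lemma spanning_paths_exist:
  assumes "path_connected_space X" "x \<in> topspace X"
  shows "\<exists>k. spanning_paths X x k"
proof -
  have "\<exists>g. pathin X g \<and> g 0 = x \<and> g 1 = y" if "y \<in> topspace X" for y
    using assms that by (auto simp: path_connected_space_def)
  then obtain k where k: "\<And>y. y \<in> topspace X \<Longrightarrow> pathin X (k y) \<and> k y 0 = x \<and> k y 1 = y"
    by metis
  have "spanning_paths X x (k(x := (\<lambda>_. x)))"
    by unfold_locales (use k assms in \<open>auto simp: pathin_const_iff\<close>)
  then show ?thesis by blast
qed

section \<open>Subdivision of paths and homotopies\<close>

lemma cover_Lebesgue:
  fixes K :: "'c::heine_borel set"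
  assumes K: "compact K" and F: "continuous_map (top_of_set K) X F"
    and op: "\<And>U. U \<in> \<U> \<Longrightarrow> openin X U" and cov: "topspace X \<subseteq> \<Union>\<U>" and ne: "\<U> \<noteq> {}"
  obtains d where "d > 0" "\<And>S. S \<subseteq> K \<Longrightarrow> diameter S < d \<Longrightarrow> \<exists>U\<in>\<U>. F ` S \<subseteq> U"
proof -
  have "\<exists>V. open V \<and> {y \<in> K. F y \<in> U} = K \<inter> V" if "U \<in> \<U>" for U
    using F op[OF that] by (auto simp: continuous_map_def openin_open)
  then obtain V where V: "\<And>U. U \<in> \<U> \<Longrightarrow> open (V U) \<and> {y \<in> K. F y \<in> U} = K \<inter> V U" by metis
  have 1: "K \<subseteq> \<Union>(V ` \<U>)"
  proof
    fix y assume y: "y \<in> K"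
    then have "F y \<in> topspace X" using F by (auto simp: continuous_map_def)
    then obtain U where "U \<in> \<U>" "F y \<in> U" using cov by auto
    then show "y \<in> \<Union>(V ` \<U>)" using V[of U] y by blast
  qed
  obtain d where d: "d > 0" "\<And>S. S \<subseteq> K \<Longrightarrow> diameter S < d \<Longrightarrow> \<exists>B\<in>V ` \<U>. S \<subseteq> B"
  proof (rule Lebesgue_number_lemma[OF K _ 1])
    show "V ` \<U> \<noteq> {}" using ne by simp
    show "open B" if "B \<in> V ` \<U>" for B using that V by auto
  qed blast
  have "\<exists>U\<in>\<U>. F ` S \<subseteq> U" if S: "S \<subseteq> K" "diameter S < d" for S
  proof -
    obtain U where "U \<in> \<U>" "S \<subseteq> V U" using d(2)[OF S] by auto
    then show ?thesis using V[of U] S by blast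
  qed
  with d(1) show ?thesis by (rule that)
qed

text \<open>Keeps subdivision points in the form \<open>real (Suc i) / real n\<close> while
  subdivisions are being manipulated; the rule is restored afterwards.\<close>

declare of_nat_Suc [simp del]

definition fine_subdivision :: "'a set set \<Rightarrow> (real \<Rightarrow> 'a) \<Rightarrow> nat \<Rightarrow> bool" where
  "fine_subdivision \<U> p n \<longleftrightarrow> n > 0 \<and> (\<forall>i<n. \<exists>U\<in>\<U>. p ` {real i / real n .. real (Suc i) / real n} \<subseteq> U)"

lemma subdivision_sub: "i < n \<Longrightarrow> {real i / real n .. real (Suc i) / real n} \<subseteq> {0..1}"
  by (auto simp: field_simps)

lemma fine_subdivision_exists:
  assumes p: "pathin X p" and op: "\<And>U. U \<in> \<U> \<Longrightarrow> openin X U" and cov: "topspace X \<subseteq> \<Union>\<U>"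
  obtains n where "fine_subdivision \<U> p n"
proof -
  have "\<U> \<noteq> {}" using cov pathin_in[OF p, of 0] by auto
  then obtain d where d: "d > 0" "\<And>S. S \<subseteq> {0..1} \<Longrightarrow> diameter S < d \<Longrightarrow> \<exists>U\<in>\<U>. p ` S \<subseteq> U"
    using cover_Lebesgue[OF compact_Icc p[unfolded pathin_def] op cov] by metis
  obtain m where m: "inverse (real (Suc m)) < d" using reals_Archimedean[OF d(1)] by auto
  have "fine_subdivision \<U> p (Suc m)" unfolding fine_subdivision_def
  proof (intro conjI allI impI)
    fix i assume i: "i < Suc m"
    have "diameter {real i / real (Suc m) .. real (Suc i) / real (Suc m)} = inverse (real (Suc m))"
      by (subst diameter_closed_interval) (auto simp: field_simps divide_right_mono)
    then show "\<exists>U\<in>\<U>. p ` {real i / real (Suc m) .. real (Suc i) / real (Suc m)} \<subseteq> U"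
      using d(2)[OF subdivision_sub[OF i]] m by simp
  qed simp
  then show ?thesis by (rule that)
qed

definition square_piece :: "nat \<Rightarrow> nat \<Rightarrow> nat \<Rightarrow> (real \<times> real) set" where
  "square_piece n i j = {real i / real n .. real (Suc i) / real n} \<times> {real j / real n .. real (Suc j) / real n}"

lemma square_subdivision_exists:
  fixes F :: "real \<times> real \<Rightarrow> 'a"
  assumes F: "continuous_map (top_of_set ({0..1} \<times> {0..1})) X F"
    and op: "\<And>U. U \<in> \<U> \<Longrightarrow> openin X U" and cov: "topspace X \<subseteq> \<Union>\<U>"
  obtains n where "n > 0" "\<And>i j. i < n \<Longrightarrow> j < n \<Longrightarrow> \<exists>U\<in>\<U>. F ` square_piece n i j \<subseteq> U"
proof -
  have "F (0, 0) \<in> topspace X" using F by (auto simp: continuous_map_def)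
  then have "\<U> \<noteq> {}" using cov by auto
  moreover have "compact ({0..1::real} \<times> {0..1::real})" by (intro compact_Times compact_Icc)
  ultimately obtain d where d: "d > 0"
    "\<And>S. S \<subseteq> {0..1} \<times> {0..1} \<Longrightarrow> diameter S < d \<Longrightarrow> \<exists>U\<in>\<U>. F ` S \<subseteq> U"
    using cover_Lebesgue[OF _ F op cov] by metis
  obtain m where m: "inverse (real (Suc m)) < d / 2" using reals_Archimedean[of "d/2"] d(1) by auto
  have "\<exists>U\<in>\<U>. F ` square_piece (Suc m) i j \<subseteq> U" if "i < Suc m" "j < Suc m" for i j
  proof (rule d(2))
    show "square_piece (Suc m) i j \<subseteq> {0..1} \<times> {0..1}"
      unfolding square_piece_def using subdivision_sub[OF that(1)] subdivision_sub[OF that(2)] by (rule Sigma_mono)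
    have "diameter (square_piece (Suc m) i j) \<le> 2 * inverse (real (Suc m))"
    proof (rule diameter_le)
      fix y z assume yz: "y \<in> square_piece (Suc m) i j" "z \<in> square_piece (Suc m) i j"
      have e: "real (Suc k) / real (Suc m) = real k / real (Suc m) + inverse (real (Suc m))" for k
        by (simp add: field_simps)
      have "norm (y - z) \<le> norm (fst (y - z)) + norm (snd (y - z))"
        by (metis norm_Pair_le prod.collapse)
      also have "\<dots> \<le> inverse (real (Suc m)) + inverse (real (Suc m))"
        using yz unfolding square_piece_def e by (intro add_mono) auto
      finally show "norm (y - z) \<le> 2 * inverse (real (Suc m))" by simp
    qed simp
    then show "diameter (square_piece (Suc m) i j) < d" using m by linarith
  qed
  then show ?thesis by (intro that[of "Suc m"]) auto
qed

definition subpath_of :: "(real \<Rightarrow> 'a) \<Rightarrow> real \<Rightarrow> real \<Rightarrow> real \<Rightarrow> 'a" where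
  "subpath_of p a b = (\<lambda>t. p (a + t * (b - a)))"

lemma interp_bounds:
  fixes a b t :: real
  assumes "a \<le> b" "0 \<le> t" "t \<le> 1" shows "a \<le> a + t * (b - a)" "a + t * (b - a) \<le> b"
proof -
  show "a \<le> a + t * (b - a)" using assms by simp
  have "t * (b - a) \<le> 1 * (b - a)" using assms by (intro mult_right_mono) auto
  then show "a + t * (b - a) \<le> b" by simp
qed

lemma pathin_subpath_of:
  assumes "pathin X p" "0 \<le> a" "a \<le> b" "b \<le> 1"
  shows "pathin X (subpath_of p a b)"
proof -
  have "pathin X (p \<circ> (\<lambda>t. a + t * (b - a)))"
    unfolding pathin_def
    by (rule continuous_map_compose[OF _ assms(1)[unfolded pathin_def]])
       (use assms interp_bounds[of a b] in \<open>fastforce intro!: continuous_intros\<close>)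
  then show ?thesis by (simp add: subpath_of_def o_def)
qed

context spanning_paths
begin

lemma lp_subpath_of:
  assumes p: "pathin X p" and le: "0 \<le> a" "a \<le> b" "b \<le> c" "c \<le> 1"
  shows "lp (subpath_of p a c) = lp (subpath_of p a b) \<otimes>\<^bsub>PI\<^esub> lp (subpath_of p b c)"
proof -
  have "lp (subpath_of p a b) \<otimes>\<^bsub>PI\<^esub> lp (subpath_of p b c) = lp (loop_concat (subpath_of p a b) (subpath_of p b c))"
    using pathin_subpath_of[OF p, of a b] pathin_subpath_of[OF p, of b c] le
    by (subst lp_concat) (auto simp: subpath_of_def)
  also have "\<dots> = lp (subpath_of p a c)"
  proof (rule lp_homotopic, rule path_homotopic_reparam'[OF p])
    let ?f = "\<lambda>t. (a + min (2 * t) 1 * (b - a)) + max (2 * t - 1) 0 * (c - b)"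
    let ?g = "\<lambda>t. a + t * (c - a)"
    show "continuous_on {0..1} ?f" "continuous_on {0..1} ?g" by (auto intro!: continuous_intros)
    show "?g \<in> {0..1} \<rightarrow> {0..1}" using interp_bounds[of a c] le by fastforce
    show "?f \<in> {0..1} \<rightarrow> {0..1}"
    proof
      fix t :: real assume "t \<in> {0..1}"
      then show "?f t \<in> {0..1}"
        using interp_bounds[of a b "2*t"] interp_bounds[of b c "2*t-1"] le by (cases "t \<le> 1/2") auto
    qed
    show "?f 0 = ?g 0" "?f 1 = ?g 1" by auto
    show "loop_concat (subpath_of p a b) (subpath_of p b c) t = p (?f t)" for t
      by (cases "t \<le> 1/2") (auto simp: loop_concat_def subpath_of_def)
  qed (simp add: subpath_of_def)
  finally show ?thesis by simp
qed

text \<open>The generation half of van Kampen's theorem: a fine subdivision writes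
  \<open>lp p\<close> as a product of values on pieces that each lie in one member of the
  cover.\<close>

lemma lp_in_subgroup:
  assumes H: "subgroup H PI" and op: "\<And>U. U \<in> \<U> \<Longrightarrow> openin X U" and cov: "topspace X \<subseteq> \<Union>\<U>"
    and loc: "\<And>U r. U \<in> \<U> \<Longrightarrow> pathin X r \<Longrightarrow> r ` {0..1} \<subseteq> U \<Longrightarrow> lp r \<in> H"
    and p: "pathin X p"
  shows "lp p \<in> H"
proof -
  obtain n where n: "fine_subdivision \<U> p n" using fine_subdivision_exists[OF p op cov] by metis
  then have n0: "n > 0" by (simp add: fine_subdivision_def)
  have "i \<le> n \<Longrightarrow> lp (subpath_of p 0 (real i / real n)) \<in> H" for i
  proof (induction i)
    case 0
    then show ?case using lp_const[of "p 0"] pathin_in[OF p, of 0] subgroup.one_closed[OF H]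
      by (simp add: subpath_of_def)
  next
    case (Suc i)
    let ?a = "real i / real n" and ?b = "real (Suc i) / real n"
    have ab: "0 \<le> ?a" "?a \<le> ?b" "?b \<le> 1" using Suc n0 by (auto simp: field_simps)
    have "i < n" using Suc by simp
    then obtain U where U: "U \<in> \<U>" "p ` {?a..?b} \<subseteq> U" using n unfolding fine_subdivision_def by blast
    have "subpath_of p ?a ?b ` {0..1} \<subseteq> U"
      using U(2) interp_bounds[OF ab(2)] unfolding subpath_of_def by fastforce
    then have "lp (subpath_of p ?a ?b) \<in> H"
      using loc U pathin_subpath_of[OF p ab] by blast
    then show ?case
      using lp_subpath_of[OF p order_refl ab] Suc subgroup.m_closed[OF H] by simp
  qed
  from this[of n] have "lp (subpath_of p 0 1) \<in> H" using n0 by simp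
  then show ?thesis by (simp add: subpath_of_def)
qed

end

section \<open>Homomorphisms from discrete cocycles\<close>

text \<open>A locally defined function \<open>c y z\<close> of pairs of nearby points with \<open>c y z \<otimes> c z w = c y w\<close>
  gives a homomorphism from the fundamental group, by multiplying its values along a fine
  subdivision of a loop; no continuity is required of \<open>c\<close>.\<close>

locale discrete_cocycle = group \<Gamma> for \<Gamma> :: "('b, 'm) monoid_scheme" (structure) +
  fixes X :: "'a topology" and \<U> :: "'a set set" and c :: "'a \<Rightarrow> 'a \<Rightarrow> 'b"
  assumes op: "\<And>U. U \<in> \<U> \<Longrightarrow> openin X U" and cov: "topspace X \<subseteq> \<Union>\<U>"
    and c_closed: "\<And>U y z. U \<in> \<U> \<Longrightarrow> y \<in> U \<Longrightarrow> z \<in> U \<Longrightarrow> c y z \<in> carrier \<Gamma>"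
    and c_mult: "\<And>U y z w. U \<in> \<U> \<Longrightarrow> y \<in> U \<Longrightarrow> z \<in> U \<Longrightarrow> w \<in> U \<Longrightarrow> c y z \<otimes> c z w = c y w"
begin

lemma c_self: assumes "y \<in> topspace X" shows "c y y = \<one>"
proof -
  obtain U where "U \<in> \<U>" "y \<in> U" using assms cov by auto
  then show ?thesis using c_closed[of U y y] c_mult[of U y y y] l_cancel_one by metis
qed

primrec pc :: "(nat \<Rightarrow> 'a) \<Rightarrow> nat \<Rightarrow> 'b" where
  "pc f 0 = \<one>"
| "pc f (Suc n) = pc f n \<otimes> c (f n) (f (Suc n))"

abbreviation "finely \<equiv> fine_subdivision \<U>"

abbreviation "pts p n \<equiv> \<lambda>i. p (real i / real n)"

lemma fine_piece:
  assumes "finely p n" "i < n"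
  obtains U where "U \<in> \<U>" "p ` {real i / real n .. real (Suc i) / real n} \<subseteq> U"
  using assms by (auto simp: fine_subdivision_def)

lemma fine_step:
  assumes "finely p n" "i < n"
  shows "c (pts p n i) (pts p n (Suc i)) \<in> carrier \<Gamma>"
proof -
  obtain U where U: "U \<in> \<U>" "p ` {real i / real n .. real (Suc i) / real n} \<subseteq> U" using fine_piece[OF assms] .
  have "real i / real n \<le> real (Suc i) / real n" by (simp add: divide_right_mono)
  then show ?thesis using U by (intro c_closed[OF U(1)]) auto
qed

lemma pc_closed: "finely p n \<Longrightarrow> k \<le> n \<Longrightarrow> pc (pts p n) k \<in> carrier \<Gamma>"
  by (induction k) (auto simp: fine_step)

text \<open>All new points of a piece lie in one member of the cover, where the cocycle identity
  makes their product telescope.\<close>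

lemma pc_refine:
  assumes n: "finely p n" and m: "m > 0"
  shows "pc (pts p (n * m)) (n * m) = pc (pts p n) n"
proof -
  have n0: "n > 0" using n by (auto simp: fine_subdivision_def)
  have "j \<le> n \<Longrightarrow> pc (pts p (n * m)) (j * m) = pc (pts p n) j" for j
  proof (induction j)
    case (Suc j)
    obtain U where U: "U \<in> \<U>" "p ` {real j / real n .. real (Suc j) / real n} \<subseteq> U"
      using fine_piece[OF n, of j] Suc by auto
    have e: "real (j * m) / real (n * m) = real j / real n" "real (Suc j * m) / real (n * m) = real (Suc j) / real n"
      using m nonzero_mult_divide_mult_cancel_right[of "real m"] by (simp_all only: of_nat_mult)
    have inU: "p (real (j * m + l) / real (n * m)) \<in> U" if "l \<le> m" for l
    proof -
      have "real (j * m) / real (n * m) \<le> real (j * m + l) / real (n * m)" by (intro divide_right_mono) auto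
      moreover have "real (j * m + l) / real (n * m) \<le> real (Suc j * m) / real (n * m)"
        using that by (intro divide_right_mono) auto
      ultimately show ?thesis using U(2) e by auto
    qed
    \<comment> \<open>The partial product inside piece \<open>j\<close> collapses to one value of
      \<open>c\<close>, from the left end of the piece to the current point.\<close>
    have "l \<le> m \<Longrightarrow> pc (pts p (n * m)) (j * m + l) =
        pc (pts p n) j \<otimes> c (p (real j / real n)) (p (real (j * m + l) / real (n * m)))" for l
    proof (induction l)
      case 0
      have "p (real j / real n) \<in> U" using inU[of 0] e m by simp
      then have "c (p (real j / real n)) (p (real j / real n)) = \<one>"
        using op[OF U(1)] by (intro c_self) (auto dest: openin_subset)
      then show ?case using Suc pc_closed[OF n, of j] e m by simp
    next
      case (Suc l)
      have ins: "p (real j / real n) \<in> U" using inU[of 0] e m by simp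
      have "pc (pts p (n * m)) (j * m + Suc l) = pc (pts p n) j \<otimes>
         c (p (real j / real n)) (p (real (j * m + l) / real (n * m))) \<otimes>
         c (p (real (j * m + l) / real (n * m))) (p (real (j * m + Suc l) / real (n * m)))"
        using Suc by simp
      also have "\<dots> = pc (pts p n) j \<otimes> c (p (real j / real n)) (p (real (j * m + Suc l) / real (n * m)))"
        using Suc \<open>Suc j \<le> n\<close> pc_closed[OF n, of j] ins inU[of l] inU[of "Suc l"]
        by (subst m_assoc) (auto simp: c_closed[OF U(1)] c_mult[OF U(1)] simp del: of_nat_add)
      finally show ?case .
    qed
    from this[of m] show ?case using e by (simp add: add.commute)
  qed simp
  from this[of n] show ?thesis by simp
qed

definition hol :: "(real \<Rightarrow> 'a) \<Rightarrow> 'b" where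
  "hol p = (let n = (SOME n. finely p n) in pc (pts p n) n)"

text \<open>The subdivisions into \<open>n\<close> and \<open>m\<close> pieces have the common
  refinement into \<open>n * m\<close> pieces, so the arbitrary choice in \<open>hol\<close> is
  harmless.\<close>

lemma hol_eq: assumes "finely p n" shows "hol p = pc (pts p n) n"
proof -
  let ?m = "SOME n. finely p n"
  have m: "finely p ?m" using assms by (rule someI)
  have "pc (pts p n) n = pc (pts p (n * ?m)) (n * ?m)"
    using pc_refine[OF assms, of ?m] m by (auto simp: fine_subdivision_def)
  also have "\<dots> = pc (pts p ?m) ?m"
    using pc_refine[OF m, of n] assms by (auto simp: fine_subdivision_def mult.commute)
  finally show ?thesis by (simp add: hol_def Let_def)
qed

lemma fine_exists: "pathin X p \<Longrightarrow> \<exists>n. finely p n"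
  using fine_subdivision_exists[OF _ op cov] by metis

lemma hol_closed: "pathin X p \<Longrightarrow> hol p \<in> carrier \<Gamma>"
  using fine_exists hol_eq pc_closed by (metis order_refl)

lemma fine_mult:
  assumes n: "finely p n" and m: "m > 0" shows "finely p (n * m)"
  unfolding fine_subdivision_def
proof (intro conjI allI impI)
  show "0 < n * m" using assms by (auto simp: fine_subdivision_def)
  fix i assume i: "i < n * m"
  then have "i div m < n" by (simp add: less_mult_imp_div_less)
  then obtain U where U: "U \<in> \<U>" "p ` {real (i div m) / real n .. real (Suc (i div m)) / real n} \<subseteq> U"
    using fine_piece[OF n] by metis
  have "i div m * m \<le> i" "Suc i \<le> Suc (i div m) * m"
    using m by (auto simp: Suc_le_eq dividend_less_div_times)
  then have "real (i div m * m) / real (n * m) \<le> real i / real (n * m)"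
    "real (Suc i) / real (n * m) \<le> real (Suc (i div m) * m) / real (n * m)"
    by (intro divide_right_mono; simp del: of_nat_mult)+
  then have "{real i / real (n * m) .. real (Suc i) / real (n * m)} \<subseteq>
     {real (i div m) / real n .. real (Suc (i div m)) / real n}"
    using m nonzero_mult_divide_mult_cancel_right[of "real m"] by (simp only: of_nat_mult) simp
  then show "\<exists>U\<in>\<U>. p ` {real i / real (n * m)..real (Suc i) / real (n * m)} \<subseteq> U"
    using U by blast
qed

lemma hol_concat:
  assumes p: "pathin X p" and q: "pathin X q" and pq: "p 1 = q 0"
  shows "hol (loop_concat p q) = hol p \<otimes> hol q"
proof -
  obtain n1 n2 where n12: "finely p n1" "finely q n2" using fine_exists p q by metis
  then have "n1 > 0" "n2 > 0" by (auto simp: fine_subdivision_def)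
  then obtain n where n: "finely p n" "finely q n"
    using fine_mult[OF n12(1), of n2] fine_mult[OF n12(2), of n1] by (metis mult.commute)
  then have n0: "n > 0" by (simp add: fine_subdivision_def)
  let ?r = "loop_concat p q"
  have r1: "?r (t / 2) = p t" if "t \<le> 1" for t using that by (simp add: loop_concat_def)
  have r2: "?r ((1 + t) / 2) = q t" if "0 \<le> t" for t
  proof -
    have "2 * ((1 + t) / 2) = 1 + t" by simp
    then have "loop_concat p q ((1 + t) / 2) = (if (1 + t) / 2 \<le> 1/2 then p (1 + t) else q t)"
      by (simp only: loop_concat_def) simp
    then show ?thesis using that pq by auto
  qed
  have f: "finely ?r (2 * n)" unfolding fine_subdivision_def
  proof (intro conjI allI impI)
    fix i assume i: "i < 2 * n"
    show "\<exists>U\<in>\<U>. ?r ` {real i / real (2 * n)..real (Suc i) / real (2 * n)} \<subseteq> U"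
    proof (cases "i < n")
      case True
      then obtain U where U: "U \<in> \<U>" "p ` {real i / real n .. real (Suc i) / real n} \<subseteq> U" using fine_piece[OF n(1)] by metis
      have "?r t \<in> U" if "t \<in> {real i / real (2 * n)..real (Suc i) / real (2 * n)}" for t
      proof -
        have "2 * t \<in> {real i / real n .. real (Suc i) / real n}" using that n0 by (auto simp: field_simps)
        moreover from this have "2 * t \<le> 1" using subdivision_sub[OF True] by auto
        ultimately show ?thesis using U(2) r1[of "2*t"] by auto
      qed
      then show ?thesis using U by blast
    next
      case False
      then obtain j where j: "i = n + j" using le_Suc_ex not_less by blast
      then have jn: "j < n" using i by simp
      then obtain U where U: "U \<in> \<U>" "q ` {real j / real n .. real (Suc j) / real n} \<subseteq> U" using fine_piece[OF n(2)] by metis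
      have "?r t \<in> U" if "t \<in> {real i / real (2 * n)..real (Suc i) / real (2 * n)}" for t
      proof -
        have "2 * t - 1 \<in> {real j / real n .. real (Suc j) / real n}" using that n0 by (auto simp: field_simps j)
        moreover from this have "0 \<le> 2 * t - 1"
          using order_trans[of 0 "real j / real n" "2 * t - 1"] by simp
        ultimately show ?thesis using U(2) r2[of "2*t-1"] by auto
      qed
      then show ?thesis using U by blast
    qed
  qed (use n0 in simp)
  have e1: "pts ?r (2 * n) i = pts p n i" if "i \<le> n" for i
    using r1[of "real i / real n"] that n0 by (simp add: field_simps)
  have e2: "pts ?r (2 * n) (n + i) = pts q n i" for i
    using r2[of "real i / real n"] n0 by (simp add: field_simps)
  have 1: "i \<le> n \<Longrightarrow> pc (pts ?r (2 * n)) i = pc (pts p n) i" for i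
  proof (induction i)
    case (Suc i)
    then show ?case using e1[of i] e1[of "Suc i"] by simp
  qed simp
  have "i \<le> n \<Longrightarrow> pc (pts ?r (2 * n)) (n + i) = pc (pts p n) n \<otimes> pc (pts q n) i" for i
  proof (induction i)
    case 0
    then show ?case using 1[of n] pc_closed[OF n(1), of n] by simp
  next
    case (Suc i)
    have "pc (pts ?r (2 * n)) (n + Suc i) =
       pc (pts p n) n \<otimes> pc (pts q n) i \<otimes> c (pts q n i) (pts q n (Suc i))"
      using Suc e2[of i] e2[of "Suc i"] by (simp del: of_nat_add)
    also have "\<dots> = pc (pts p n) n \<otimes> pc (pts q n) (Suc i)"
      using pc_closed[OF n(1), of n] pc_closed[OF n(2), of i] fine_step[OF n(2), of i] Suc
      by (simp add: m_assoc)
    finally show ?case .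
  qed
  from this[OF order_refl] have "pc (pts ?r (2 * n)) (2 * n) = pc (pts p n) n \<otimes> pc (pts q n) n"
    unfolding mult_2[of n, symmetric] .
  then show ?thesis
    unfolding hol_eq[OF n(1)] hol_eq[OF n(2)] hol_eq[OF f] .
qed

text \<open>On a fine grid in the homotopy square, the products along neighbouring rows agree:
  around each small square the cocycle commutes, and the two side edges contribute
  \<open>c_self\<close>, because the homotopy fixes the endpoints.\<close>

lemma hol_homotopic:
  assumes "path_homotopic X p q" shows "hol p = hol q"
proof -
  obtain F :: "real \<times> real \<Rightarrow> 'a" where F: "continuous_map (top_of_set ({0..1} \<times> {0..1})) X F"
    and e: "\<And>t. F (0, t) = p t" "\<And>t. F (1, t) = q t"
    "\<And>u. u \<in> {0..1} \<Longrightarrow> F (u, 0) = p 0" "\<And>u. u \<in> {0..1} \<Longrightarrow> F (u, 1) = p 1"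
    by (rule path_homotopic_square_ex[OF assms]) blast
  obtain n where n0: "n > 0" and n: "\<And>i j. i < n \<Longrightarrow> j < n \<Longrightarrow> \<exists>U\<in>\<U>. F ` square_piece n i j \<subseteq> U"
    using square_subdivision_exists[OF F op cov] by metis
  define P where "P i j = F (real i / real n, real j / real n)" for i j
  have le: "real i / real n \<le> real (Suc i) / real n" for i by (simp add: divide_right_mono)
  have fin: "finely (\<lambda>t. F (real i / real n, t)) n" if "i \<le> n" for i
    unfolding fine_subdivision_def
  proof (intro conjI allI impI n0)
    fix j assume j: "j < n"
    \<comment> \<open>The last row \<open>i = n\<close> starts no strip of its own and is taken as
      the upper edge of strip \<open>n - 1\<close>.\<close>
    have "\<exists>i'<n. real i / real n \<in> {real i' / real n .. real (Suc i') / real n}"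
    proof (cases "i < n")
      case True then show ?thesis using le[of i] by auto
    next
      case False
      then have "i = Suc (n - 1)" using that n0 by auto
      then show ?thesis using le[of "n-1"] n0 by (intro exI[of _ "n-1"]) auto
    qed
    then obtain i' where i': "i' < n" "real i / real n \<in> {real i' / real n .. real (Suc i') / real n}" by blast
    obtain U where "U \<in> \<U>" "F ` square_piece n i' j \<subseteq> U" using n[OF i'(1) j] by blast
    then show "\<exists>U\<in>\<U>. (\<lambda>t. F (real i / real n, t)) ` {real j / real n..real (Suc j) / real n} \<subseteq> U"
      using i'(2) by (intro bexI[of _ U]) (auto simp: square_piece_def)
  qed
  have row: "pc (P i) n = pc (P (Suc i)) n" if i: "i < n" for i
  proof -
    have sq: "\<exists>U\<in>\<U>. P i j \<in> U \<and> P i (Suc j) \<in> U \<and> P (Suc i) j \<in> U \<and> P (Suc i) (Suc j) \<in> U" if "j < n" for j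
    proof -
      obtain U where U: "U \<in> \<U>" "F ` square_piece n i j \<subseteq> U" using n[OF i \<open>j < n\<close>] by blast
      have "{(real i / real n, real j / real n), (real i / real n, real (Suc j) / real n),
         (real (Suc i) / real n, real j / real n), (real (Suc i) / real n, real (Suc j) / real n)} \<subseteq> square_piece n i j"
        using le[of i] le[of j] by (auto simp: square_piece_def)
      then show ?thesis using U unfolding P_def by (intro bexI[OF _ U(1)]) blast
    qed
    have cl: "pc (P i) j \<in> carrier \<Gamma>" "pc (P (Suc i)) j \<in> carrier \<Gamma>" if "j \<le> n" for j
      using pc_closed[OF fin[of i], of j] pc_closed[OF fin[of "Suc i"], of j] i that by (auto simp: P_def[abs_def])
    \<comment> \<open>A ladder: following row \<open>i\<close> and then crossing at column
      \<open>j\<close> equals crossing at column 0 and then following row \<open>Suc i\<close>. The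
      order of the factors is kept, as the target group need not be abelian.\<close>
    have "j \<le> n \<Longrightarrow> pc (P i) j \<otimes> c (P i j) (P (Suc i) j) = c (P i 0) (P (Suc i) 0) \<otimes> pc (P (Suc i)) j" for j
    proof (induction j)
      case 0
      obtain U where "U \<in> \<U>" "P i 0 \<in> U" "P (Suc i) 0 \<in> U" using sq[OF n0] by blast
      then show ?case using c_closed[of U] by simp
    next
      case (Suc j)
      obtain U where U: "U \<in> \<U>" and m: "P i j \<in> U" "P i (Suc j) \<in> U" "P (Suc i) j \<in> U" "P (Suc i) (Suc j) \<in> U"
        using sq[of j] Suc by auto
      obtain U' where U': "U' \<in> \<U>" "P i 0 \<in> U'" "P (Suc i) 0 \<in> U'" using sq[OF n0] by blast
      note cc = c_closed[OF U] c_closed[OF U'(1)]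
      have "pc (P i) (Suc j) \<otimes> c (P i (Suc j)) (P (Suc i) (Suc j)) =
            pc (P i) j \<otimes> (c (P i j) (P i (Suc j)) \<otimes> c (P i (Suc j)) (P (Suc i) (Suc j)))"
        using cl[of j] Suc m cc by (simp add: m_assoc)
      also have "\<dots> = pc (P i) j \<otimes> (c (P i j) (P (Suc i) j) \<otimes> c (P (Suc i) j) (P (Suc i) (Suc j)))"
        using m c_mult[OF U] by simp
      also have "\<dots> = c (P i 0) (P (Suc i) 0) \<otimes> pc (P (Suc i)) j \<otimes> c (P (Suc i) j) (P (Suc i) (Suc j))"
        using cl[of j] Suc m cc by (simp add: m_assoc[symmetric])
      also have "\<dots> = c (P i 0) (P (Suc i) 0) \<otimes> pc (P (Suc i)) (Suc j)"
        using cl[of j] Suc m cc U' by (simp add: m_assoc)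
      finally show ?case .
    qed
    from this[OF order_refl] show ?thesis
    proof -
      assume ends: "pc (P i) n \<otimes> c (P i n) (P (Suc i) n) = c (P i 0) (P (Suc i) 0) \<otimes> pc (P (Suc i)) n"
      have "P i 0 = p 0" "P (Suc i) 0 = p 0" "P i n = p 1" "P (Suc i) n = p 1"
        using e(3)[of "real i / real n"] e(3)[of "real (Suc i) / real n"] e(4)[of "real i / real n"]
          e(4)[of "real (Suc i) / real n"] i n0 by (auto simp: P_def)
      moreover have "p 0 \<in> topspace X" "p 1 \<in> topspace X"
        using path_homotopic_imp[OF assms] pathin_in[of X p] by auto
      ultimately show ?thesis
        using ends cl[of n] by (simp add: c_self)
    qed
  qed
  have "i \<le> n \<Longrightarrow> pc (P 0) n = pc (P i) n" for i
    by (induction i) (auto simp: row)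
  then have "pc (P 0) n = pc (P n) n" by simp
  moreover have "hol p = pc (P 0) n" using hol_eq[of p n] fin[of 0] e n0 by (simp add: P_def[abs_def])
  moreover have "hol q = pc (P n) n" using hol_eq[of q n] fin[of n] e n0 by (simp add: P_def[abs_def])
  ultimately show ?thesis by simp
qed

lemma hol_hom:
  assumes "x \<in> topspace X"
  shows "\<exists>\<eta>\<in>hom (fundamental_group X x) \<Gamma>. \<forall>p\<in>loops X x. \<eta> (loop_class X x p) = hol p"
proof -
  define \<eta> where "\<eta> a = hol (SOME p. p \<in> loops X x \<and> a = loop_class X x p)" for a
  have e: "\<eta> (loop_class X x p) = hol p" if "p \<in> loops X x" for p
  proof -
    let ?q = "SOME q. q \<in> loops X x \<and> loop_class X x p = loop_class X x q"
    have "?q \<in> loops X x \<and> loop_class X x p = loop_class X x ?q"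
      by (rule someI[of _ p]) (use that in simp)
    then show ?thesis using that hol_homotopic loop_class_eq_iff unfolding \<eta>_def by metis
  qed
  have "\<eta> \<in> hom (fundamental_group X x) \<Gamma>"
    by (rule homI)
       (auto simp: fundamental_group_carrier e fundamental_group_mult loops_concat,
        auto simp: loops_def intro!: hol_closed hol_concat)
  then show ?thesis using e by blast
qed

end

declare of_nat_Suc [simp]

section \<open>The fundamental group of the punctured torus\<close>

text \<open>The minus signs put angle 0 at the base point, opposite the centre of the removed disc;
  in these angles a point survives if and only if one of the two cosines is nonnegative.\<close>

definition torus_map :: "real \<times> real \<Rightarrow> complex \<times> complex" where
  "torus_map = (\<lambda>(s, t). (- cis s, - cis t))"

definition "ptorus = std_torus - std_disc"
abbreviation "pt_top \<equiv> top_of_set ptorus"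
abbreviation "pt_base \<equiv> (-1, -1) :: complex \<times> complex"

definition loop_a :: "real \<Rightarrow> complex \<times> complex" where
  "loop_a = torus_map \<circ> (\<lambda>t. (2 * pi * t, 0))"
definition loop_b :: "real \<Rightarrow> complex \<times> complex" where
  "loop_b = torus_map \<circ> (\<lambda>t. (0, 2 * pi * t))"

text \<open>The straight segment from the origin in angular coordinates. It stays in the surface
  because shrinking an angle of size at most \<open>pi / 2\<close> keeps it in that range. It jumps
  where \<open>Arg\<close> does, and these jumps produce the generators.\<close>

definition spoke :: "complex \<times> complex \<Rightarrow> real \<Rightarrow> complex \<times> complex" where
  "spoke y = torus_map \<circ> (\<lambda>t. (t * Arg (- fst y), t * Arg (- snd y)))"

lemma ptorus_iff: "(z, w) \<in> ptorus \<longleftrightarrow> norm z = 1 \<and> norm w = 1 \<and> (Re z \<le> 0 \<or> Re w \<le> 0)"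
  by (auto simp: ptorus_def std_torus_def std_disc_def dist_norm)

lemma torus_map_in: "torus_map (s, t) \<in> ptorus \<longleftrightarrow> cos s \<ge> 0 \<or> cos t \<ge> 0"
  by (simp add: torus_map_def ptorus_iff)

lemma continuous_torus_map [continuous_intros]:
  "continuous_on A f \<Longrightarrow> continuous_on A (\<lambda>x. torus_map (f x))"
  unfolding torus_map_def case_prod_beta by (auto intro!: continuous_intros)

lemma torus_map_continuous_map:
  assumes "\<And>s t. (s, t) \<in> C \<Longrightarrow> cos s \<ge> 0 \<or> cos t \<ge> 0"
  shows "continuous_map (top_of_set C) pt_top torus_map"
  using assms torus_map_in by (auto intro!: continuous_intros)

lemma norm1_cis: "norm z = 1 \<Longrightarrow> cis (Arg z) = z"
  by (metis cis_Arg norm_zero sgn_div_norm scaleR_one inverse_1 zero_neq_one)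

lemma torus_map_Arg: "y \<in> ptorus \<Longrightarrow> torus_map (Arg (- fst y), Arg (- snd y)) = y"
  by (cases y) (auto simp: ptorus_iff torus_map_def norm1_cis)

lemma cos_Arg: "norm z = 1 \<Longrightarrow> cos (Arg z) = Re z"
  by (metis norm1_cis cis.sel(1))

lemma small_of_cos_nonneg: assumes "- pi < s" "s \<le> pi" "cos s \<ge> 0" shows "\<bar>s\<bar> \<le> pi / 2"
proof (rule ccontr)
  assume "\<not> \<bar>s\<bar> \<le> pi / 2"
  then have "pi/2 < \<bar>s\<bar>" "\<bar>s\<bar> \<le> pi" using assms by auto
  then have "cos \<bar>s\<bar> < cos (pi / 2)" by (intro cos_monotone_0_pi) auto
  then show False using assms by simp
qed

lemma cos_nonneg_of_small: "\<bar>s\<bar> \<le> pi / 2 \<Longrightarrow> cos s \<ge> 0"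
  by (intro cos_ge_zero) auto

lemma abs_scale_le: "0 \<le> t \<Longrightarrow> t \<le> 1 \<Longrightarrow> \<bar>s\<bar> \<le> c \<Longrightarrow> \<bar>t * s\<bar> \<le> (c::real)"
  by (metis abs_ge_zero abs_mult abs_of_nonneg mult_left_le_one_le order_trans)

lemma spoke_spanning: "spanning_paths pt_top pt_base spoke"
proof
  show "pt_base \<in> topspace pt_top" by (simp add: ptorus_iff)
  show "spoke pt_base = (\<lambda>_. pt_base)"
    by (auto simp: spoke_def torus_map_def fun_eq_iff)
  fix y assume y: "y \<in> topspace pt_top"
  obtain z w where zw: "y = (z, w)" by fastforce
  then have n: "norm z = 1" "norm w = 1" "Re z \<le> 0 \<or> Re w \<le> 0" using y by (auto simp: ptorus_iff)
  let ?s = "Arg (- z)" and ?t = "Arg (- w)"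
  have "cos ?s \<ge> 0 \<or> cos ?t \<ge> 0" using n by (simp add: cos_Arg)
  then have st: "\<bar>?s\<bar> \<le> pi / 2 \<or> \<bar>?t\<bar> \<le> pi / 2"
    using small_of_cos_nonneg Arg_bounded by blast
  have "pathin pt_top (spoke y)"
    unfolding pathin_def spoke_def
  proof (rule continuous_map_compose)
    show "continuous_map (top_of_set {0..1}) (top_of_set {(s, t). cos s \<ge> 0 \<or> cos t \<ge> 0}) (\<lambda>u. (u * Arg (- fst y), u * Arg (- snd y)))"
    proof -
      have "cos (u * ?s) \<ge> 0 \<or> cos (u * ?t) \<ge> 0" if "0 \<le> u" "u \<le> 1" for u
        using st abs_scale_le[OF that] cos_nonneg_of_small by blast
      then show ?thesis by (auto intro!: continuous_intros simp: zw)
    qed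
    show "continuous_map (top_of_set {(s, t). cos s \<ge> 0 \<or> cos t \<ge> 0}) pt_top torus_map"
      by (rule torus_map_continuous_map) auto
  qed
  then show "pathin pt_top (spoke y) \<and> spoke y 0 = pt_base \<and> spoke y 1 = y"
    using torus_map_Arg[of y] y by (auto simp: spoke_def torus_map_def)
qed

section \<open>Generation of the fundamental group by the two loops\<close>

lemma (in spanning_paths) lp_eq_class:
  assumes r: "path_homotopic X r r'" and q: "path_homotopic X (close_up r') q"
  shows "lp r = loop_class X x q"
proof -
  have l: "close_up r' \<in> loops X x" using path_homotopic_imp(2)[OF r] by (rule close_up_loops)
  show ?thesis
    unfolding lp_homotopic[OF r] unfolding lp_def
    using l loops_homotopic[OF l q] q by (simp add: loop_class_eq_iff)
qed

interpretation pt: spanning_paths pt_top pt_base spoke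
  by (rule spoke_spanning)

lemma loop_a_loops: "loop_a \<in> loops pt_top pt_base" and loop_b_loops: "loop_b \<in> loops pt_top pt_base"
proof -
  have "continuous_map (top_of_set {(s, t). cos s \<ge> 0 \<or> cos t \<ge> 0}) pt_top torus_map"
    by (rule torus_map_continuous_map) auto
  then have "pathin pt_top loop_a" "pathin pt_top loop_b"
    unfolding pathin_def loop_a_def loop_b_def
    by (auto intro!: continuous_map_compose[of _ "top_of_set {(s, t). cos s \<ge> 0 \<or> cos t \<ge> 0}"] continuous_intros)
  then show "loop_a \<in> loops pt_top pt_base" "loop_b \<in> loops pt_top pt_base"
    by (auto simp: loops_def loop_a_def loop_b_def torus_map_def)
qed

abbreviation "pt_a \<equiv> loop_class pt_top pt_base loop_a"
abbreviation "pt_b \<equiv> loop_class pt_top pt_base loop_b"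
abbreviation "pt_group \<equiv> fundamental_group pt_top pt_base"

text \<open>If a path and the spokes to both of its ends lift to one simply connected planar region,
  then the closed-up loop depends only on where the lifted spokes start, and \<open>L\<close> joins
  these two starting points.\<close>

lemma pt_close_up:
  assumes C: "simply_connected C" "\<And>s t. (s, t) \<in> C \<Longrightarrow> cos s \<ge> 0 \<or> cos t \<ge> 0"
    and r: "pathin (top_of_set C) r" and r0: "pathin (top_of_set C) r0" and r1: "pathin (top_of_set C) r1"
    and L: "pathin (top_of_set C) L"
    and e: "r0 1 = r 0" "r1 1 = r 1" "L 0 = r0 0" "L 1 = r1 0"
    and sp: "spoke (torus_map (r 0)) = torus_map \<circ> r0" "spoke (torus_map (r 1)) = torus_map \<circ> r1"
  shows "path_homotopic pt_top (pt.close_up (torus_map \<circ> r)) (torus_map \<circ> L)"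
proof -
  let ?q = "loop_concat r0 (loop_concat r (path_reverse r1))"
  have q: "pathin (top_of_set C) ?q" using r r0 r1 e by (auto intro!: pathin_concat pathin_reverse)
  have "path_homotopic pt_top (torus_map \<circ> ?q) (torus_map \<circ> L)"
    by (rule path_homotopic_simply_connected[OF torus_map_continuous_map[OF C(2)] C(1)])
       (use q L e in \<open>auto simp: pathin_def\<close>)
  then show ?thesis by (simp add: pt.close_up_def map_loop_concat map_path_reverse sp)
qed

lemma pathin_top_of_set: "pathin (top_of_set C) r \<longleftrightarrow> continuous_on {0..1} r \<and> r ` {0..1} \<subseteq> C"
  by (auto simp: pathin_def)

text \<open>The first set avoids the circles where \<open>Arg\<close> of a negated coordinate jumps;
  the two strips are neighbourhoods of those circles, and in each of them the other coordinate has
  nonpositive real part.\<close>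

definition "pt_cover = {{y \<in> ptorus. fst y \<noteq> 1 \<and> snd y \<noteq> 1}, {y \<in> ptorus. Re (snd y) > 0}, {y \<in> ptorus. Re (fst y) > 0}}"

text \<open>Away from the jumps the path and its spokes lift to a region that is star-shaped about
  the origin. Both spokes start at the origin, so the closed-up loop contracts.\<close>

lemma pt_lp_spokes:
  assumes r: "pathin pt_top r" "r ` {0..1} \<subseteq> {y \<in> ptorus. fst y \<noteq> 1 \<and> snd y \<noteq> 1}"
  shows "pt.lp r = \<one>\<^bsub>pt_group\<^esub>"
proof -
  define C where "C = {(s::real, t::real). \<bar>s\<bar> < pi \<and> \<bar>t\<bar> < pi \<and> (\<bar>s\<bar> \<le> pi/2 \<or> \<bar>t\<bar> \<le> pi/2)}"
  define r' where "r' = (\<lambda>u. (Arg (- fst (r u)), Arg (- snd (r u))))"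
  have ry: "r u \<in> ptorus" "fst (r u) \<noteq> 1" "snd (r u) \<noteq> 1" if "0 \<le> u" "u \<le> 1" for u
    using r(2) that unfolding image_subset_iff by auto
  have n: "norm (fst (r u)) = 1" "norm (snd (r u)) = 1" "Re (fst (r u)) \<le> 0 \<or> Re (snd (r u)) \<le> 0" if "0 \<le> u" "u \<le> 1" for u
    using ry[OF that] ptorus_iff[of "fst (r u)" "snd (r u)"] by auto
  have notneg: "- z \<notin> \<real>\<^sub>\<le>\<^sub>0" if "norm z = 1" "z \<noteq> 1" for z :: complex
  proof
    assume "- z \<in> \<real>\<^sub>\<le>\<^sub>0"
    then obtain x where x: "z = of_real x" "x \<ge> 0" by (metis nonpos_Reals_cases of_real_minus minus_minus neg_0_le_iff_le)
    then show False using that by simp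
  qed
  have Arg_lt: "\<bar>Arg (- z)\<bar> < pi" if "norm z = 1" "z \<noteq> 1" for z :: complex
  proof -
    have "Arg (- z) \<noteq> pi" using notneg[OF that] that by (auto simp: Arg_eq_pi complex_nonpos_Reals_iff)
    then show ?thesis using Arg_bounded[of "-z"] by auto
  qed
  have rc: "continuous_on {0..1} r" using r by (auto simp: pathin_def)
  have r'c: "continuous_on {0..1} r'"
    unfolding r'_def using notneg[OF n(1) ry(2)] notneg[OF n(2) ry(3)] by (auto intro!: continuous_intros rc)
  have small: "\<bar>Arg (- z)\<bar> \<le> pi/2" if "norm z = 1" "Re z \<le> 0" for z :: complex
    using small_of_cos_nonneg[of "Arg (- z)"] Arg_bounded[of "-z"] that by (simp add: cos_Arg)
  have r'C: "r' u \<in> C" if "0 \<le> u" "u \<le> 1" for u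
    unfolding C_def r'_def using n[OF that] ry[OF that] Arg_lt small by auto
  have star: "u *\<^sub>R p \<in> C" if "p \<in> C" "0 \<le> u" "u \<le> 1" for u p
  proof -
    obtain s t where p: "p = (s, t)" by fastforce
    have "\<bar>u * s\<bar> \<le> \<bar>s\<bar>" "\<bar>u * t\<bar> \<le> \<bar>t\<bar>" using that abs_scale_le by auto
    then show ?thesis using that(1) unfolding C_def p by auto
  qed
  have "starlike C" unfolding starlike_def
  proof (intro bexI ballI subsetI)
    show "(0, 0) \<in> C" by (simp add: C_def)
    fix p q assume "p \<in> C" "q \<in> closed_segment (0, 0) p"
    then obtain u where u: "0 \<le> u" "u \<le> 1" "q = u *\<^sub>R p" by (auto simp: closed_segment_def zero_prod_def[symmetric])
    then show "q \<in> C" using star \<open>p \<in> C\<close> by simp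
  qed
  then have Csc: "simply_connected C" by (rule starlike_imp_simply_connected)
  have tr: "torus_map (r' u) = r u" if "0 \<le> u" "u \<le> 1" for u
    using torus_map_Arg[OF ry(1)[OF that]] by (simp add: r'_def)
  have "path_homotopic pt_top (pt.close_up (torus_map \<circ> r')) (torus_map \<circ> (\<lambda>_. (0,0)))"
  proof (rule pt_close_up[OF Csc])
    show "cos s \<ge> 0 \<or> cos t \<ge> 0" if "(s, t) \<in> C" for s t
      using that cos_nonneg_of_small by (auto simp: C_def)
    show "pathin (top_of_set C) r'" using r'c r'C by (auto simp: pathin_top_of_set)
    show "pathin (top_of_set C) (\<lambda>u. u *\<^sub>R r' 0)" "pathin (top_of_set C) (\<lambda>u. u *\<^sub>R r' 1)"
      using star[OF r'C[of 0]] star[OF r'C[of 1]]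
      by (auto simp: pathin_top_of_set image_subset_iff simp del: split_paired_All intro!: continuous_intros)
    show "pathin (top_of_set C) (\<lambda>_. (0,0))" by (auto simp: pathin_top_of_set C_def)
    show "spoke (torus_map (r' 0)) = torus_map \<circ> (\<lambda>u. u *\<^sub>R r' 0)"
      "spoke (torus_map (r' 1)) = torus_map \<circ> (\<lambda>u. u *\<^sub>R r' 1)"
      using tr[of 0] tr[of 1] by (simp_all add: spoke_def r'_def)
  qed (auto simp: zero_prod_def)
  moreover have hr: "path_homotopic pt_top r (torus_map \<circ> r')"
    by (rule path_homotopic_eq[OF r(1)]) (simp add: tr)
  moreover have "torus_map \<circ> (\<lambda>_::real. (0,0)) = (\<lambda>_. pt_base)" by (auto simp: torus_map_def)
  ultimately have "path_homotopic pt_top (pt.close_up (torus_map \<circ> r')) (\<lambda>_. pt_base)" by (simp only:)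
  then show ?thesis unfolding fundamental_group_one using hr by (intro pt.lp_eq_class)
qed

lemma Arg_minus_shift:
  assumes "norm w = 1" "Re w > 0"
  shows "Arg (- w) = Arg w + pi - (if Arg w \<le> 0 then 0 else 2 * pi)"
proof -
  have b: "- pi < Arg w" "Arg w \<le> pi" using Arg_bounded by auto
  have w: "w \<noteq> 0" using assms by auto
  show ?thesis using Arg_minus[OF w] by auto
qed

text \<open>Across the jump at second coordinate 1, the continuous lift \<open>Arg + pi\<close> is
  used. The lifted spokes then start at second angle 0 or \<open>2 * pi\<close>, depending on the
  side of the jump, so the closed-up loop is trivial, \<open>loop_b\<close>, or its reverse.\<close>

lemma pt_lp_strip_b:
  assumes r: "pathin pt_top r" "r ` {0..1} \<subseteq> {y \<in> ptorus. Re (snd y) > 0}"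
  shows "pt.lp r \<in> generate pt_group {pt_a, pt_b}"
proof -
  define C where "C = {(s::real, t::real). \<bar>s\<bar> \<le> pi/2}"
  define r' where "r' = (\<lambda>u. (Arg (- fst (r u)), Arg (snd (r u)) + pi))"
  \<comment> \<open>The second angle at which the lifted spoke to \<open>r u\<close> has to start in
    order to end at the continuous lift; the convention at argument 0 is that of
    \<open>Arg_minus_shift\<close>.\<close>
  define k where "k u = (if Arg (snd (r u)) \<le> 0 then 0 else 2 * pi)" for u :: real
  have n: "norm (fst (r u)) = 1" "norm (snd (r u)) = 1" "Re (fst (r u)) \<le> 0" "Re (snd (r u)) > 0" if "0 \<le> u" "u \<le> 1" for u
  proof -
    have "r u \<in> ptorus" "Re (snd (r u)) > 0" using that r(2) unfolding image_subset_iff by auto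
    then show "norm (fst (r u)) = 1" "norm (snd (r u)) = 1" "Re (fst (r u)) \<le> 0" "Re (snd (r u)) > 0"
      using ptorus_iff[of "fst (r u)" "snd (r u)"] by auto
  qed
  have rc: "continuous_on {0..1} r" using r by (auto simp: pathin_def)
  have 1: "- fst (r u) \<notin> \<real>\<^sub>\<le>\<^sub>0" "snd (r u) \<notin> \<real>\<^sub>\<le>\<^sub>0" if "0 \<le> u" "u \<le> 1" for u
    using n[OF that] by (auto simp: complex_nonpos_Reals_iff cmod_def)
  have r'c: "continuous_on {0..1} r'"
    unfolding r'_def using 1 by (auto intro!: continuous_intros rc)
  have small: "\<bar>Arg (- z)\<bar> \<le> pi/2" if "norm z = 1" "Re z \<le> 0" for z :: complex
    using small_of_cos_nonneg[of "Arg (- z)"] Arg_bounded[of "-z"] that by (simp add: cos_Arg)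
  have r'C: "r' u \<in> C" if "0 \<le> u" "u \<le> 1" for u
    unfolding C_def r'_def using n[OF that] small by auto
  have Csc: "simply_connected C"
  proof (rule convex_imp_simply_connected)
    have "C = {- (pi/2)..pi/2} \<times> UNIV" by (auto simp: C_def)
    then show "convex C" by (simp add: convex_Times)
  qed
  have tr: "torus_map (r' u) = r u" if "0 \<le> u" "u \<le> 1" for u
    using n[OF that] norm1_cis[of "- fst (r u)"] norm1_cis[of "snd (r u)"]
    by (auto simp: torus_map_def r'_def cis_mult[symmetric] prod_eq_iff)
  define rr where "rr v = (\<lambda>u. (u * fst (r' v), k v + u * (snd (r' v) - k v)))" for v :: real
  have rrC: "pathin (top_of_set C) (rr v)" if "0 \<le> v" "v \<le> 1" for v
    using r'C[OF that] abs_scale_le[of _ "fst (r' v)" "pi/2"]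
    by (auto simp: pathin_top_of_set rr_def C_def intro!: continuous_intros)
  have spk: "spoke (torus_map (r' v)) = torus_map \<circ> rr v" if "0 \<le> v" "v \<le> 1" for v
  proof
    fix u
    have "cis (k v + x) = cis x" for x by (simp add: k_def cis_mult[symmetric])
    then show "spoke (torus_map (r' v)) u = (torus_map \<circ> rr v) u"
      using tr[OF that] Arg_minus_shift[of "snd (r v)"] n[OF that]
      by (simp add: spoke_def rr_def torus_map_def r'_def k_def)
  qed
  define L where "L = (\<lambda>u. (0::real, k 0 + u * (k 1 - k 0)))"
  have "path_homotopic pt_top (pt.close_up (torus_map \<circ> r')) (torus_map \<circ> L)"
  proof (rule pt_close_up[OF Csc])
    show "cos s \<ge> 0 \<or> cos t \<ge> 0" if "(s, t) \<in> C" for s t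
      using that cos_nonneg_of_small by (auto simp: C_def)
    show "pathin (top_of_set C) r'" using r'c r'C by (auto simp: pathin_top_of_set)
    show "pathin (top_of_set C) (rr 0)" "pathin (top_of_set C) (rr 1)" using rrC by auto
    show "pathin (top_of_set C) L" by (auto simp: pathin_top_of_set C_def L_def intro!: continuous_intros)
    show "spoke (torus_map (r' 0)) = torus_map \<circ> rr 0" "spoke (torus_map (r' 1)) = torus_map \<circ> rr 1"
      using spk by auto
  qed (auto simp: rr_def L_def)
  moreover have hr: "path_homotopic pt_top r (torus_map \<circ> r')"
    by (rule path_homotopic_eq[OF r(1)]) (simp add: tr)
  ultimately have "pt.lp r = loop_class pt_top pt_base (torus_map \<circ> L)"
    by (intro pt.lp_eq_class)
  moreover have "torus_map \<circ> L = (\<lambda>_. pt_base) \<or> torus_map \<circ> L = loop_b \<or> torus_map \<circ> L = path_reverse loop_b"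
  proof -
    have "k 0 = 0 \<or> k 0 = 2 * pi" "k 1 = 0 \<or> k 1 = 2 * pi" by (auto simp: k_def)
    moreover have "torus_map \<circ> L = (\<lambda>_. pt_base)" if "k 0 = k 1" "k 0 = 0 \<or> k 0 = 2 * pi"
      using that by (auto simp: L_def torus_map_def)
    moreover have "torus_map \<circ> L = loop_b" if "k 0 = 0" "k 1 = 2 * pi"
      using that by (auto simp: L_def loop_b_def mult.commute)
    moreover have "torus_map \<circ> L = path_reverse loop_b" if "k 0 = 2 * pi" "k 1 = 0"
      using that by (auto simp: L_def loop_b_def path_reverse_def fun_eq_iff algebra_simps)
    ultimately show ?thesis by metis
  qed
  moreover have "pt_b \<in> generate pt_group {pt_a, pt_b}" by (simp add: generate.incl)
  moreover have "inv\<^bsub>pt_group\<^esub> pt_b \<in> generate pt_group {pt_a, pt_b}" by (simp add: generate.inv)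
  ultimately show ?thesis
    using fundamental_group_inv[OF loop_b_loops] generate.one[of pt_group]
    by (auto simp: fundamental_group_one)
qed

text \<open>The argument of \<open>pt_lp_strip_b\<close> with the two coordinates exchanged.\<close>

lemma pt_lp_strip_a:
  assumes r: "pathin pt_top r" "r ` {0..1} \<subseteq> {y \<in> ptorus. Re (fst y) > 0}"
  shows "pt.lp r \<in> generate pt_group {pt_a, pt_b}"
proof -
  define C where "C = {(s::real, t::real). \<bar>t\<bar> \<le> pi/2}"
  define r' where "r' = (\<lambda>u. (Arg (fst (r u)) + pi, Arg (- snd (r u))))"
  define k where "k u = (if Arg (fst (r u)) \<le> 0 then 0 else 2 * pi)" for u :: real
  have n: "norm (fst (r u)) = 1" "norm (snd (r u)) = 1" "Re (snd (r u)) \<le> 0" "Re (fst (r u)) > 0" if "0 \<le> u" "u \<le> 1" for u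
  proof -
    have "r u \<in> ptorus" "Re (fst (r u)) > 0" using that r(2) unfolding image_subset_iff by auto
    then show "norm (fst (r u)) = 1" "norm (snd (r u)) = 1" "Re (snd (r u)) \<le> 0" "Re (fst (r u)) > 0"
      using ptorus_iff[of "fst (r u)" "snd (r u)"] by auto
  qed
  have rc: "continuous_on {0..1} r" using r by (auto simp: pathin_def)
  have 1: "- snd (r u) \<notin> \<real>\<^sub>\<le>\<^sub>0" "fst (r u) \<notin> \<real>\<^sub>\<le>\<^sub>0" if "0 \<le> u" "u \<le> 1" for u
    using n[OF that] by (auto simp: complex_nonpos_Reals_iff cmod_def)
  have r'c: "continuous_on {0..1} r'"
    unfolding r'_def using 1 by (auto intro!: continuous_intros rc)
  have small: "\<bar>Arg (- z)\<bar> \<le> pi/2" if "norm z = 1" "Re z \<le> 0" for z :: complex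
    using small_of_cos_nonneg[of "Arg (- z)"] Arg_bounded[of "-z"] that by (simp add: cos_Arg)
  have r'C: "r' u \<in> C" if "0 \<le> u" "u \<le> 1" for u
    unfolding C_def r'_def using n[OF that] small by auto
  have Csc: "simply_connected C"
  proof (rule convex_imp_simply_connected)
    have "C = UNIV \<times> {- (pi/2)..pi/2}" by (auto simp: C_def)
    then show "convex C" by (simp add: convex_Times)
  qed
  have tr: "torus_map (r' u) = r u" if "0 \<le> u" "u \<le> 1" for u
    using n[OF that] norm1_cis[of "- snd (r u)"] norm1_cis[of "fst (r u)"]
    by (auto simp: torus_map_def r'_def cis_mult[symmetric] prod_eq_iff)
  define rr where "rr v = (\<lambda>u. (k v + u * (fst (r' v) - k v), u * snd (r' v)))" for v :: real
  have rrC: "pathin (top_of_set C) (rr v)" if "0 \<le> v" "v \<le> 1" for v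
    using r'C[OF that] abs_scale_le[of _ "snd (r' v)" "pi/2"]
    by (auto simp: pathin_top_of_set rr_def C_def intro!: continuous_intros)
  have spk: "spoke (torus_map (r' v)) = torus_map \<circ> rr v" if "0 \<le> v" "v \<le> 1" for v
  proof
    fix u
    have "cis (k v + x) = cis x" for x by (simp add: k_def cis_mult[symmetric])
    then show "spoke (torus_map (r' v)) u = (torus_map \<circ> rr v) u"
      using tr[OF that] Arg_minus_shift[of "fst (r v)"] n[OF that]
      by (simp add: spoke_def rr_def torus_map_def r'_def k_def)
  qed
  define L where "L = (\<lambda>u. (k 0 + u * (k 1 - k 0), 0::real))"
  have "path_homotopic pt_top (pt.close_up (torus_map \<circ> r')) (torus_map \<circ> L)"
  proof (rule pt_close_up[OF Csc])
    show "cos s \<ge> 0 \<or> cos t \<ge> 0" if "(s, t) \<in> C" for s t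
      using that cos_nonneg_of_small by (auto simp: C_def)
    show "pathin (top_of_set C) r'" using r'c r'C by (auto simp: pathin_top_of_set)
    show "pathin (top_of_set C) (rr 0)" "pathin (top_of_set C) (rr 1)" using rrC by auto
    show "pathin (top_of_set C) L" by (auto simp: pathin_top_of_set C_def L_def intro!: continuous_intros)
    show "spoke (torus_map (r' 0)) = torus_map \<circ> rr 0" "spoke (torus_map (r' 1)) = torus_map \<circ> rr 1"
      using spk by auto
  qed (auto simp: rr_def L_def)
  moreover have hr: "path_homotopic pt_top r (torus_map \<circ> r')"
    by (rule path_homotopic_eq[OF r(1)]) (simp add: tr)
  ultimately have "pt.lp r = loop_class pt_top pt_base (torus_map \<circ> L)"
    by (intro pt.lp_eq_class)
  moreover have "torus_map \<circ> L = (\<lambda>_. pt_base) \<or> torus_map \<circ> L = loop_a \<or> torus_map \<circ> L = path_reverse loop_a"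
  proof -
    have "k 0 = 0 \<or> k 0 = 2 * pi" "k 1 = 0 \<or> k 1 = 2 * pi" by (auto simp: k_def)
    moreover have "torus_map \<circ> L = (\<lambda>_. pt_base)" if "k 0 = k 1" "k 0 = 0 \<or> k 0 = 2 * pi"
      using that by (auto simp: L_def torus_map_def)
    moreover have "torus_map \<circ> L = loop_a" if "k 0 = 0" "k 1 = 2 * pi"
      using that by (auto simp: L_def loop_a_def mult.commute)
    moreover have "torus_map \<circ> L = path_reverse loop_a" if "k 0 = 2 * pi" "k 1 = 0"
      using that by (auto simp: L_def loop_a_def path_reverse_def fun_eq_iff algebra_simps)
    ultimately show ?thesis by metis
  qed
  moreover have "pt_a \<in> generate pt_group {pt_a, pt_b}" by (simp add: generate.incl)
  moreover have "inv\<^bsub>pt_group\<^esub> pt_a \<in> generate pt_group {pt_a, pt_b}" by (simp add: generate.inv)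
  ultimately show ?thesis
    using fundamental_group_inv[OF loop_a_loops] generate.one[of pt_group]
    by (auto simp: fundamental_group_one)
qed

lemma openin_ptorus: "open V \<Longrightarrow> openin pt_top {y \<in> ptorus. y \<in> V}"
  by (auto simp: openin_open)

theorem pt_generated: "generate pt_group {pt_a, pt_b} = carrier pt_group"
proof
  have in_carrier: "{pt_a, pt_b} \<subseteq> carrier pt_group"
    using loop_a_loops loop_b_loops by (auto simp: fundamental_group_carrier)
  then show "generate pt_group {pt_a, pt_b} \<subseteq> carrier pt_group"
    by (rule pt.PI.generate_incl)
  have sg: "subgroup (generate pt_group {pt_a, pt_b}) pt_group"
    using in_carrier by (rule pt.PI.generate_is_subgroup)
  have "pt.lp p \<in> generate pt_group {pt_a, pt_b}" if p: "pathin pt_top p" for p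
  proof (rule pt.lp_in_subgroup[OF sg _ _ _ p, of pt_cover])
    have "open {y :: complex \<times> complex. fst y \<noteq> 1 \<and> snd y \<noteq> 1}" "open {y :: complex \<times> complex. Re (snd y) > 0}"
      "open {y :: complex \<times> complex. Re (fst y) > 0}"
      by (auto intro!: open_Collect_conj open_Collect_neq open_Collect_less continuous_intros)
    then show "openin pt_top U" if "U \<in> pt_cover" for U
      using that openin_ptorus unfolding pt_cover_def by fastforce
    show "topspace pt_top \<subseteq> \<Union>pt_cover" by (auto simp: pt_cover_def)
    show "pt.lp r \<in> generate pt_group {pt_a, pt_b}" if "U \<in> pt_cover" "pathin pt_top r" "r ` {0..1} \<subseteq> U" for U r
      using that pt_lp_spokes[of r] pt_lp_strip_a[of r] pt_lp_strip_b[of r] generate.one[of pt_group]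
      unfolding pt_cover_def by auto
  qed
  note gen = this
  show "carrier pt_group \<subseteq> generate pt_group {pt_a, pt_b}"
  proof
    fix a assume "a \<in> carrier pt_group"
    then obtain p where p: "p \<in> loops pt_top pt_base" "a = loop_class pt_top pt_base p"
      by (auto simp: fundamental_group_carrier)
    then show "a \<in> generate pt_group {pt_a, pt_b}"
      using gen[of p] pt.lp_loop[OF p(1)] by (simp add: loops_def)
  qed
qed

section \<open>Freeness on the two loops\<close>

definition crossing :: "('g, 'm) monoid_scheme \<Rightarrow> 'g \<Rightarrow> complex \<Rightarrow> complex \<Rightarrow> 'g" where
  "crossing \<Gamma> g u v =
     (if Re u > 0 \<and> Re v > 0 \<and> Im u < 0 \<and> 0 \<le> Im v then g
      else if Re u > 0 \<and> Re v > 0 \<and> 0 \<le> Im u \<and> Im v < 0 then inv\<^bsub>\<Gamma>\<^esub> g else \<one>\<^bsub>\<Gamma>\<^esub>)"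

text \<open>In each coordinate the arc omits one side of the point 1 within the right half circle,
  so two points of the same set never have a jump between them.\<close>

definition arc_set :: "real \<Rightarrow> real \<Rightarrow> (complex \<times> complex) set" where
  "arc_set \<sigma> \<tau> = {y \<in> ptorus. (Re (fst y) < 0 \<or> \<sigma> * Im (fst y) > 0) \<and> (Re (snd y) < 0 \<or> \<tau> * Im (snd y) > 0)}"

definition "arc_cover = {{y \<in> ptorus. Re (snd y) > 0}, {y \<in> ptorus. Re (fst y) > 0},
  arc_set 1 1, arc_set 1 (-1), arc_set (-1) 1, arc_set (-1) (-1)}"

text \<open>On the right half circle, \<open>crossing\<close> is the quotient of two values of the
  step function that is \<open>g\<close> where the imaginary part is nonnegative and 1 elsewhere;
  such quotients telescope. It counts passages through 1, positively when counterclockwise.\<close>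

lemma (in group) crossing_mult:
  assumes "g \<in> carrier G" "Re u > 0" "Re v > 0" "Re w > 0"
  shows "crossing G g u v \<otimes> crossing G g v w = crossing G g u w"
  using assms by (auto simp: crossing_def)

lemma (in group) crossing_closed [simp]: "g \<in> carrier G \<Longrightarrow> crossing G g u v \<in> carrier G"
  by (simp add: crossing_def)

lemma crossing_left: "Re u \<le> 0 \<or> Re v \<le> 0 \<Longrightarrow> crossing \<Gamma> g u v = \<one>\<^bsub>\<Gamma>\<^esub>"
  by (auto simp: crossing_def)

lemma crossing_arc:
  assumes "Re u < 0 \<or> \<sigma> * Im u > 0" "Re v < 0 \<or> \<sigma> * Im v > 0"
  shows "crossing \<Gamma> g u v = \<one>\<^bsub>\<Gamma>\<^esub>"
  using assms by (auto simp: crossing_def zero_less_mult_iff)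

text \<open>No member of the cover lets both coordinates jump: in a strip, the other coordinate
  stays in the closed left half plane, because the disc where both real parts are positive has been
  removed. Hence \<open>g\<close> and \<open>g'\<close> never have to commute.\<close>

lemma crossing_cocycle:
  assumes "group \<Gamma>" "g \<in> carrier \<Gamma>" "g' \<in> carrier \<Gamma>"
  shows "discrete_cocycle \<Gamma> pt_top arc_cover
     (\<lambda>y z. crossing \<Gamma> g (fst y) (fst z) \<otimes>\<^bsub>\<Gamma>\<^esub> crossing \<Gamma> g' (snd y) (snd z))"
proof -
  interpret group \<Gamma> by fact
  show ?thesis
  proof
    have 1: "open {y :: complex \<times> complex. Re (snd y) > 0}" "open {y :: complex \<times> complex. Re (fst y) > 0}"
      by (auto intro!: open_Collect_less continuous_intros)
    have 2: "open {y :: complex \<times> complex. (Re (fst y) < 0 \<or> \<sigma> * Im (fst y) > 0) \<and> (Re (snd y) < 0 \<or> \<tau> * Im (snd y) > 0)}" for \<sigma> \<tau>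
      by (intro open_Collect_conj open_Collect_disj open_Collect_less continuous_intros)
    have 3: "openin pt_top (arc_set \<sigma> \<tau>)" for \<sigma> \<tau>
      using openin_ptorus[OF 2[of \<sigma> \<tau>]] by (simp add: arc_set_def)
    show "openin pt_top U" if "U \<in> arc_cover" for U
      using that openin_ptorus[OF 1(1)] openin_ptorus[OF 1(2)] 3
      unfolding arc_cover_def by auto
    show "topspace pt_top \<subseteq> \<Union>arc_cover"
    proof
      fix y assume y: "y \<in> topspace pt_top"
      have n: "norm (fst y) = 1" "norm (snd y) = 1" using y ptorus_iff[of "fst y" "snd y"] by auto
      show "y \<in> \<Union>arc_cover"
      proof (cases "Re (fst y) > 0 \<or> Re (snd y) > 0")
        case True then show ?thesis using y by (auto simp: arc_cover_def)
      next
        case False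
        define \<sigma> where "\<sigma> = (if Im (fst y) > 0 then 1 else - 1 :: real)"
        define \<tau> where "\<tau> = (if Im (snd y) > 0 then 1 else - 1 :: real)"
        have nz: "Re z < 0 \<or> Im z \<noteq> 0" if "norm z = 1" "Re z \<le> 0" for z
          using that by (auto simp: cmod_def)
        have "y \<in> arc_set \<sigma> \<tau>"
          using nz[of "fst y"] nz[of "snd y"] n False y unfolding arc_set_def \<sigma>_def \<tau>_def by auto
        moreover have "arc_set \<sigma> \<tau> \<in> arc_cover" by (auto simp: arc_cover_def \<sigma>_def \<tau>_def)
        ultimately show ?thesis by blast
      qed
    qed
  next
    fix U y z w assume U: "U \<in> arc_cover" and yzw: "y \<in> U" "z \<in> U" "w \<in> U"
    have n: "Re (fst v) \<le> 0 \<or> Re (snd v) \<le> 0" if "v \<in> ptorus" for v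
      using that ptorus_iff[of "fst v" "snd v"] by auto
    consider "U = {y \<in> ptorus. Re (snd y) > 0}" | "U = {y \<in> ptorus. Re (fst y) > 0}" | \<sigma> \<tau> where "U = arc_set \<sigma> \<tau>"
      using U unfolding arc_cover_def by blast
    then show "crossing \<Gamma> g (fst y) (fst z) \<otimes>\<^bsub>\<Gamma>\<^esub> crossing \<Gamma> g' (snd y) (snd z) \<otimes>\<^bsub>\<Gamma>\<^esub>
        (crossing \<Gamma> g (fst z) (fst w) \<otimes>\<^bsub>\<Gamma>\<^esub> crossing \<Gamma> g' (snd z) (snd w)) =
        crossing \<Gamma> g (fst y) (fst w) \<otimes>\<^bsub>\<Gamma>\<^esub> crossing \<Gamma> g' (snd y) (snd w)"
    proof cases
      case 1
      then have "Re (fst y) \<le> 0" "Re (fst z) \<le> 0" "Re (fst w) \<le> 0" "Re (snd y) > 0" "Re (snd z) > 0" "Re (snd w) > 0"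
        using yzw n[of y] n[of z] n[of w] by auto
      then show ?thesis using assms by (simp add: crossing_left crossing_mult)
    next
      case 2
      then have "Re (snd y) \<le> 0" "Re (snd z) \<le> 0" "Re (snd w) \<le> 0" "Re (fst y) > 0" "Re (fst z) > 0" "Re (fst w) > 0"
        using yzw n[of y] n[of z] n[of w] by auto
      then show ?thesis using assms by (simp add: crossing_left crossing_mult)
    next
      case 3
      have "crossing \<Gamma> g (fst v) (fst v') = \<one>\<^bsub>\<Gamma>\<^esub>" "crossing \<Gamma> g' (snd v) (snd v') = \<one>\<^bsub>\<Gamma>\<^esub>" if "v \<in> U" "v' \<in> U" for v v'
        using that unfolding 3 arc_set_def by (auto intro: crossing_arc)
      then show ?thesis using yzw by simp
    qed
  qed (use assms in simp)
qed

lemma arc_sub_first: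
  assumes "0 \<le> x" "x \<le> 2 * pi / 3" shows "cos x > 0 \<or> sin x > 0"
  using assms sin_gt_zero[of x] pi_gt_zero by (cases "x = 0") auto

lemma arc_sub_mid:
  assumes "2 * pi / 3 \<le> x" "x \<le> 4 * pi / 3" shows "cos x < 0"
proof -
  have "- (pi / 2) < x - pi" "x - pi < pi / 2" using assms pi_gt_zero by linarith+
  then have "cos (x - pi) > 0" by (rule cos_gt_zero_pi)
  then show ?thesis by simp
qed

lemma arc_sub_last:
  assumes "4 * pi / 3 \<le> x" "x \<le> 2 * pi" shows "cos x > 0 \<or> sin x < 0"
  using assms sin_lt_zero[of x] pi_gt_zero by (cases "x = 2 * pi") auto

lemma less_3_cases: "i < 3 \<Longrightarrow> i = 0 \<or> i = 1 \<or> i = (2::nat)" by auto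

lemma scale_2pi:
  assumes "t \<in> {a / 3..b / 3}" shows "a * (2 * pi / 3) \<le> 2 * pi * t" "2 * pi * t \<le> b * (2 * pi / 3)"
proof -
  have "2 * pi * (a / 3) \<le> 2 * pi * t" "2 * pi * t \<le> 2 * pi * (b / 3)"
    using assms pi_gt_zero by (auto intro!: mult_left_mono)
  then show "a * (2 * pi / 3) \<le> 2 * pi * t" "2 * pi * t \<le> b * (2 * pi / 3)" by (auto simp: field_simps)
qed

text \<open>The moving coordinate passes 1 at time 1/2, inside the middle third, which lies in a
  strip; the outer thirds stay in sets without jumps.\<close>

lemma fine_loop_a: "fine_subdivision arc_cover loop_a 3"
  and fine_loop_b: "fine_subdivision arc_cover loop_b 3"
proof -
  have l: "loop_a t \<in> ptorus" "loop_b t \<in> ptorus" for t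
    by (auto simp: loop_a_def loop_b_def torus_map_in)
  have A: "\<exists>U\<in>arc_cover. loop_a ` {real i / real 3..real (Suc i) / real 3} \<subseteq> U" (is "?A i")
   and B: "\<exists>U\<in>arc_cover. loop_b ` {real i / real 3..real (Suc i) / real 3} \<subseteq> U" (is "?B i") if "i < 3" for i
  proof -
    consider "i = 0" | "i = 1" | "i = 2" using less_3_cases[OF \<open>i < 3\<close>] by blast
    then have "?A i \<and> ?B i"
    proof cases
      case 1
      have "cos (2 * pi * t) > 0 \<or> sin (2 * pi * t) > 0" if "t \<in> {0 / 3..1 / 3}" for t
        using scale_2pi[OF that] by (intro arc_sub_first) auto
      then have "loop_a t \<in> arc_set (-1) 1" "loop_b t \<in> arc_set 1 (-1)" if "t \<in> {0 / 3..1 / 3}" for t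
        using l[of t] that by (auto simp: arc_set_def loop_a_def loop_b_def torus_map_def)
      then have "loop_a ` {0 / 3..1 / 3} \<subseteq> arc_set (-1) 1" "loop_b ` {0 / 3..1 / 3} \<subseteq> arc_set 1 (-1)" by blast+
      then show ?thesis using 1 unfolding arc_cover_def by auto
    next
      case 2
      have "cos (2 * pi * t) < 0" if "t \<in> {1 / 3..2 / 3}" for t
        using scale_2pi[OF that] by (intro arc_sub_mid) auto
      then have "loop_a t \<in> {y \<in> ptorus. Re (fst y) > 0}" "loop_b t \<in> {y \<in> ptorus. Re (snd y) > 0}" if "t \<in> {1 / 3..2 / 3}" for t
        using l[of t] that by (auto simp: loop_a_def loop_b_def torus_map_def)
      then have "loop_a ` {1 / 3..2 / 3} \<subseteq> {y \<in> ptorus. Re (fst y) > 0}" "loop_b ` {1 / 3..2 / 3} \<subseteq> {y \<in> ptorus. Re (snd y) > 0}" by blast+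
      then show ?thesis using 2 unfolding arc_cover_def by auto
    next
      case 3
      have "cos (2 * pi * t) > 0 \<or> sin (2 * pi * t) < 0" if "t \<in> {2 / 3..3 / 3}" for t
        using scale_2pi[OF that] by (intro arc_sub_last) auto
      then have "loop_a t \<in> arc_set 1 1" "loop_b t \<in> arc_set 1 1" if "t \<in> {2 / 3..3 / 3}" for t
        using l[of t] that by (auto simp: arc_set_def loop_a_def loop_b_def torus_map_def)
      then have "loop_a ` {2 / 3..3 / 3} \<subseteq> arc_set 1 1" "loop_b ` {2 / 3..3 / 3} \<subseteq> arc_set 1 1" by blast+
      then show ?thesis using 3 unfolding arc_cover_def by auto
    qed
    then show "?A i" "?B i" by auto
  qed
  show "fine_subdivision arc_cover loop_a 3" "fine_subdivision arc_cover loop_b 3"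
    unfolding fine_subdivision_def by (intro conjI allI impI A B zero_less_numeral; assumption)+
qed

text \<open>The holonomy of the crossing cocycle. Over the thirds of each loop only the middle
  factor is nontrivial, and it equals the prescribed value. Together with
  \<open>pt_generated\<close> this makes the group free of rank 2.\<close>

theorem pt_universal:
  assumes \<Gamma>: "group \<Gamma>" and g: "g \<in> carrier \<Gamma>" "g' \<in> carrier \<Gamma>"
  shows "\<exists>\<eta>\<in>hom pt_group \<Gamma>. \<eta> pt_a = g \<and> \<eta> pt_b = g'"
proof -
  let ?c = "\<lambda>y z. crossing \<Gamma> g (fst y) (fst z) \<otimes>\<^bsub>\<Gamma>\<^esub> crossing \<Gamma> g' (snd y) (snd z)"
  interpret discrete_cocycle \<Gamma> pt_top arc_cover ?c by (rule crossing_cocycle[OF assms])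
  obtain \<eta> where \<eta>: "\<eta> \<in> hom pt_group \<Gamma>" "\<And>p. p \<in> loops pt_top pt_base \<Longrightarrow> \<eta> (loop_class pt_top pt_base p) = hol p"
    using hol_hom[OF pt.base] by blast
  have s: "sin (2 * pi / 3) > 0" "sin (4 * pi / 3) < 0" "cos (2 * pi / 3) < 0" "cos (4 * pi / 3) < 0"
    using sin_gt_zero[of "2 * pi / 3"] sin_lt_zero[of "4 * pi / 3"] arc_sub_mid[of "2 * pi / 3"] arc_sub_mid[of "4 * pi / 3"] pi_gt_zero
    by auto
  have p3: "pc f 3 = \<one>\<^bsub>\<Gamma>\<^esub> \<otimes>\<^bsub>\<Gamma>\<^esub> ?c (f 0) (f 1) \<otimes>\<^bsub>\<Gamma>\<^esub> ?c (f 1) (f 2) \<otimes>\<^bsub>\<Gamma>\<^esub> ?c (f 2) (f 3)" for f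
    by (simp add: eval_nat_numeral)
  have v: "crossing \<Gamma> k (-1) (- cis (2 * pi / 3)) = \<one>\<^bsub>\<Gamma>\<^esub>"
    "crossing \<Gamma> k (- cis (2 * pi / 3)) (- cis (4 * pi / 3)) = k"
    "crossing \<Gamma> k (- cis (4 * pi / 3)) (-1) = \<one>\<^bsub>\<Gamma>\<^esub>"
    "crossing \<Gamma> k (-1) (-1) = \<one>\<^bsub>\<Gamma>\<^esub>" for k
    using s by (auto simp: crossing_def)
  have "hol loop_a = g"
    unfolding hol_eq[OF fine_loop_a] p3 using v g by (simp add: loop_a_def torus_map_def)
  moreover have "hol loop_b = g'"
    unfolding hol_eq[OF fine_loop_b] p3 using v g by (simp add: loop_b_def torus_map_def)
  ultimately show ?thesis
    using \<eta>(2)[OF loop_a_loops] \<eta>(2)[OF loop_b_loops] by (intro bexI[OF _ \<eta>(1)]) simp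
qed

section \<open>Isomorphisms of fundamental groups\<close>

lemma fundamental_induced_iso:
  assumes f: "homeomorphic_map X Y f" and x: "x \<in> topspace X"
  shows "fundamental_induced Y (f x) f \<in> iso (fundamental_group X x) (fundamental_group Y (f x))"
proof -
  obtain g where g: "homeomorphic_maps X Y f g" using f by (auto simp: homeomorphic_map_maps)
  then have c: "continuous_map X Y f" "continuous_map Y X g" and gf: "\<And>y. y \<in> topspace X \<Longrightarrow> g (f y) = y"
    and fg: "\<And>y. y \<in> topspace Y \<Longrightarrow> f (g y) = y"
    by (auto simp: homeomorphic_maps_def)
  let ?f = "fundamental_induced Y (f x) f" and ?g = "fundamental_induced X (g (f x)) g"
  have y: "f x \<in> topspace Y" using c(1) x by (auto simp: continuous_map_def)
  have hf: "?f \<in> hom (fundamental_group X x) (fundamental_group Y (f x))"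
    by (rule fundamental_induced_hom[OF c(1)])
  have hg: "?g \<in> hom (fundamental_group Y (f x)) (fundamental_group X x)"
    using fundamental_induced_hom[OF c(2), of "f x"] gf[OF x] by simp
  have 1: "?g (?f a) = a" if "a \<in> carrier (fundamental_group X x)" for a
    using fundamental_induced_comp[OF c that] fundamental_induced_id[of X "g \<circ> f" x a] gf x that by simp
  have 2: "?f (?g a) = a" if "a \<in> carrier (fundamental_group Y (f x))" for a
    using fundamental_induced_comp[OF c(2,1) that] fundamental_induced_id[of Y "f \<circ> g" "f x" a] fg gf[OF x] y that by simp
  have "bij_betw ?f (carrier (fundamental_group X x)) (carrier (fundamental_group Y (f x)))"
    by (rule bij_betw_byWitness[where f' = ?g]) (use 1 2 hf hg in \<open>auto simp: hom_def\<close>)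
  then show ?thesis using hf by (simp add: iso_def)
qed

text \<open>On loops at \<open>y\<close> the function \<open>A.lp\<close> is conjugation by the
  spanning path from \<open>x\<close> to \<open>y\<close>; surjectivity comes from conjugating
  back.\<close>

lemma base_change_iso:
  assumes pc: "path_connected_space X" and x: "x \<in> topspace X" and y: "y \<in> topspace X"
  shows "\<exists>\<theta>. \<theta> \<in> iso (fundamental_group X y) (fundamental_group X x)"
proof -
  obtain k where "spanning_paths X x k" using spanning_paths_exist[OF pc x] by blast
  then interpret A: spanning_paths X x k .
  obtain k' where "spanning_paths X y k'" using spanning_paths_exist[OF pc y] by blast
  then interpret B: spanning_paths X y k' .
  define \<theta> where "\<theta> a = A.lp (SOME p. p \<in> loops X y \<and> a = loop_class X y p)" for a
  have e: "\<theta> (loop_class X y p) = A.lp p" if "p \<in> loops X y" for p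
  proof -
    let ?q = "SOME q. q \<in> loops X y \<and> loop_class X y p = loop_class X y q"
    have "?q \<in> loops X y \<and> loop_class X y p = loop_class X y ?q"
      using someI[of "\<lambda>q. q \<in> loops X y \<and> loop_class X y p = loop_class X y q" p] that by blast
    then have "path_homotopic X p ?q" using loop_class_eq_iff[OF that] by blast
    then show ?thesis unfolding \<theta>_def by (rule A.lp_homotopic[symmetric])
  qed
  have hom: "\<theta> \<in> hom (fundamental_group X y) (fundamental_group X x)"
  proof (rule homI)
    fix a b assume "a \<in> carrier (fundamental_group X y)" "b \<in> carrier (fundamental_group X y)"
    then obtain p q where p: "p \<in> loops X y" "a = loop_class X y p" and q: "q \<in> loops X y" "b = loop_class X y q"
      by (auto simp: fundamental_group_carrier)
    then show "\<theta> (a \<otimes>\<^bsub>fundamental_group X y\<^esub> b) = \<theta> a \<otimes>\<^bsub>fundamental_group X x\<^esub> \<theta> b"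
      using A.lp_concat[of p q] by (simp add: fundamental_group_mult e loops_concat) (simp add: loops_def)
  next
    fix a assume "a \<in> carrier (fundamental_group X y)"
    then obtain p where p: "p \<in> loops X y" "a = loop_class X y p" by (auto simp: fundamental_group_carrier)
    then show "\<theta> a \<in> carrier (fundamental_group X x)"
      using A.lp_carrier[of p] by (simp add: e) (simp add: loops_def)
  qed
  have ky: "pathin X (k y)" "k y 0 = x" "k y 1 = y" using A.k_path[OF y] by auto
  have "inj_on \<theta> (carrier (fundamental_group X y))"
  proof (rule inj_onI)
    fix a b assume ab: "a \<in> carrier (fundamental_group X y)" "b \<in> carrier (fundamental_group X y)" "\<theta> a = \<theta> b"
    then obtain p q where p: "p \<in> loops X y" "a = loop_class X y p" and q: "q \<in> loops X y" "b = loop_class X y q"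
      by (auto simp: fundamental_group_carrier)
    have pq: "pathin X p" "p 0 = y" "p 1 = y" "pathin X q" "q 0 = y" "q 1 = y" using p q by (auto simp: loops_def)
    have "path_homotopic X (A.close_up p) (A.close_up q)"
      using ab e p q A.close_up_loops pq by (simp add: A.lp_def loop_class_eq_iff)
    \<comment> \<open>Spanning paths based at \<open>y\<close> make the two copies of
      \<open>k y\<close> into group elements, which can then be cancelled.\<close>
    then have "B.lp (A.close_up p) = B.lp (A.close_up q)" by (rule B.lp_homotopic)
    then have "B.lp (k y) \<otimes>\<^bsub>fundamental_group X y\<^esub> (B.lp p \<otimes>\<^bsub>fundamental_group X y\<^esub> B.lp (path_reverse (k y))) =
       B.lp (k y) \<otimes>\<^bsub>fundamental_group X y\<^esub> (B.lp q \<otimes>\<^bsub>fundamental_group X y\<^esub> B.lp (path_reverse (k y)))"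
      using pq ky by (simp add: A.close_up_def B.lp_concat pathin_concat pathin_reverse)
    then have "B.lp p = B.lp q" using pq ky by (simp add: pathin_reverse)
    then show "a = b" using B.lp_loop p q by simp
  qed
  moreover have "\<theta> ` carrier (fundamental_group X y) = carrier (fundamental_group X x)"
  proof
    show "\<theta> ` carrier (fundamental_group X y) \<subseteq> carrier (fundamental_group X x)" using hom by (auto simp: hom_def)
    show "carrier (fundamental_group X x) \<subseteq> \<theta> ` carrier (fundamental_group X y)"
    proof
      fix a assume "a \<in> carrier (fundamental_group X x)"
      then obtain p where p: "p \<in> loops X x" "a = loop_class X x p" by (auto simp: fundamental_group_carrier)
      let ?q = "loop_concat (path_reverse (k y)) (loop_concat p (k y))"
      have pp: "pathin X p" "p 0 = x" "p 1 = x" using p by (auto simp: loops_def)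
      have q: "?q \<in> loops X y" using pp ky by (auto simp: loops_def intro!: pathin_concat pathin_reverse)
      have "A.lp ?q = A.lp p"
        using pp ky y by (simp add: A.lp_concat pathin_concat pathin_reverse A.lp_reverse A.lp_k)
      then have "\<theta> (loop_class X y ?q) = a" using e[OF q] A.lp_loop[OF p(1)] p by simp
      moreover have "loop_class X y ?q \<in> carrier (fundamental_group X y)" using q by (auto simp: fundamental_group_carrier)
      ultimately show "a \<in> \<theta> ` carrier (fundamental_group X y)" by blast
    qed
  qed
  ultimately show ?thesis using hom by (auto simp: iso_def bij_betw_def)
qed

lemma path_connected_pt: "path_connected_space pt_top"
  unfolding path_connected_space_def
proof (intro ballI)
  fix y z assume yz: "y \<in> topspace pt_top" "z \<in> topspace pt_top"
  let ?p = "loop_concat (path_reverse (spoke y)) (spoke z)"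
  have "pathin pt_top ?p" "?p 0 = y" "?p 1 = z"
    using pt.k_path[OF yz(1)] pt.k_path[OF yz(2)] by (auto intro!: pathin_concat pathin_reverse)
  then show "\<exists>g. pathin pt_top g \<and> g 0 = y \<and> g 1 = z" by blast
qed

theorem punctured_torus_iso:
  assumes T: "punctured_torus T B" and x: "x \<in> topspace T"
  shows "\<exists>\<theta>. \<theta> \<in> iso pt_group (fundamental_group T x)" "path_connected_space T"
proof -
  obtain f where f: "homeomorphic_map T pt_top f"
    using T by (auto simp: punctured_torus_def ptorus_def)
  then have hs: "T homeomorphic_space pt_top" using homeomorphic_map_imp_homeomorphic_space by blast
  then show pc: "path_connected_space T"
    using homeomorphic_path_connected_space path_connected_pt by blast
  obtain g where g: "homeomorphic_map pt_top T g"
    using hs homeomorphic_space_sym homeomorphic_space by metis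
  have gb: "g pt_base \<in> topspace T" using g pt.base by (auto simp: homeomorphic_eq_everything_map)
  have 1: "fundamental_induced T (g pt_base) g \<in> iso pt_group (fundamental_group T (g pt_base))"
    by (rule fundamental_induced_iso[OF g pt.base])
  obtain \<theta> where "\<theta> \<in> iso (fundamental_group T (g pt_base)) (fundamental_group T x)"
    using base_change_iso[OF pc x gb] by blast
  then show "\<exists>\<theta>. \<theta> \<in> iso pt_group (fundamental_group T x)"
    using iso_set_trans[OF 1] by blast
qed

section \<open>The infinite cyclic cover of a mapping torus\<close>

lemma cis_2pi_eq_iff: "cis (2 * pi * s) = cis (2 * pi * t) \<longleftrightarrow> s - t \<in> \<int>"
proof -
  have "cis (2 * pi * s) = cis (2 * pi * t) \<longleftrightarrow> cis (2 * pi * (s - t)) = 1"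
    by (simp add: right_diff_distrib cis_divide[symmetric])
  also have "\<dots> \<longleftrightarrow> (\<exists>n::int. 2 * pi * (s - t) = of_int (2 * n) * pi)"
    by (simp add: cis_conv_exp exp_eq_1)
  also have "\<dots> \<longleftrightarrow> s - t \<in> \<int>" by (auto simp: Ints_def)
  finally show ?thesis .
qed

lemma int_valued_constant:
  fixes f :: "'c::topological_space \<Rightarrow> real"
  assumes "connected S" "continuous_on S f" "\<And>x. x \<in> S \<Longrightarrow> f x \<in> \<int>" "x \<in> S" "y \<in> S"
  shows "f x = f y"
proof -
  have "f constant_on S"
  proof (rule continuous_discrete_range_constant[OF assms(1,2)])
    fix x assume x: "x \<in> S"
    have "1 \<le> norm (f y - f x)" if "y \<in> S" "f y \<noteq> f x" for y
    proof -
      have "f y - f x \<in> \<int>" using assms(3) x that by auto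
      then show ?thesis using that Ints_nonzero_abs_ge1[of "f y - f x"] by simp
    qed
    then show "\<exists>e>0. \<forall>y. y \<in> S \<and> f y \<noteq> f x \<longrightarrow> e \<le> norm (f y - f x)" by (intro exI[of _ 1]) auto
  qed
  then show ?thesis using assms by (auto simp: constant_on_def)
qed

lemma continuous_map_Pair:
  assumes "continuous_map X euclidean u" "continuous_map X euclidean v"
  shows "continuous_map X euclidean (\<lambda>z. (u z, v z))"
  using continuous_map_pairedI[OF assms] by simp

lemma continuous_map_scale:
  fixes v :: "'c \<Rightarrow> 'd::real_normed_vector"
  assumes "continuous_map X euclideanreal u" "continuous_map X euclidean v"
  shows "continuous_map X euclidean (\<lambda>z. u z *\<^sub>R v z)"
proof -
  have "continuous_map euclidean euclidean (\<lambda>p :: real \<times> 'd. fst p *\<^sub>R snd p)" by (auto intro!: continuous_intros)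
  from continuous_map_compose[OF continuous_map_Pair[OF assms] this] show ?thesis by (simp add: o_def)
qed

text \<open>The injection \<open>f\<close> into a normed space serves to prove \<open>M\<close>
  Hausdorff; with \<open>T\<close> compact, this makes short pieces of the cyclic cover embed. The
  fixed point \<open>x\<close> traces a closed loop through the bundle.\<close>

locale torus_bundle =
  fixes T :: "'a topology" and h h' :: "'a \<Rightarrow> 'a" and M :: "'b topology" and q :: "'a \<times> real \<Rightarrow> 'b"
    and f :: "'a \<Rightarrow> 'e::real_normed_vector" and x :: 'a
  assumes comp: "compact_space T" and f: "continuous_map T euclidean f" "inj_on f (topspace T)"
    and hmaps: "homeomorphic_maps T T h h'" and mt: "mapping_torus T h M q"
    and x: "x \<in> topspace T" "h x = x"
begin

abbreviation "m0 \<equiv> q (x, 0)"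

lemma h: "continuous_map T T h" "continuous_map T T h'"
  "y \<in> topspace T \<Longrightarrow> h (h' y) = y" "y \<in> topspace T \<Longrightarrow> h' (h y) = y"
  "y \<in> topspace T \<Longrightarrow> h y \<in> topspace T" "y \<in> topspace T \<Longrightarrow> h' y \<in> topspace T"
  using hmaps by (auto simp: homeomorphic_maps_def continuous_map_def)

lemma qmap: "quotient_map (prod_topology T (top_of_set {0..1})) M q"
  using mt by (simp add: mapping_torus_def)

lemma qcont: "continuous_map (prod_topology T (top_of_set {0..1})) M q"
  using qmap by (rule quotient_imp_continuous_map)

lemma q_eq:
  assumes "y \<in> topspace T" "y' \<in> topspace T" "t \<in> {0..1}" "t' \<in> {0..1}"
  shows "q (y, t) = q (y', t') \<longleftrightarrow> (y, t) = (y', t') \<or> (t = 1 \<and> t' = 0 \<and> y' = h y) \<or> (t = 0 \<and> t' = 1 \<and> y = h y')"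
  using mt assms unfolding mapping_torus_def by blast

lemma q_glue: "y \<in> topspace T \<Longrightarrow> q (y, 1) = q (h y, 0)"
  by (subst q_eq) (auto simp: h)

lemma q_surj: assumes "m \<in> topspace M" obtains y t where "y \<in> topspace T" "0 \<le> t" "t < 1" "m = q (y, t)"
proof -
  have "m \<in> q ` (topspace T \<times> {0..1})" using assms quotient_imp_surjective_map[OF qmap] by simp
  then obtain y t where yt: "y \<in> topspace T" "t \<in> {0..1}" "m = q (y, t)" by auto
  show thesis
  proof (cases "t = 1")
    case True
    then show thesis using that[of "h y" 0] yt q_glue h by auto
  next
    case False
    then show thesis using that[of y t] yt by auto
  qed
qed

text \<open>Glued points have parameters 0 and 1, where \<open>cis (2 * pi * t)\<close> agrees, so
  the function descends to the quotient. It is the bundle projection to the circle.\<close>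

lemma angle_exists: "\<exists>g. continuous_map M euclidean g \<and> (\<forall>y\<in>topspace T. \<forall>t\<in>{0..1}. g (q (y, t)) = cis (2 * pi * t))"
proof -
  let ?c = "\<lambda>z::'a\<times>real. cis (2 * pi * snd z)"
  have c: "continuous_map (prod_topology T (top_of_set {0..1})) euclidean ?c"
  proof -
    have "continuous_map (top_of_set {0..1::real}) euclidean (\<lambda>t. cis (2 * pi * t))"
      by (auto intro!: continuous_intros)
    from continuous_map_compose[OF continuous_map_snd this] show ?thesis by (simp add: o_def)
  qed
  have e: "?c z = ?c z'" if z: "z \<in> topspace (prod_topology T (top_of_set {0..1}))" "z' \<in> topspace (prod_topology T (top_of_set {0..1}))"
    and eq: "q z = q z'" for z z'
  proof -
    obtain y t y' t' where yt: "z = (y, t)" "z' = (y', t')" by (metis surj_pair)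
    then have "(y, t) = (y', t') \<or> (t = 1 \<and> t' = 0 \<and> y' = h y) \<or> (t = 0 \<and> t' = 1 \<and> y = h y')"
      using q_eq[of y y' t t'] z eq by auto
    then show ?thesis using yt by auto
  qed
  obtain g where "continuous_map M euclidean g" "\<And>z. z \<in> topspace (prod_topology T (top_of_set {0..1})) \<Longrightarrow> g (q z) = ?c z"
  proof (rule quotient_map_lift_exists[OF qmap c])
    show "?c z = ?c z'" if "z \<in> topspace (prod_topology T (top_of_set {0..1}))" "z' \<in> topspace (prod_topology T (top_of_set {0..1}))"
      "q z = q z'" for z z' using that by (rule e)
  qed blast
  then show ?thesis by (intro exI[of _ g]) auto
qed

definition angle :: "'b \<Rightarrow> complex" where
  "angle = (SOME g. continuous_map M euclidean g \<and> (\<forall>y\<in>topspace T. \<forall>t\<in>{0..1}. g (q (y, t)) = cis (2 * pi * t)))"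

lemma angle: "continuous_map M euclidean angle" "y \<in> topspace T \<Longrightarrow> 0 \<le> t \<Longrightarrow> t \<le> 1 \<Longrightarrow> angle (q (y, t)) = cis (2 * pi * t)"
  using someI_ex[OF angle_exists] unfolding angle_def by auto

text \<open>The second coordinate separates the points of the fibre over 0, the third one those of the other
  fibres; hence \<open>M\<close> injects into a metric space.\<close>

lemma Hausdorff_M: "Hausdorff_space M"
proof -
  let ?c = "\<lambda>z::'a\<times>real. (cis (2 * pi * snd z), (1 - snd z) *\<^sub>R f (fst z) + snd z *\<^sub>R f (h (fst z)), (snd z * (1 - snd z)) *\<^sub>R f (fst z))"
  let ?X = "prod_topology T (top_of_set {0..1::real})"
  have s: "continuous_map ?X euclideanreal snd"
    using continuous_map_into_fulltopology[OF continuous_map_snd] by blast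
  have f1: "continuous_map ?X euclidean (\<lambda>z. f (fst z))" "continuous_map ?X euclidean (\<lambda>z. f (h (fst z)))"
    using continuous_map_compose[OF continuous_map_fst f(1)] continuous_map_compose[OF continuous_map_compose[OF continuous_map_fst h(1)] f(1)]
    by (auto simp: o_def)
  have c: "continuous_map ?X euclidean ?c"
  proof (intro continuous_map_Pair)
    have "continuous_map euclideanreal euclidean (\<lambda>t. cis (2 * pi * t))" by (auto intro!: continuous_intros)
    from continuous_map_compose[OF s this] show "continuous_map ?X euclidean (\<lambda>z. cis (2 * pi * snd z))" by (simp add: o_def)
    show "continuous_map ?X euclidean (\<lambda>z. (1 - snd z) *\<^sub>R f (fst z) + snd z *\<^sub>R f (h (fst z)))"
      "continuous_map ?X euclidean (\<lambda>z. (snd z * (1 - snd z)) *\<^sub>R f (fst z))"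
      by (intro continuous_map_add continuous_map_scale continuous_map_diff continuous_map_real_mult s f1; simp)+
  qed
  have e: "?c z = ?c z'" if z: "z \<in> topspace ?X" "z' \<in> topspace ?X" and eq: "q z = q z'" for z z'
  proof -
    obtain y t y' t' where yt: "z = (y, t)" "z' = (y', t')" by (metis surj_pair)
    then have "(y, t) = (y', t') \<or> (t = 1 \<and> t' = 0 \<and> y' = h y) \<or> (t = 0 \<and> t' = 1 \<and> y = h y')"
      using q_eq[of y y' t t'] z eq by auto
    then show ?thesis using yt by auto
  qed
  obtain g where g: "continuous_map M euclidean g" "\<And>z. z \<in> topspace ?X \<Longrightarrow> g (q z) = ?c z"
  proof (rule quotient_map_lift_exists[OF qmap c])
    show "?c z = ?c z'" if "z \<in> topspace ?X" "z' \<in> topspace ?X" "q z = q z'" for z z' using that by (rule e)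
  qed blast
  have "inj_on g (topspace M)"
  proof (rule inj_onI)
    fix m m' assume m: "m \<in> topspace M" "m' \<in> topspace M" "g m = g m'"
    obtain y t where yt: "y \<in> topspace T" "0 \<le> t" "t < 1" "m = q (y, t)" using q_surj[OF m(1)] .
    obtain y' t' where yt': "y' \<in> topspace T" "0 \<le> t'" "t' < 1" "m' = q (y', t')" using q_surj[OF m(2)] .
    have eq: "?c (y, t) = ?c (y', t')" using m(3) g(2)[of "(y, t)"] g(2)[of "(y', t')"] yt yt' by simp
    then have "t - t' \<in> \<int>" using cis_2pi_eq_iff[of t t'] by simp
    then have tt: "t = t'" using yt yt' Ints_nonzero_abs_less1[of "t - t'"] by auto
    have "f y = f y'"
    proof (cases "t = 0")
      case True then show ?thesis using eq tt by simp
    next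
      case False then show ?thesis using eq tt yt by simp
    qed
    then show "m = m'" using f(2) yt yt' tt by (simp add: inj_on_eq_iff)
  qed
  then show ?thesis using Hausdorff_space_injective_preimage[OF _ g(1)] by simp
qed

section \<open>The covering of the bundle by the product of the fibre with the line\<close>

definition hp :: "int \<Rightarrow> 'a \<Rightarrow> 'a" where
  "hp n = (if n \<ge> 0 then h ^^ nat n else h' ^^ nat (- n))"

lemma hp_0 [simp]: "hp 0 y = y" by (simp add: hp_def)

lemma funpow_cont: "continuous_map T T g \<Longrightarrow> continuous_map T T (g ^^ n)"
  by (induction n) (auto intro: continuous_map_compose simp: id_def[symmetric] simp del: funpow.simps simp: funpow_Suc_right funpow_0[abs_def])

lemma hp_cont: "continuous_map T T (hp n)"
  using funpow_cont h by (simp add: hp_def)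

lemma hp_in: "y \<in> topspace T \<Longrightarrow> hp n y \<in> topspace T"
  using hp_cont[of n] by (auto simp: continuous_map_def)

lemma hp_Suc: assumes y: "y \<in> topspace T" shows "hp (n + 1) y = h (hp n y)"
proof (cases "n \<ge> 0")
  case True
  then have "nat (n + 1) = Suc (nat n)" by auto
  then show ?thesis using True by (simp add: hp_def)
next
  case False
  then have "nat (- n) = Suc (nat (- (n + 1)))" by auto
  then have "hp n y = h' (hp (n + 1) y)" using False by (cases "n + 1 = 0") (auto simp: hp_def)
  then show ?thesis using h(3)[OF hp_in[OF y]] by simp
qed

lemma hp_bij: "bij_betw (hp n) (topspace T) (topspace T)"
proof (induction n rule: int_induct[where k = 0])
  case base
  show ?case using bij_betw_id[of "topspace T"] by (simp add: hp_def id_def)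
next
  have hb: "bij_betw h (topspace T) (topspace T)" by (rule bij_betw_byWitness[where f' = h']) (use h in auto)
  case (step1 n)
  have "bij_betw (h \<circ> hp n) (topspace T) (topspace T)" using step1(2) hb by (rule bij_betw_trans)
  then show ?case by (rule bij_betw_cong[THEN iffD1, rotated]) (simp add: hp_Suc)
next
  have hb: "bij_betw h' (topspace T) (topspace T)" by (rule bij_betw_byWitness[where f' = h]) (use h in auto)
  case (step2 n)
  have "bij_betw (h' \<circ> hp n) (topspace T) (topspace T)" using step2(2) hb by (rule bij_betw_trans)
  moreover have "(h' \<circ> hp n) y = hp (n - 1) y" if "y \<in> topspace T" for y
    using hp_Suc[OF that, of "n - 1"] h(4)[OF hp_in[OF that]] by simp
  ultimately show ?case by (rule bij_betw_cong[THEN iffD1, rotated])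
qed

text \<open>Passing an integer height means passing from \<open>q (y, 1)\<close> to
  \<open>q (h y, 0)\<close>, so one application of \<open>h\<close> is accumulated per unit of
  height.\<close>

definition cover :: "'a \<times> real \<Rightarrow> 'b" where
  "cover = (\<lambda>(y, s). q (hp \<lfloor>s\<rfloor> y, frac s))"

abbreviation "TR \<equiv> prod_topology T euclideanreal"

lemma cover_strip:
  assumes y: "y \<in> topspace T" and s: "of_int n \<le> s" "s \<le> of_int n + 1"
  shows "cover (y, s) = q (hp n y, s - of_int n)"
proof (cases "s = of_int n + 1")
  case True
  then have "\<lfloor>s\<rfloor> = n + 1" "frac s = 0" by (auto simp: frac_def)
  then show ?thesis using True hp_Suc[OF y] q_glue[OF hp_in[OF y]] by (simp add: cover_def)
next
  case False
  then have "\<lfloor>s\<rfloor> = n" using s by (simp add: floor_eq_iff)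
  then show ?thesis by (simp add: cover_def frac_def)
qed

lemma cover_strip_cont: "continuous_map (subtopology TR (UNIV \<times> {of_int n..of_int n + 1})) M cover"
proof -
  let ?X = "subtopology TR (UNIV \<times> {of_int n..of_int n + 1})"
  have 1: "continuous_map ?X T (\<lambda>z. hp n (fst z))"
    using continuous_map_compose[OF continuous_map_from_subtopology[OF continuous_map_fst] hp_cont] by (simp add: o_def)
  have "continuous_map ?X euclideanreal (\<lambda>z. snd z - of_int n)"
    by (intro continuous_map_diff continuous_map_from_subtopology[OF continuous_map_snd]) simp
  then have 2: "continuous_map ?X (top_of_set {0..1}) (\<lambda>z. snd z - of_int n)"
    by (auto simp: continuous_map_in_subtopology)
  have "continuous_map ?X M (\<lambda>z. q (hp n (fst z), snd z - of_int n))"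
    using continuous_map_compose[OF continuous_map_pairedI[OF 1 2] qcont] by (simp add: o_def)
  then show ?thesis
    by (rule continuous_map_eq) (auto simp: cover_strip)
qed

lemma cover_cont: "continuous_map TR M cover"
proof (rule pasting_lemma[where I = UNIV and T = "\<lambda>n::int. topspace T \<times> {of_int n - 1<..<of_int n + 1}" and f = "\<lambda>_. cover"])
  fix n :: int
  show "openin TR (topspace T \<times> {of_int n - 1<..<of_int n + 1})"
    by (simp add: openin_prod_Times_iff)
  \<comment> \<open>The conditional with equal branches brings the gluing of the two closed strips
    above and below height \<open>n\<close> into the shape of
    \<open>continuous_map_cases_le\<close>.\<close>
  have "continuous_map (subtopology TR (UNIV \<times> {of_int (n - 1)..of_int n + 1})) M (\<lambda>z. if snd z \<le> of_int n then cover z else cover z)"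
  proof (rule continuous_map_cases_le)
    let ?X = "subtopology TR (UNIV \<times> {of_int (n - 1)..of_int n + 1})"
    show "continuous_map ?X euclideanreal snd" "continuous_map ?X euclideanreal (\<lambda>z. of_int n)"
      by (auto intro: continuous_map_from_subtopology[OF continuous_map_snd])
    show "continuous_map (subtopology ?X {z. z \<in> topspace ?X \<and> snd z \<le> of_int n}) M cover"
      unfolding subtopology_subtopology
      by (rule continuous_map_from_subtopology_mono[OF cover_strip_cont[of "n - 1"]]) auto
    show "continuous_map (subtopology ?X {z. z \<in> topspace ?X \<and> of_int n \<le> snd z}) M cover"
      unfolding subtopology_subtopology
      by (rule continuous_map_from_subtopology_mono[OF cover_strip_cont[of n]]) auto
  qed simp
  then have "continuous_map (subtopology TR (UNIV \<times> {of_int (n - 1)..of_int n + 1})) M cover" by simp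
  then show "continuous_map (subtopology TR (topspace T \<times> {of_int n - 1<..<of_int n + 1})) M cover"
    by (rule continuous_map_from_subtopology_mono) auto
next
  fix z assume "z \<in> topspace TR"
  then show "\<exists>n. n \<in> UNIV \<and> z \<in> topspace T \<times> {of_int n - 1<..<of_int n + 1} \<and> cover z = cover z"
    by (intro exI[of _ "\<lfloor>snd z\<rfloor>"]) (auto simp: mem_Times_iff, linarith)
qed auto

lemma cover_0: "cover (y, 0) = q (y, 0)" by (simp add: cover_def)

lemma frac_bounds: "frac s \<in> {0..1}" using frac_ge_0[of s] frac_lt_1[of s] by auto

lemma angle_cover: assumes "y \<in> topspace T" shows "angle (cover (y, s)) = cis (2 * pi * s)"
proof -
  have "angle (cover (y, s)) = cis (2 * pi * frac s)"
    using angle(2)[OF hp_in[OF assms] frac_ge_0 less_imp_le[OF frac_lt_1]] by (simp add: cover_def)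
  also have "\<dots> = cis (2 * pi * s)" by (simp add: cis_2pi_eq_iff) (simp add: frac_def)
  finally show ?thesis .
qed

lemma cover_inj_fibre:
  assumes "y \<in> topspace T" "y' \<in> topspace T" "cover (y, s) = cover (y', s)" shows "y = y'"
proof -
  have "hp \<lfloor>s\<rfloor> y = hp \<lfloor>s\<rfloor> y'"
    using assms q_eq[OF hp_in[OF assms(1)] hp_in[OF assms(2)] frac_bounds frac_bounds] frac_lt_1[of s]
    by (auto simp: cover_def)
  then show ?thesis using hp_bij[of "\<lfloor>s\<rfloor>"] assms by (auto simp: bij_betw_def inj_on_def)
qed

lemma cover_surj_fibre:
  assumes m: "m \<in> topspace M" "angle m = cis (2 * pi * s)"
  shows "\<exists>y\<in>topspace T. cover (y, s) = m"
proof -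
  obtain y t where yt: "y \<in> topspace T" "0 \<le> t" "t < 1" "m = q (y, t)" using q_surj[OF m(1)] .
  then have "t - s \<in> \<int>" using m(2) angle(2)[of y t] cis_2pi_eq_iff[of t s] by simp
  then have fr: "frac s = t" using yt by (metis frac_unique_iff Ints_minus minus_diff_eq)
  have "y \<in> hp \<lfloor>s\<rfloor> ` topspace T" using hp_bij[of "\<lfloor>s\<rfloor>"] yt(1) by (simp add: bij_betw_def)
  then obtain y' where "y' \<in> topspace T" "hp \<lfloor>s\<rfloor> y' = y" by blast
  then show ?thesis using yt fr by (intro bexI[of _ y']) (auto simp: cover_def)
qed

text \<open>With the height \<open>s\<close> prescribed, the point of the fibre is unique. It varies
  continuously because \<open>cover\<close>, restricted to a short closed range of heights, is a
  continuous injection of a compact space into a Hausdorff one and so has a continuous inverse on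
  its image.\<close>

lemma cover_lift:
  fixes Z :: "'z::real_normed_vector set"
  assumes F: "continuous_map (top_of_set Z) M F" and s: "continuous_on Z s"
    and eq: "\<And>z. z \<in> Z \<Longrightarrow> angle (F z) = cis (2 * pi * s z)"
  obtains y where "continuous_map (top_of_set Z) T y" "\<And>z. z \<in> Z \<Longrightarrow> F z = cover (y z, s z)"
proof -
  have Fz: "F z \<in> topspace M" if "z \<in> Z" for z using F that by (auto simp: continuous_map_def)
  have "\<exists>y\<in>topspace T. cover (y, s z) = F z" if "z \<in> Z" for z
    using cover_surj_fibre[OF Fz[OF that] eq[OF that]] .
  then obtain y where y: "\<And>z. z \<in> Z \<Longrightarrow> y z \<in> topspace T \<and> cover (y z, s z) = F z" by metis
  \<comment> \<open>The corresponding range of heights has length 2/3; any length below 1 makes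
    \<open>cover\<close> injective on it.\<close>
  define N where "N z0 = {z \<in> Z. s z \<in> {s z0 - 1/3<..<s z0 + 1/3}}" for z0
  have N: "openin (top_of_set Z) (N z0)" for z0
    using continuous_openin_preimage_gen[OF s, of "{s z0 - 1/3<..<s z0 + 1/3}"] by (simp add: N_def vimage_def Int_def)
  have loc: "continuous_map (subtopology (top_of_set Z) (N z0)) T y" if z0: "z0 \<in> Z" for z0
  proof -
    let ?I = "{s z0 - 1/3..s z0 + 1/3}"
    let ?X = "prod_topology T (top_of_set ?I)"
    have X: "?X = subtopology TR (topspace T \<times> ?I)"
      by (metis prod_topology_subtopology(2) subtopology_topspace prod_topology_subtopology(1) subtopology_Times)
    have cX: "continuous_map ?X M cover" unfolding X by (rule continuous_map_from_subtopology[OF cover_cont])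
    have compX: "compact_space ?X" using comp by (simp add: compact_space_prod_topology compact_space_subtopology)
    have "inj_on cover (topspace ?X)"
    proof (rule inj_onI)
      fix u v assume uv: "u \<in> topspace ?X" "v \<in> topspace ?X" "cover u = cover v"
      obtain a t b r where ab: "u = (a, t)" "v = (b, r)" by (metis surj_pair)
      have "cis (2 * pi * t) = cis (2 * pi * r)" using uv angle_cover[of a t] angle_cover[of b r] ab by auto
      then have "t - r \<in> \<int>" by (simp only: cis_2pi_eq_iff)
      moreover have "\<bar>t - r\<bar> < 1" using uv ab by auto
      ultimately have "t = r" using Ints_nonzero_abs_less1[of "t - r"] by auto
      then show "u = v" using cover_inj_fibre[of a b t] uv ab by auto
    qed
    then have "embedding_map ?X M cover"
      using continuous_imp_embedding_map[OF cX compX Hausdorff_M] by blast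
    then have "homeomorphic_map ?X (subtopology M (cover ` topspace ?X)) cover" by (simp add: embedding_map_def)
    then obtain g where g: "homeomorphic_maps ?X (subtopology M (cover ` topspace ?X)) cover g"
      by (auto simp: homeomorphic_map_maps)
    have inX: "(y z, s z) \<in> topspace ?X" if "z \<in> N z0" for z using that y by (auto simp: N_def)
    have "continuous_map (subtopology (top_of_set Z) (N z0)) (subtopology M (cover ` topspace ?X)) F"
      unfolding continuous_map_in_subtopology
    proof (intro conjI)
      show "continuous_map (subtopology (top_of_set Z) (N z0)) M F" by (rule continuous_map_from_subtopology[OF F])
      show "F \<in> topspace (subtopology (top_of_set Z) (N z0)) \<rightarrow> cover ` topspace ?X"
      proof
        fix z assume "z \<in> topspace (subtopology (top_of_set Z) (N z0))"
        then have z: "z \<in> Z" "z \<in> N z0" by (auto simp: N_def)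
        show "F z \<in> cover ` topspace ?X"
          by (rule image_eqI[OF _ inX[OF z(2)]]) (use y[OF z(1)] in simp)
      qed
    qed
    then have "continuous_map (subtopology (top_of_set Z) (N z0)) ?X (g \<circ> F)"
      using g continuous_map_compose unfolding homeomorphic_maps_def by blast
    then have "continuous_map (subtopology (top_of_set Z) (N z0)) T (fst \<circ> (g \<circ> F))"
      by (rule continuous_map_compose) (rule continuous_map_fst)
    then show ?thesis
    proof (rule continuous_map_eq)
      fix z assume z: "z \<in> topspace (subtopology (top_of_set Z) (N z0))"
      then have "z \<in> N z0" "z \<in> Z" by (auto simp: N_def)
      then have "g (F z) = (y z, s z)" using g inX[of z] y[of z] unfolding homeomorphic_maps_def by metis
      then show "(fst \<circ> (g \<circ> F)) z = y z" by simp
    qed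
  qed
  have "continuous_map (top_of_set Z) T y"
  proof (rule pasting_lemma[where I = Z and T = N and f = "\<lambda>_. y"])
    show "\<exists>j. j \<in> Z \<and> z \<in> N j \<and> y z = y z" if "z \<in> topspace (top_of_set Z)" for z
      using that by (intro exI[of _ z]) (auto simp: N_def)
  qed (use N loc in auto)
  then show thesis using that y by metis
qed

lemma norm_angle: "m \<in> topspace M \<Longrightarrow> norm (angle m) = 1"
  using angle(2) by (elim q_surj) auto

text \<open>A convex set is contractible, so the nonvanishing function
  \<open>angle \<circ> F\<close> has a continuous logarithm, purely imaginary since the norm is 1.
  At \<open>z0\<close> the resulting height is an integer, which is subtracted.\<close>

lemma angle_log:
  fixes Z :: "'z::real_normed_vector set"
  assumes Z: "convex Z" and F: "continuous_map (top_of_set Z) M F" and z0: "z0 \<in> Z" "F z0 = m0"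
  obtains s where "continuous_on Z s" "\<And>z. z \<in> Z \<Longrightarrow> angle (F z) = cis (2 * pi * s z)" "s z0 = 0"
proof -
  have Fz: "F z \<in> topspace M" if "z \<in> Z" for z using F that by (auto simp: continuous_map_def)
  have "continuous_on Z (angle \<circ> F)" using continuous_map_compose[OF F angle(1)] by simp
  moreover have "(angle \<circ> F) z \<noteq> 0" if "z \<in> Z" for z using norm_angle[OF Fz[OF that]] by auto
  ultimately obtain g where g: "continuous_on Z g" "\<And>z. z \<in> Z \<Longrightarrow> (angle \<circ> F) z = exp (g z)"
    using continuous_logarithm_on_contractible[OF _ convex_imp_contractible[OF Z]] by metis
  define s where "s z = Im (g z) / (2 * pi)" for z
  have sc: "continuous_on Z s" unfolding s_def by (intro continuous_intros g) auto
  have e: "angle (F z) = cis (2 * pi * s z)" if z: "z \<in> Z" for z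
  proof -
    have "norm (exp (g z)) = 1" using norm_angle[OF Fz[OF z]] g(2)[OF z] by simp
    then have "Re (g z) = 0" by simp
    then show ?thesis using g(2)[OF z] by (simp add: s_def exp_eq_polar)
  qed
  have "cis (2 * pi * s z0) = cis (2 * pi * 0)" using e[OF z0(1)] angle(2)[OF x(1), of 0] z0(2) by simp
  then have "s z0 \<in> \<int>" by (simp only: cis_2pi_eq_iff) simp
  then have "cis (2 * pi * (s z - s z0)) = cis (2 * pi * s z)" for z by (simp only: cis_2pi_eq_iff) simp
  then show thesis
    by (intro that[of "\<lambda>z. s z - s z0"]) (simp_all add: e continuous_on_diff[OF sc continuous_on_const])
qed

subsection \<open>The fundamental group of a mapping torus\<close>

abbreviation "fib \<equiv> (\<lambda>y. q (y, 0))"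
abbreviation "PT \<equiv> fundamental_group T x"
abbreviation "PM \<equiv> fundamental_group M m0"
abbreviation "incl \<equiv> fundamental_induced M m0 fib"

lemma fib_cont: "continuous_map T M fib"
proof -
  have "continuous_map T (prod_topology T (top_of_set {0..1::real})) (\<lambda>y. (y, 0))"
    by (intro continuous_map_pairedI) auto
  then show ?thesis using continuous_map_compose[OF _ qcont] by (fastforce simp: o_def)
qed

lemma fib_inj: "y \<in> topspace T \<Longrightarrow> y' \<in> topspace T \<Longrightarrow> fib y = fib y' \<Longrightarrow> y = y'"
  using q_eq[of y y' 0 0] by auto

lemma incl_hom: "incl \<in> hom PT PM"
  by (rule fundamental_induced_hom[OF fib_cont])

text \<open>A homotopy in \<open>M\<close> between two loops of the fibre lifts to the cyclic cover.
  Its height vanishes on the whole boundary of the square, so its fibre coordinate is a homotopy in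
  \<open>T\<close> between the original loops.\<close>

lemma incl_inj: "inj_on incl (carrier PT)"
proof (rule inj_onI)
  fix a b assume ab: "a \<in> carrier PT" "b \<in> carrier PT" "incl a = incl b"
  then obtain p p' where p: "p \<in> loops T x" "a = loop_class T x p" and p': "p' \<in> loops T x" "b = loop_class T x p'"
    by (auto simp: fundamental_group_carrier)
  have "path_homotopic M (fib \<circ> p) (fib \<circ> p')"
    using ab(3) fundamental_induced_class[OF fib_cont p(1)] fundamental_induced_class[OF fib_cont p'(1)] p p'
      map_loops[OF fib_cont p(1)] map_loops[OF fib_cont p'(1)] by (simp add: loop_class_eq_iff)
  then obtain F :: "real \<times> real \<Rightarrow> 'b" where F: "continuous_map (top_of_set ({0..1} \<times> {0..1})) M F"
    and e: "\<And>t. F (0, t) = (fib \<circ> p) t" "\<And>t. F (1, t) = (fib \<circ> p') t"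
      "\<And>u. u \<in> {0..1} \<Longrightarrow> F (u, 0) = (fib \<circ> p) 0" "\<And>u. u \<in> {0..1} \<Longrightarrow> F (u, 1) = (fib \<circ> p) 1"
    by (rule path_homotopic_square_ex) blast
  have pp: "pathin T p" "p 0 = x" "p 1 = x" "pathin T p'" "p' 0 = x" "p' 1 = x" using p p' by (auto simp: loops_def)
  obtain s where s: "continuous_on ({0..1} \<times> {0..1}) s" "\<And>z. z \<in> {0..1} \<times> {0..1} \<Longrightarrow> angle (F z) = cis (2 * pi * s z)" "s (0, 0) = 0"
    using angle_log[OF convex_Times[OF convex_closed_interval convex_closed_interval] F, of "(0, 0)"] e pp by auto
  obtain y where y: "continuous_map (top_of_set ({0..1} \<times> {0..1})) T y" "\<And>z. z \<in> {0..1} \<times> {0..1} \<Longrightarrow> F z = cover (y z, s z)"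
    using cover_lift[OF F s(1,2)] by blast
  \<comment> \<open>Along a path mapped into the fibre over 0 the height is integer-valued and
    continuous, hence constant.\<close>
  have edge: "s (g t) = s (g 0)" if g: "continuous_on {0..1} g" "g \<in> {0..1} \<rightarrow> {0..1} \<times> {0..1}"
    and w: "\<And>t. t \<in> {0..1} \<Longrightarrow> \<exists>w\<in>topspace T. F (g t) = fib w" and t: "t \<in> {0..1}" for g :: "real \<Rightarrow> real \<times> real" and t
  proof (rule int_valued_constant[of "{0..1}" "\<lambda>t. s (g t)"])
    show "continuous_on {0..1} (\<lambda>t. s (g t))"
      using continuous_on_compose2[OF s(1) g(1)] g(2) by auto
    fix t :: real assume t: "t \<in> {0..1}"
    obtain w where w': "w \<in> topspace T" "F (g t) = fib w" using w[OF t] by blast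
    have "cis (2 * pi * s (g t)) = cis (2 * pi * 0)"
      using s(2)[OF funcset_mem[OF g(2) t]] w' angle(2)[OF w'(1), of 0] by simp
    then show "s (g t) \<in> \<int>" by (simp only: cis_2pi_eq_iff) simp
  qed (use t in auto)
  have pT: "p t \<in> topspace T" "p' t \<in> topspace T" if "t \<in> {0..1}" for t
    using pathin_in[OF pp(1)] pathin_in[OF pp(4)] that by auto
  have vert: "continuous_on {0..1} (\<lambda>t::real. (c, t))" and horiz: "continuous_on {0..1} (\<lambda>u::real. (u, c))" for c :: real
    by (auto intro!: continuous_intros)
  have s0: "s (0, t) = 0" if t: "t \<in> {0..1}" for t
  proof -
    have "s (0, t) = s (0, 0)"
      by (rule edge[OF vert[of 0] _ _ t]) (use e(1) pT(1) in auto)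
    then show ?thesis using s(3) by simp
  qed
  have sb: "s (u, 0) = 0" "s (u, 1) = 0" if u: "u \<in> {0..1}" for u
  proof -
    have "s (u, 0) = s (0, 0)"
      by (rule edge[OF horiz[of 0] _ _ u]) (use e(3) pp x(1) in auto)
    then show "s (u, 0) = 0" using s(3) by simp
    have "s (u, 1) = s (0, 1)"
      by (rule edge[OF horiz[of 1] _ _ u]) (use e(4) pp x(1) in auto)
    then show "s (u, 1) = 0" using s0[of 1] by simp
  qed
  have s1: "s (1, t) = 0" if t: "t \<in> {0..1}" for t
  proof -
    have "s (1, t) = s (1, 0)"
      by (rule edge[OF vert[of 1] _ _ t]) (use e(2) pT(2) in auto)
    then show ?thesis using sb(1)[of 1] by simp
  qed
  have yin: "y z \<in> topspace T" if "z \<in> {0..1} \<times> {0..1}" for z using y(1) that by (auto simp: continuous_map_def)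
  have "path_homotopic T p p'"
  proof (rule path_homotopic_square[OF y(1)])
    have fy: "y z = w" if "z \<in> {0..1} \<times> {0..1}" "s z = 0" "F z = fib w" "w \<in> topspace T" for z w
      using fib_inj[OF yin[OF that(1)] that(4)] y(2)[OF that(1)] that cover_0 by simp
    show "y (0, t) = p t" "y (1, t) = p' t" if "t \<in> {0..1}" for t
      using that s0 s1 e(1,2) pathin_in[OF pp(1)] pathin_in[OF pp(4)] by (auto intro!: fy)
    show "y (u, 0) = p 0" "y (u, 1) = p 1" if "u \<in> {0..1}" for u
      using that sb e(3,4) pp x(1) by (auto intro!: fy)
  qed
  then show "a = b" using p p' by (simp add: loop_class_eq_iff)
qed

text \<open>The total change of height along a path; as \<open>angle\<close> has norm 1, passing to
  the real part loses nothing.\<close>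

definition wind :: "(real \<Rightarrow> 'b) \<Rightarrow> real" where
  "wind p = Re (winding_number (angle \<circ> p) 0)"

lemma angle_path: "pathin M p \<Longrightarrow> path (angle \<circ> p) \<and> 0 \<notin> path_image (angle \<circ> p)"
proof -
  assume p: "pathin M p"
  have "path (angle \<circ> p)" using continuous_map_compose[OF p[unfolded pathin_def] angle(1)] by (simp add: path_def)
  moreover have "(angle \<circ> p) t \<noteq> 0" if "t \<in> {0..1}" for t using norm_angle[OF pathin_in[OF p, of t]] that by auto
  ultimately show ?thesis by (force simp: path_image_def)
qed

lemma wind_homotopic: assumes "path_homotopic M p p'" shows "wind p = wind p'"
proof -
  have "angle \<in> topspace M \<rightarrow> - {0}" using norm_angle by fastforce
  then have "continuous_map M (top_of_set (- {0})) angle" using angle(1) by (simp add: continuous_map_in_subtopology)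
  then have "path_homotopic (top_of_set (- {0})) (angle \<circ> p) (angle \<circ> p')" using assms by (rule path_homotopic_map)
  then have "homotopic_paths (- {0}) (angle \<circ> p) (angle \<circ> p')"
    by (simp add: homotopic_paths_def path_homotopic_def pathstart_def pathfinish_def)
  then show ?thesis unfolding wind_def using winding_number_homotopic_paths by metis
qed

lemma wind_concat: assumes "pathin M p" "pathin M p'" "p 1 = p' 0" shows "wind (loop_concat p p') = wind p + wind p'"
proof -
  have "angle \<circ> loop_concat p p' = (angle \<circ> p) +++ (angle \<circ> p')"
    by (auto simp: loop_concat_def joinpaths_def)
  then show ?thesis
    using winding_number_join[of "angle \<circ> p" 0 "angle \<circ> p'"] angle_path assms by (simp add: wind_def pathstart_def pathfinish_def)
qed

lemma wind_cis:
  assumes s: "continuous_on {0..1} s" "\<And>t. t \<in> {0..1} \<Longrightarrow> angle (p t) = cis (2 * pi * s t)"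
  shows "wind p = s 1 - s 0"
proof -
  let ?g = "\<lambda>t. \<i> * complex_of_real (2 * pi * s t)"
  have g: "path ?g" unfolding path_def by (intro continuous_intros s)
  have "winding_number (angle \<circ> p) 0 = winding_number (exp \<circ> ?g) 0"
    by (rule winding_number_cong) (use s(2) in \<open>auto simp: cis_conv_exp\<close>)
  also have "\<dots> = (pathfinish ?g - pathstart ?g) / (2 * of_real pi * \<i>)" by (rule winding_number_compose_exp[OF g])
  also have "\<dots> = of_real (s 1 - s 0)" by (simp add: pathfinish_def pathstart_def field_simps)
  finally show ?thesis by (simp add: wind_def)
qed

definition winding :: "(real \<Rightarrow> 'b) set \<Rightarrow> real" where
  "winding a = wind (SOME p. p \<in> loops M m0 \<and> a = loop_class M m0 p)"

lemma winding_class: assumes "p \<in> loops M m0" shows "winding (loop_class M m0 p) = wind p"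
proof -
  let ?q = "SOME q. q \<in> loops M m0 \<and> loop_class M m0 p = loop_class M m0 q"
  have "?q \<in> loops M m0 \<and> loop_class M m0 p = loop_class M m0 ?q"
    using someI[of "\<lambda>q. q \<in> loops M m0 \<and> loop_class M m0 p = loop_class M m0 q" p] assms by blast
  then have "path_homotopic M p ?q" using loop_class_eq_iff[OF assms] by blast
  then show ?thesis unfolding winding_def by (rule wind_homotopic[symmetric])
qed

lemma winding_mult: assumes "a \<in> carrier PM" "b \<in> carrier PM" shows "winding (a \<otimes>\<^bsub>PM\<^esub> b) = winding a + winding b"
proof -
  obtain p p' where p: "p \<in> loops M m0" "a = loop_class M m0 p" and p': "p' \<in> loops M m0" "b = loop_class M m0 p'"
    using assms by (auto simp: fundamental_group_carrier)
  have "wind (loop_concat p p') = wind p + wind p'" using p p' by (intro wind_concat) (auto simp: loops_def)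
  then show ?thesis using p p' winding_class by (simp add: fundamental_group_mult loops_concat)
qed

lemma loop_lift:
  assumes p: "p \<in> loops M m0"
  obtains s y where "continuous_on {0..1} s" "s 0 = 0" "s 1 = wind p" "s 1 \<in> \<int>" "pathin T y" "y 0 = x"
    "\<And>t. t \<in> {0..1} \<Longrightarrow> p t = cover (y t, s t)"
proof -
  have pp: "continuous_map (top_of_set {0..1}) M p" "p 0 = m0" "p 1 = m0" using p by (auto simp: loops_def pathin_def)
  obtain s where s: "continuous_on {0..1} s" "\<And>t. t \<in> {0..1} \<Longrightarrow> angle (p t) = cis (2 * pi * s t)" "s 0 = 0"
    using angle_log[OF convex_closed_interval pp(1), of 0] pp(2) by auto
  obtain y where y: "continuous_map (top_of_set {0..1}) T y" "\<And>t. t \<in> {0..1} \<Longrightarrow> p t = cover (y t, s t)"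
    using cover_lift[OF pp(1) s(1,2)] by blast
  have yin: "y 0 \<in> topspace T" using y(1) by (auto simp: continuous_map_def)
  have "fib (y 0) = fib x" using y(2)[of 0] s(3) pp(2) cover_0 by simp
  then have y0: "y 0 = x" using fib_inj[OF yin x(1)] by blast
  have "cis (2 * pi * s 1) = cis (2 * pi * 0)" using s(2)[of 1] pp(3) angle(2)[OF x(1), of 0] by simp
  then have "s 1 \<in> \<int>" by (simp only: cis_2pi_eq_iff) simp
  moreover have "s 1 = wind p" using wind_cis[OF s(1,2)] s(3) by simp
  ultimately show thesis using y y0 s(1,3) by (intro that[of s y]) (simp_all add: pathin_def)
qed

lemma winding_int: "a \<in> carrier PM \<Longrightarrow> winding a \<in> \<int>"
  using winding_class by (auto simp: fundamental_group_carrier) (metis loop_lift)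

text \<open>A loop of winding 0 lifts to a path in the cover whose height starts and ends at 0;
  pushing that height to 0 moves the loop into the fibre.\<close>

theorem winding_kernel: "incl ` carrier PT = {a \<in> carrier PM. winding a = 0}"
proof (intro equalityI subsetI)
  fix a assume "a \<in> incl ` carrier PT"
  then obtain p where p: "p \<in> loops T x" "a = incl (loop_class T x p)" by (auto simp: fundamental_group_carrier)
  have fp: "fib \<circ> p \<in> loops M m0" by (rule map_loops[OF fib_cont p(1)])
  have a: "a = loop_class M m0 (fib \<circ> p)" using fundamental_induced_class[OF fib_cont p(1)] p(2) by simp
  have "wind (fib \<circ> p) = (\<lambda>_. 0) (1::real) - (\<lambda>_. 0) (0::real)"
    by (rule wind_cis) (use angle(2)[of _ 0] p pathin_in in \<open>auto simp: loops_def\<close>)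
  then show "a \<in> {a \<in> carrier PM. winding a = 0}" using a fp winding_class by (auto simp: fundamental_group_carrier)
next
  fix a assume a: "a \<in> {a \<in> carrier PM. winding a = 0}"
  then obtain p where p: "p \<in> loops M m0" "a = loop_class M m0 p" by (auto simp: fundamental_group_carrier)
  obtain s y where sy: "continuous_on {0..1} s" "s 0 = 0" "s 1 = wind p" "pathin T y" "y 0 = x"
    "\<And>t. t \<in> {0..1} \<Longrightarrow> p t = cover (y t, s t)" using loop_lift[OF p(1)] by metis
  have s1: "s 1 = 0" using a p sy(3) winding_class by simp
  have yin: "y t \<in> topspace T" if "t \<in> {0..1}" for t using pathin_in[OF sy(4)] that by auto
  have "fib (y 1) = fib x" using sy(6)[of 1] s1 p(1) cover_0 by (simp add: loops_def)
  then have y1: "y 1 = x" using fib_inj yin[of 1] x(1) by auto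
  have yl: "y \<in> loops T x" using sy y1 by (simp add: loops_def)
  \<comment> \<open>The height is scaled down linearly; the ends stay fixed since \<open>s\<close>
    is 0 at both of them.\<close>
  let ?H = "cover \<circ> (\<lambda>z. (y (snd z), (1 - fst z) * s (snd z)))"
  have "continuous_map (top_of_set ({0..1} \<times> {0..1})) M ?H"
  proof (rule continuous_map_compose[OF _ cover_cont], rule continuous_map_pairedI)
    have "continuous_map (top_of_set ({0..1::real} \<times> {0..1::real})) (top_of_set {0..1::real}) snd" by (auto intro!: continuous_intros)
    from continuous_map_compose[OF this sy(4)[unfolded pathin_def]]
    show "continuous_map (top_of_set ({0..1} \<times> {0..1})) T (\<lambda>z::real\<times>real. y (snd z))" by (simp add: o_def)
    have "continuous_on ({0..1} \<times> {0..1}) (\<lambda>z::real\<times>real. s (snd z))"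
      by (rule continuous_on_compose2[OF sy(1)]) (auto intro!: continuous_intros)
    then show "continuous_map (top_of_set ({0..1} \<times> {0..1})) euclideanreal (\<lambda>z::real\<times>real. (1 - fst z) * s (snd z))"
      by (auto intro!: continuous_intros)
  qed
  then have "path_homotopic M p (fib \<circ> y)"
    by (rule path_homotopic_square) (use sy y1 s1 p(1) cover_0 in \<open>auto simp: loops_def\<close>)
  then have "a = incl (loop_class T x y)"
    using fundamental_induced_class[OF fib_cont yl] p map_loops[OF fib_cont yl] by (simp add: loop_class_eq_iff)
  then show "a \<in> incl ` carrier PT" using yl by (auto simp: fundamental_group_carrier)
qed

definition stable_letter :: "(real \<Rightarrow> 'b) set" where
  "stable_letter = loop_class M m0 (\<lambda>t. q (x, t))"

lemma suspension_loop: "(\<lambda>t. q (x, t)) \<in> loops M m0"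
proof -
  have "continuous_map (top_of_set {0..1::real}) (prod_topology T (top_of_set {0..1::real})) (\<lambda>t. (x, t))"
    by (intro continuous_map_pairedI) (use x in auto)
  then have "pathin M (\<lambda>t. q (x, t))" using continuous_map_compose[OF _ qcont] by (fastforce simp: o_def pathin_def)
  then show ?thesis using q_glue[OF x(1)] x(2) by (simp add: loops_def)
qed

lemma stable_letter: "stable_letter \<in> carrier PM" "winding stable_letter = 1"
proof -
  show "stable_letter \<in> carrier PM" using suspension_loop by (auto simp: stable_letter_def fundamental_group_carrier)
  have "wind (\<lambda>t. q (x, t)) = (\<lambda>t. t) 1 - (\<lambda>t. t) (0::real)"
    by (rule wind_cis) (use angle(2)[OF x(1)] in auto)
  then show "winding stable_letter = 1" using winding_class[OF suspension_loop] by (simp add: stable_letter_def)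
qed

text \<open>Moving the loop \<open>p\<close> once around the bundle gives a map of the square. Two
  opposite edges are the suspension of \<open>x\<close>; the others are \<open>p\<close> in the
  fibre over 0 and \<open>p\<close> in the fibre over 1, which is \<open>h \<circ> p\<close> in the
  fibre over 0.\<close>

theorem stable_letter_conj:
  assumes a: "a \<in> carrier PT"
  shows "stable_letter \<otimes>\<^bsub>PM\<^esub> incl (fundamental_induced T x h a) = incl a \<otimes>\<^bsub>PM\<^esub> stable_letter"
proof -
  obtain p where p: "p \<in> loops T x" "a = loop_class T x p" using a by (auto simp: fundamental_group_carrier)
  have pp: "pathin T p" "p 0 = x" "p 1 = x" using p by (auto simp: loops_def)
  have hp: "h \<circ> p \<in> loops T x" using map_loops[OF h(1) p(1)] x(2) by simp
  let ?H = "q \<circ> (\<lambda>z. (p (snd z), fst z))"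
  have "continuous_map (top_of_set ({0..1} \<times> {0..1})) M ?H"
  proof (rule continuous_map_compose[OF _ qcont], rule continuous_map_pairedI)
    have "continuous_map (top_of_set ({0..1::real} \<times> {0..1::real})) (top_of_set {0..1::real}) snd" by (auto intro!: continuous_intros)
    from continuous_map_compose[OF this pp(1)[unfolded pathin_def]]
    show "continuous_map (top_of_set ({0..1} \<times> {0..1})) T (\<lambda>z::real\<times>real. p (snd z))" by (simp add: o_def)
    show "continuous_map (top_of_set ({0..1} \<times> {0..1})) (top_of_set {0..1}) (\<lambda>z::real\<times>real. fst z)" by (auto intro!: continuous_intros)
  qed
  from path_homotopic_square_edges[OF this]
  have sq: "path_homotopic M (loop_concat (\<lambda>t. q (x, t)) (\<lambda>t. q (p t, 1))) (loop_concat (fib \<circ> p) (\<lambda>t. q (x, t)))"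
    using pp by (simp add: o_def)
  have ip: "fib \<circ> p \<in> loops M m0" "fib \<circ> (h \<circ> p) \<in> loops M m0" by (rule map_loops[OF fib_cont p(1)] map_loops[OF fib_cont hp])+
  have "path_homotopic M (fib \<circ> (h \<circ> p)) (\<lambda>t. q (p t, 1))"
    by (rule path_homotopic_eq) (use ip(2) q_glue pathin_in[OF pp(1)] in \<open>auto simp: loops_def\<close>)
  then have "path_homotopic M (loop_concat (\<lambda>t. q (x, t)) (fib \<circ> (h \<circ> p))) (loop_concat (\<lambda>t. q (x, t)) (\<lambda>t. q (p t, 1)))"
    using suspension_loop ip(2) by (intro path_homotopic_concat[OF path_homotopic_refl]) (auto simp: loops_def)
  from path_homotopic_trans[OF this sq]
  have "loop_class M m0 (loop_concat (\<lambda>t. q (x, t)) (fib \<circ> (h \<circ> p))) = loop_class M m0 (loop_concat (fib \<circ> p) (\<lambda>t. q (x, t)))"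
    using suspension_loop ip by (subst loop_class_eq_iff) (auto intro: loops_concat)
  moreover have "incl a = loop_class M m0 (fib \<circ> p)" using fundamental_induced_class[OF fib_cont p(1)] p by simp
  moreover have "fundamental_induced T x h a = loop_class T x (h \<circ> p)"
    using fundamental_induced_class[OF h(1) p(1)] p x(2) by simp
  moreover have "incl (loop_class T x (h \<circ> p)) = loop_class M m0 (fib \<circ> (h \<circ> p))" by (rule fundamental_induced_class[OF fib_cont hp])
  ultimately show ?thesis
    using suspension_loop ip by (simp add: stable_letter_def fundamental_group_mult)
qed

end

section \<open>Characters of the fundamental group as functionals on homology\<close>

definition frag_sum :: "('a \<Rightarrow> real) \<Rightarrow> ('a \<Rightarrow>\<^sub>0 int) \<Rightarrow> real" where
  "frag_sum w c = (\<Sum>f\<in>Poly_Mapping.keys c. of_int (Poly_Mapping.lookup c f) * w f)"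

lemma frag_sum_superset:
  assumes "finite A" "Poly_Mapping.keys c \<subseteq> A"
  shows "frag_sum w c = (\<Sum>f\<in>A. of_int (Poly_Mapping.lookup c f) * w f)"
  unfolding frag_sum_def by (rule sum.mono_neutral_left) (use assms in \<open>auto simp: in_keys_iff\<close>)

lemma frag_sum_0 [simp]: "frag_sum w 0 = 0" by (simp add: frag_sum_def)

lemma frag_sum_of [simp]: "frag_sum w (frag_of f) = w f"
  by (simp add: frag_sum_def)

lemma frag_sum_diff: "frag_sum w (a - b) = frag_sum w a - frag_sum w b"
proof -
  let ?A = "Poly_Mapping.keys a \<union> Poly_Mapping.keys b"
  have "Poly_Mapping.keys (a - b) \<subseteq> ?A" by (rule keys_diff)
  then show ?thesis
    using frag_sum_superset[of ?A "a - b" w] frag_sum_superset[of ?A a w] frag_sum_superset[of ?A b w]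
    by (simp add: lookup_minus sum_subtractf[symmetric] algebra_simps)
qed

lemma frag_sum_minus: "frag_sum w (- a) = - frag_sum w a"
  using frag_sum_diff[of w 0 a] by simp

lemma frag_sum_add: "frag_sum w (a + b) = frag_sum w a + frag_sum w b"
  using frag_sum_diff[of w a "- b"] by (simp add: frag_sum_minus)

lemma frag_sum_cong:
  "Poly_Mapping.keys c \<subseteq> S \<Longrightarrow> (\<And>f. f \<in> S \<Longrightarrow> w f = w' f) \<Longrightarrow> frag_sum w c = frag_sum w' c"
  unfolding frag_sum_def by (intro sum.cong) auto

lemma frag_sum_linear: "frag_sum (\<lambda>f. s * w f + t * w' f) c = s * frag_sum w c + t * frag_sum w' c"
  by (simp add: frag_sum_def sum_distrib_left sum.distrib[symmetric] algebra_simps)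

lemma frag_sum_boundary:
  "Poly_Mapping.keys c \<subseteq> S \<Longrightarrow> frag_sum w (chain_boundary p c) = frag_sum (\<lambda>f. frag_sum w (chain_boundary p (frag_of f))) c"
  by (induction c rule: frag_induction) (auto simp: chain_boundary_diff frag_sum_diff)

lemma frag_sum_chain_map:
  "Poly_Mapping.keys c \<subseteq> S \<Longrightarrow> frag_sum w (chain_map p g c) = frag_sum (\<lambda>f. w (simplex_map p g f)) c"
  by (induction c rule: frag_induction) (auto simp: chain_map_diff frag_sum_diff)

definition edge_point :: "real \<Rightarrow> nat \<Rightarrow> real" where
  "edge_point t = (\<lambda>i. if i = 0 then 1 - t else if i = 1 then t else 0)"

text \<open>Sends the corners (0,0), (1,0), (1,1) of \<open>triangle\<close> to the vertices 0, 1, 2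
  of the standard simplex, so that the face opposite vertex 1 is the diagonal.\<close>

definition tri_point :: "real \<times> real \<Rightarrow> nat \<Rightarrow> real" where
  "tri_point = (\<lambda>(u, v) i. if i = 0 then 1 - u else if i = 1 then u - v else if i = 2 then v else 0)"

definition edge_path :: "((nat \<Rightarrow> real) \<Rightarrow> 'a) \<Rightarrow> real \<Rightarrow> 'a" where
  "edge_path f = (\<lambda>t. f (edge_point t))"

lemma edge_point_simplex: "0 \<le> t \<Longrightarrow> t \<le> 1 \<Longrightarrow> edge_point t \<in> standard_simplex (Suc 0)"
  by (auto simp: standard_simplex_def edge_point_def)

lemma edge_point_cont: "continuous_map (top_of_set {0..1}) (subtopology (powertop_real UNIV) (standard_simplex (Suc 0))) edge_point"
proof -
  have "continuous_map (top_of_set {0..1}) euclideanreal (\<lambda>t. edge_point t i)" for i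
    by (cases "i = 0"; cases "i = 1") (auto simp: edge_point_def intro!: continuous_intros)
  then show ?thesis
    using edge_point_simplex by (auto simp: continuous_map_in_subtopology continuous_map_componentwise_UNIV)
qed

definition triangle :: "(real \<times> real) set" where "triangle = {(u, v). 0 \<le> v \<and> v \<le> u \<and> u \<le> 1}"

lemma tri_point_cont: "continuous_map (top_of_set triangle) (subtopology (powertop_real UNIV) (standard_simplex 2)) tri_point"
proof -
  have "tri_point p \<in> standard_simplex 2" if "p \<in> triangle" for p
    using that by (auto simp: standard_simplex_def tri_point_def triangle_def eval_nat_numeral)
  moreover have "continuous_map (top_of_set triangle) euclideanreal (\<lambda>p. tri_point p i)" for i
    by (cases "i = 0"; cases "i = 1"; cases "i = 2")
       (auto simp: tri_point_def case_prod_beta intro!: continuous_intros)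
  ultimately show ?thesis by (auto simp: continuous_map_in_subtopology continuous_map_componentwise_UNIV)
qed

lemma convex_triangle: "convex triangle"
proof -
  have "triangle = {p. 0 \<le> snd p} \<inter> {p. snd p - fst p \<le> 0} \<inter> {p. fst p \<le> 1}"
    by (auto simp: triangle_def)
  moreover have "convex {p :: real\<times>real. 0 \<le> snd p}" "convex {p :: real\<times>real. snd p - fst p \<le> 0}" "convex {p :: real\<times>real. fst p \<le> 1}"
  proof -
    have "convex {p. inner (0::real, 1::real) p \<ge> 0}" "convex {p. inner (-1::real, 1::real) p \<le> 0}"
      "convex {p. inner (1::real, 0::real) p \<le> 1}"
      by (rule convex_halfspace_ge convex_halfspace_le)+
    then show "convex {p :: real\<times>real. 0 \<le> snd p}" "convex {p :: real\<times>real. snd p - fst p \<le> 0}" "convex {p :: real\<times>real. fst p \<le> 1}"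
      by (simp_all add: inner_prod_def)
  qed
  ultimately show ?thesis by (metis convex_Int)
qed

lemma edge_path_pathin: "singular_simplex (Suc 0) X f \<Longrightarrow> pathin X (edge_path f)"
  unfolding pathin_def edge_path_def singular_simplex_def
  using continuous_map_compose[OF edge_point_cont] by (auto simp: o_def)

lemma edge_path_faces:
  assumes "0 \<le> t" "t \<le> 1"
  shows "edge_path (singular_face 2 0 f) t = f (tri_point (1, t))"
    "edge_path (singular_face 2 1 f) t = f (tri_point (t, t))"
    "edge_path (singular_face 2 2 f) t = f (tri_point (t, 0))"
proof -
  have "simplical_face 0 (edge_point t) = tri_point (1, t)" "simplical_face 1 (edge_point t) = tri_point (t, t)"
    "simplical_face 2 (edge_point t) = tri_point (t, 0)"
    by (auto simp: simplical_face_def edge_point_def tri_point_def fun_eq_iff)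
  then show "edge_path (singular_face 2 0 f) t = f (tri_point (1, t))"
    "edge_path (singular_face 2 1 f) t = f (tri_point (t, t))"
    "edge_path (singular_face 2 2 f) t = f (tri_point (t, 0))"
    using edge_point_simplex[OF assms] by (simp_all add: edge_path_def singular_face_def)
qed

lemma simplex_map_edge_path:
  assumes "0 \<le> t" "t \<le> 1"
  shows "edge_path (simplex_map (Suc 0) h f) t = (h \<circ> edge_path f) t"
  using edge_point_simplex[OF assms] by (simp add: edge_path_def simplex_map_def)

section \<open>Characters as cocycles on singular 1-simplices\<close>

context spanning_paths
begin

definition character :: "((real \<Rightarrow> 'a) set \<Rightarrow> real) \<Rightarrow> bool" where
  "character ch \<longleftrightarrow> (\<forall>a\<in>carrier PI. \<forall>b\<in>carrier PI. ch (a \<otimes>\<^bsub>PI\<^esub> b) = ch a + ch b)"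

definition weight :: "((real \<Rightarrow> 'a) set \<Rightarrow> real) \<Rightarrow> ((nat \<Rightarrow> real) \<Rightarrow> 'a) \<Rightarrow> real" where
  "weight ch f = ch (lp (edge_path f))"

lemma character_mult: "character ch \<Longrightarrow> a \<in> carrier PI \<Longrightarrow> b \<in> carrier PI \<Longrightarrow> ch (a \<otimes>\<^bsub>PI\<^esub> b) = ch a + ch b"
  by (simp add: character_def)

lemma character_one: assumes "character ch" shows "ch \<one>\<^bsub>PI\<^esub> = 0"
  using character_mult[OF assms PI.one_closed PI.one_closed] by simp

lemma character_inv: assumes "character ch" "a \<in> carrier PI" shows "ch (inv\<^bsub>PI\<^esub> a) = - ch a"
  using character_mult[OF assms(1), of a "inv\<^bsub>PI\<^esub> a"] character_one[OF assms(1)] assms by simp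

text \<open>A singular triangle fills its boundary: the face opposite vertex 1 is homotopic to the
  face opposite 2 followed by the face opposite 0. Applying \<open>lp\<close> and the character
  gives the cocycle identity.\<close>

lemma weight_triangle:
  assumes ch: "character ch" and f: "singular_simplex 2 X f"
  shows "frag_sum (weight ch) (chain_boundary 2 (frag_of f)) = 0"
proof -
  let ?F = "f \<circ> tri_point"
  have F: "continuous_map (top_of_set triangle) X ?F"
    using f by (simp add: singular_simplex_def continuous_map_compose[OF tri_point_cont])
  have s: "singular_simplex (Suc 0) X (singular_face 2 k f)" if "k \<le> 2" for k
    using singular_simplex_singular_face[OF f, of k] that by simp
  note p = edge_path_pathin[OF s]
  have ends: "edge_path (singular_face 2 2 f) 1 = edge_path (singular_face 2 0 f) 0"
    by (simp add: edge_path_faces)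
  have "path_homotopic X (loop_concat (edge_path (singular_face 2 2 f)) (edge_path (singular_face 2 0 f))) (?F \<circ> (\<lambda>t. (min (2*t) 1, max 0 (2*t-1))))"
  proof (rule path_homotopic_eq)
    show "pathin X (loop_concat (edge_path (singular_face 2 2 f)) (edge_path (singular_face 2 0 f)))"
      using p[of 2] p[of 0] ends by (intro pathin_concat) auto
    fix t :: real assume t: "0 \<le> t" "t \<le> 1"
    show "(?F \<circ> (\<lambda>t. (min (2*t) 1, max 0 (2*t-1)))) t = loop_concat (edge_path (singular_face 2 2 f)) (edge_path (singular_face 2 0 f)) t"
      using t by (cases "t \<le> 1/2") (auto simp: loop_concat_def edge_path_faces)
  qed
  also have "path_homotopic X \<dots> (?F \<circ> (\<lambda>t. (t, t)))"
    by (rule path_homotopic_simply_connected[OF F convex_imp_simply_connected[OF convex_triangle]])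
       (auto intro!: continuous_intros simp: triangle_def)
  also have "path_homotopic X \<dots> (edge_path (singular_face 2 1 f))"
    by (rule path_homotopic_sym, rule path_homotopic_eq) (use p[of 1] in \<open>auto simp: edge_path_faces[unfolded One_nat_def]\<close>)
  finally have "lp (loop_concat (edge_path (singular_face 2 2 f)) (edge_path (singular_face 2 0 f))) = lp (edge_path (singular_face 2 1 f))"
    by (rule lp_homotopic)
  then have "lp (edge_path (singular_face 2 1 f)) = lp (edge_path (singular_face 2 2 f)) \<otimes>\<^bsub>PI\<^esub> lp (edge_path (singular_face 2 0 f))"
    using p[of 2] p[of 0] ends by (simp add: lp_concat)
  then have "weight ch (singular_face 2 1 f) = weight ch (singular_face 2 2 f) + weight ch (singular_face 2 0 f)"
    using p[of 2] p[of 0] by (simp add: weight_def character_mult[OF ch])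
  then show ?thesis
    by (simp add: chain_boundary_of eval_nat_numeral frag_sum_add frag_sum_minus frag_sum_diff)
qed

lemma weight_relboundary:
  assumes ch: "character ch" and c: "singular_relboundary (Suc 0) X {} c"
  shows "frag_sum (weight ch) c = 0"
proof -
  obtain d where d: "singular_chain 2 X d" "chain_boundary 2 d = c"
    using c by (auto simp: singular_boundary eval_nat_numeral)
  have k: "Poly_Mapping.keys d \<subseteq> singular_simplex_set 2 X" using d by (simp add: singular_chain_def)
  have "frag_sum (weight ch) c = frag_sum (\<lambda>f. frag_sum (weight ch) (chain_boundary 2 (frag_of f))) d"
    using frag_sum_boundary[OF k] d(2) by metis
  also have "\<dots> = frag_sum (\<lambda>_. 0) d"
    by (rule frag_sum_cong[OF k]) (simp add: weight_triangle[OF ch])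
  finally show ?thesis by (simp add: frag_sum_def)
qed

text \<open>The Hurewicz correspondence in dual form: a character extended linearly to 1-chains and
  evaluated on a chosen cycle. The choice is immaterial, since weights vanish on boundaries.\<close>

definition H1_fun :: "((real \<Rightarrow> 'a) set \<Rightarrow> real) \<Rightarrow> 'a chain set \<Rightarrow> real" where
  "H1_fun ch C = frag_sum (weight ch) (SOME c. singular_relcycle 1 X {} c \<and> C = homologous_rel_set 1 X {} c)"

lemma H1_fun_eq:
  assumes "character ch" "singular_relcycle 1 X {} c"
  shows "H1_fun ch (homologous_rel_set 1 X {} c) = frag_sum (weight ch) c"
proof -
  let ?P = "\<lambda>d. singular_relcycle 1 X {} d \<and> homologous_rel_set 1 X {} c = homologous_rel_set 1 X {} d"
  let ?d = "SOME d. ?P d"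
  have "?P ?d" using someI[of ?P c] assms by blast
  then have "homologous_rel 1 X {} c ?d" using homologous_rel_set_eq by blast
  then have "frag_sum (weight ch) (c - ?d) = 0"
    using weight_relboundary[OF assms(1)] by (simp add: homologous_rel_def)
  then show ?thesis by (simp add: H1_fun_def frag_sum_diff)
qed

abbreviation "H1 \<equiv> homology_group 1 X"

lemma H1_carrier: "carrier H1 = homologous_rel_set 1 X {} ` singular_relcycle_set 1 X {}"
  using carrier_relative_homology_group[of 1 X "{}"] by simp

lemma H1_mult:
  assumes "singular_relcycle 1 X {} c" "singular_relcycle 1 X {} d"
  shows "homologous_rel_set 1 X {} c \<otimes>\<^bsub>H1\<^esub> homologous_rel_set 1 X {} d = homologous_rel_set 1 X {} (c + d)"
proof -
  let ?C = "homologous_rel_set 1 X {} c" and ?D = "homologous_rel_set 1 X {} d"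
  have "?C \<in> carrier H1" "?D \<in> carrier H1" using assms by (auto simp: H1_carrier)
  then have "?C \<otimes>\<^bsub>H1\<^esub> ?D \<in> carrier H1"
    by (meson group.is_monoid group_relative_homology_group monoid.m_closed)
  then obtain e where e: "?C \<otimes>\<^bsub>H1\<^esub> ?D = homologous_rel_set 1 X {} e" by (auto simp: H1_carrier)
  have "c \<in> ?C" "d \<in> ?D" by simp_all
  moreover have "?C \<otimes>\<^bsub>H1\<^esub> ?D = (\<Union>r\<in>?C. \<Union>s\<in>?D. {r + s})"
    using mult_relative_homology_group[of 1 X "{}"] by simp
  ultimately have "c + d \<in> ?C \<otimes>\<^bsub>H1\<^esub> ?D" by blast
  then have "homologous_rel 1 X {} e (c + d)" using e by simp
  then show ?thesis using e homologous_rel_set_eq by metis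
qed

lemma H1_fun_mult:
  assumes ch: "character ch" and CD: "C \<in> carrier H1" "D \<in> carrier H1"
  shows "H1_fun ch (C \<otimes>\<^bsub>H1\<^esub> D) = H1_fun ch C + H1_fun ch D"
proof -
  obtain c d where c: "singular_relcycle 1 X {} c" "C = homologous_rel_set 1 X {} c"
    and d: "singular_relcycle 1 X {} d" "D = homologous_rel_set 1 X {} d"
    using CD by (auto simp: H1_carrier)
  show ?thesis
    unfolding c(2) d(2) H1_mult[OF c(1) d(1)]
    using H1_fun_eq[OF ch c(1)] H1_fun_eq[OF ch d(1)] H1_fun_eq[OF ch singular_relcycle_add[OF c(1) d(1)]]
    by (simp add: frag_sum_add)
qed

lemma H1_fun_linear:
  assumes "character ch" "character ch'" "C \<in> carrier H1"
  shows "H1_fun (\<lambda>a. s * ch a + t * ch' a) C = s * H1_fun ch C + t * H1_fun ch' C"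
proof -
  obtain c where c: "singular_relcycle 1 X {} c" "C = homologous_rel_set 1 X {} c"
    using assms by (auto simp: H1_carrier)
  have "character (\<lambda>a. s * ch a + t * ch' a)" using assms(1,2) by (auto simp: character_def algebra_simps)
  then show ?thesis
    using H1_fun_eq[OF _ c(1)] assms c by (simp add: weight_def[abs_def] frag_sum_linear)
qed

text \<open>Each loop is a singular 1-cycle of a single simplex, on which the functional returns the
  value of the character.\<close>

lemma H1_fun_faithful:
  assumes ch: "character ch" and z: "\<And>C. C \<in> carrier H1 \<Longrightarrow> H1_fun ch C = 0" and a: "a \<in> carrier PI"
  shows "ch a = 0"
proof -
  obtain p where p: "p \<in> loops X x" "a = loop_class X x p" using a by (auto simp: fundamental_group_carrier)
  then have pp: "pathin X p" "p 0 = x" "p 1 = x" by (auto simp: loops_def)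
  define f where "f = restrict (\<lambda>y. p (y 1)) (standard_simplex (Suc 0))"
  have "continuous_map (subtopology (powertop_real UNIV) (standard_simplex (Suc 0))) (top_of_set {0..1}) (\<lambda>y. y 1)"
    by (auto simp: continuous_map_in_subtopology standard_simplex_def
      intro!: continuous_map_from_subtopology continuous_map_product_projection)
  then have "continuous_map (subtopology (powertop_real UNIV) (standard_simplex (Suc 0))) X (\<lambda>y. p (y 1))"
    using continuous_map_compose pp(1)[unfolded pathin_def] by (fastforce simp: o_def)
  then have f: "singular_simplex (Suc 0) X f"
    unfolding singular_simplex_def f_def
    by (auto intro: continuous_map_eq)
  have v: "(\<lambda>j. if j = 0 then 1 else 0) \<in> standard_simplex 0" by (simp add: standard_simplex_0)
  have "singular_face (Suc 0) 0 f = singular_face (Suc 0) (Suc 0) f"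
    unfolding singular_face_def diff_self_eq_0 standard_simplex_0
  proof (rule restrict_ext)
    fix y :: "nat \<Rightarrow> real" assume "y \<in> {\<lambda>j. if j = 0 then 1 else 0}"
    then have y: "y = edge_point 0" by (auto simp: edge_point_def)
    have "simplical_face 0 y = edge_point 1" "simplical_face (Suc 0) y = edge_point 0"
      unfolding y by (auto simp: simplical_face_def edge_point_def fun_eq_iff)
    then show "(f \<circ> simplical_face 0) y = (f \<circ> simplical_face (Suc 0)) y"
      using edge_point_simplex[of 0] edge_point_simplex[of 1] pp by (simp add: f_def) (simp add: edge_point_def)
  qed
  then have "chain_boundary 1 (frag_of f) = 0" by (simp add: chain_boundary_of)
  then have rc: "singular_relcycle 1 X {} (frag_of f)" using f by (simp add: singular_cycle singular_chain_of)
  have "weight ch f = 0"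
    using H1_fun_eq[OF ch rc] z[of "homologous_rel_set 1 X {} (frag_of f)"] rc by (auto simp: H1_carrier)
  moreover have "path_homotopic X p (edge_path f)"
    by (rule path_homotopic_eq[OF pp(1)])
       (auto simp: edge_path_def f_def edge_point_simplex, simp add: edge_point_def)
  ultimately show ?thesis using lp_homotopic lp_loop[OF p(1)] p by (simp add: weight_def)
qed

text \<open>The map \<open>h\<close> does not carry the chosen spanning paths to spanning paths, so
  the two weights differ; the difference is a coboundary and vanishes on cycles.\<close>

lemma H1_fun_induced:
  assumes ch: "character ch" and h: "continuous_map X X h" "h x = x" and C: "C \<in> carrier H1"
  shows "H1_fun ch (hom_induced 1 X {} X {} h C) = H1_fun (\<lambda>a. ch (fundamental_induced X x h a)) C"
proof -
  obtain c where c: "singular_relcycle 1 X {} c" "C = homologous_rel_set 1 X {} c"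
    using C by (auto simp: H1_carrier)
  let ?ch = "\<lambda>a. ch (fundamental_induced X x h a)"
  have hh: "fundamental_induced X x h \<in> hom PI PI" using fundamental_induced_hom[OF h(1), of x] h(2) by simp
  then have ch': "character ?ch" using ch by (auto simp: character_def hom_def Pi_iff)
  have k: "Poly_Mapping.keys c \<subseteq> singular_simplex_set (Suc 0) X"
    using c by (simp add: singular_cycle singular_chain_def)
  \<comment> \<open>The 0-cochain whose coboundary is that difference: it measures the failure of
    \<open>h \<circ> k y\<close> to be a spanning path.\<close>
  define \<phi> where "\<phi> y = ch (lp (h \<circ> k y))" for y
  have key: "weight ch (simplex_map (Suc 0) h f) = ?ch (lp (edge_path f)) + (\<phi> (edge_path f 1) - \<phi> (edge_path f 0))"
    if f: "f \<in> singular_simplex_set (Suc 0) X" for f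
  proof -
    let ?r = "edge_path f"
    have r: "pathin X ?r" using f by (simp add: edge_path_pathin)
    have k0: "pathin X (k (?r 0))" "k (?r 0) 1 = ?r 0" "k (?r 0) 0 = x"
      and k1: "pathin X (k (?r 1))" "k (?r 1) 1 = ?r 1" "k (?r 1) 0 = x"
      using k_path pathin_in[OF r, of 0] pathin_in[OF r, of 1] by auto
    have hp: "pathin X (h \<circ> ?r)" "pathin X (h \<circ> k (?r 0))" "pathin X (h \<circ> k (?r 1))"
      using r k0 k1 h pathin_map by blast+
    have cl: "close_up ?r \<in> loops X x" by (rule close_up_loops[OF r])
    have "fundamental_induced X x h (lp ?r) = loop_class X x (h \<circ> close_up ?r)"
      using fundamental_induced_class[OF h(1) cl] h(2) by (simp add: lp_def)
    also have "\<dots> = lp (h \<circ> close_up ?r)"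
      using lp_loop[of "h \<circ> close_up ?r"] map_loops[OF h(1) cl] h(2) by simp
    also have "\<dots> = lp (h \<circ> k (?r 0)) \<otimes>\<^bsub>PI\<^esub> (lp (h \<circ> ?r) \<otimes>\<^bsub>PI\<^esub> inv\<^bsub>PI\<^esub> lp (h \<circ> k (?r 1)))"
      unfolding close_up_def map_loop_concat map_path_reverse
      using hp k0 k1 by (simp add: lp_concat pathin_concat pathin_reverse lp_reverse)
    finally have "?ch (lp ?r) = \<phi> (?r 0) + (ch (lp (h \<circ> ?r)) - \<phi> (?r 1))"
      using hp by (simp add: character_mult[OF ch] character_inv[OF ch] \<phi>_def)
    moreover have "lp (edge_path (simplex_map (Suc 0) h f)) = lp (h \<circ> ?r)"
      by (rule sym, rule lp_homotopic, rule path_homotopic_eq[OF hp(1)]) (rule simplex_map_edge_path)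
    ultimately show ?thesis by (simp add: weight_def)
  qed
  have "frag_sum (\<lambda>f. \<phi> (edge_path f 1) - \<phi> (edge_path f 0)) c =
      frag_sum (\<lambda>f. frag_sum (\<lambda>g. \<phi> (g (edge_point 0))) (chain_boundary 1 (frag_of f))) c"
  proof (rule frag_sum_cong[OF k])
    fix f assume f: "f \<in> singular_simplex_set (Suc 0) X"
    have v: "edge_point 0 \<in> standard_simplex 0" by (auto simp: standard_simplex_0 edge_point_def fun_eq_iff)
    have "simplical_face 0 (edge_point 0) = edge_point 1" "simplical_face (Suc 0) (edge_point 0) = edge_point 0"
      by (auto simp: simplical_face_def edge_point_def fun_eq_iff)
    then show "\<phi> (edge_path f 1) - \<phi> (edge_path f 0) = frag_sum (\<lambda>g. \<phi> (g (edge_point 0))) (chain_boundary 1 (frag_of f))"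
      using v by (simp add: chain_boundary_of frag_sum_add frag_sum_minus frag_sum_diff singular_face_def edge_path_def)
  qed
  also have "\<dots> = frag_sum (\<lambda>g. \<phi> (g (edge_point 0))) (chain_boundary 1 c)"
    by (rule frag_sum_boundary[OF k, symmetric])
  also have "\<dots> = 0" using c by (simp add: singular_cycle)
  finally have 0: "frag_sum (\<lambda>f. \<phi> (edge_path f 1) - \<phi> (edge_path f 0)) c = 0" .
  have "chain_map 1 h c \<in> singular_relcycle_set 1 X {}"
    using c h by (auto intro!: singular_relcycle_chain_map)
  moreover have "hom_induced 1 X {} X {} h C = homologous_rel_set 1 X {} (chain_map 1 h c)"
    using hom_induced_chain_map[of X X h "{}" "{}" 1 c] h c by simp
  ultimately have "H1_fun ch (hom_induced 1 X {} X {} h C) = frag_sum (weight ch) (chain_map 1 h c)"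
    using H1_fun_eq[OF ch] by simp
  also have "\<dots> = frag_sum (\<lambda>f. weight ch (simplex_map (Suc 0) h f)) c"
    using frag_sum_chain_map[OF k, of "weight ch" 1 h] by simp
  also have "\<dots> = frag_sum (\<lambda>f. 1 * weight ?ch f + 1 * (\<phi> (edge_path f 1) - \<phi> (edge_path f 0))) c"
  proof (rule frag_sum_cong[OF k])
    fix f assume "f \<in> singular_simplex_set (Suc 0) X"
    from key[OF this] show "weight ch (simplex_map (Suc 0) h f) =
        1 * weight ?ch f + 1 * (\<phi> (edge_path f 1) - \<phi> (edge_path f 0))"
      by (simp add: weight_def)
  qed
  also have "\<dots> = frag_sum (weight ?ch) c" unfolding frag_sum_linear 0 by simp
  also have "\<dots> = H1_fun ?ch C" using H1_fun_eq[OF ch' c(1)] c by simp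
  finally show ?thesis .
qed

end

lemma additive_int_pow:
  fixes f :: "'g \<Rightarrow> real"
  assumes "group G" and f: "\<And>a b. a \<in> carrier G \<Longrightarrow> b \<in> carrier G \<Longrightarrow> f (a \<otimes>\<^bsub>G\<^esub> b) = f a + f b"
    and a: "a \<in> carrier G"
  shows "f (a [^]\<^bsub>G\<^esub> (n::int)) = of_int n * f a"
proof -
  interpret group G by fact
  have 1: "f \<one>\<^bsub>G\<^esub> = 0" using f[of "\<one>\<^bsub>G\<^esub>" "\<one>\<^bsub>G\<^esub>"] by simp
  have nat: "f (a [^]\<^bsub>G\<^esub> (m::nat)) = of_nat m * f a" for m
    by (induction m) (use a in \<open>auto simp: 1 f algebra_simps\<close>)
  have inv: "f (inv\<^bsub>G\<^esub> b) = - f b" if "b \<in> carrier G" for b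
  proof -
    have "f b + f (inv\<^bsub>G\<^esub> b) = f (b \<otimes>\<^bsub>G\<^esub> inv\<^bsub>G\<^esub> b)"
      by (rule f[OF that inv_closed[OF that], symmetric])
    then show ?thesis using 1 that by simp
  qed
  show ?thesis
  proof (cases n rule: int_cases2)
    case (nonneg k)
    show ?thesis unfolding nonneg int_pow_int using nat[of k] by simp
  next
    case (nonpos k)
    show ?thesis unfolding nonpos int_pow_neg_int[OF a] using nat[of k] inv[of "a [^]\<^bsub>G\<^esub> k"] a by simp
  qed
qed

section \<open>Eigenvalues and left eigenvectors of the homology matrix\<close>

lemma char_poly_columns:
  fixes p q r s z :: complex
  assumes root: "z * z = (p + s) * z - (p * s - q * r)"
  shows "r * q + s * (z - p) = z * (z - p)" "p * (z - s) + q * r = z * (z - s)"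
proof -
  have "z * (z - p) = z * z - z * p" "z * (z - s) = z * z - z * s" by (simp_all add: right_diff_distrib)
  then show "r * q + s * (z - p) = z * (z - p)" "p * (z - s) + q * r = z * (z - s)"
    unfolding root by (simp_all add: algebra_simps)
qed

text \<open>With rows (p, q) and (r, s), both (q, z - p) and (z - s, r) solve the eigenvector
  equations; if both of them vanish, the matrix is scalar and any vector serves.\<close>

lemma eigenvalue_of_root:
  assumes root: "z * z - of_int (A $ 1 $ 1 + A $ 2 $ 2) * z + of_int (A $ 1 $ 1 * A $ 2 $ 2 - A $ 1 $ 2 * A $ 2 $ 1) = 0"
  shows "eigenvalue_of A z"
proof -
  let ?p = "of_int (A $ 1 $ 1) :: complex" and ?q = "of_int (A $ 1 $ 2) :: complex"
    and ?r = "of_int (A $ 2 $ 1) :: complex" and ?s = "of_int (A $ 2 $ 2) :: complex"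
  have root': "z * z = (?p + ?s) * z - (?p * ?s - ?q * ?r)" using root by (simp add: algebra_simps)
  have ev: "eigenvalue_of A z" if v: "?p * a + ?q * b = z * a" "?r * a + ?s * b = z * b" "a \<noteq> 0 \<or> b \<noteq> 0" for a b
  proof -
    let ?v = "(\<chi> i. if i = 1 then a else b) :: complex^2"
    have "?v $ 1 = a" "?v $ 2 = b" by simp_all
    then have "?v \<noteq> 0" using v(3) by (metis zero_index)
    moreover have "(\<chi> i j. of_int (A $ i $ j)) *v ?v = z *s ?v"
      using v(1,2) by (simp add: vec_eq_iff matrix_vector_mult_def forall_2 sum_2)
    ultimately show ?thesis unfolding eigenvalue_of_def by blast
  qed
  consider "?q \<noteq> 0 \<or> z \<noteq> ?p" | "?r \<noteq> 0 \<or> z \<noteq> ?s" | "?q = 0" "?r = 0" "z = ?p" "z = ?s" by blast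
  then show ?thesis
  proof cases
    case 1
    show ?thesis by (rule ev[OF _ char_poly_columns(1)[OF root']]) (use 1 in \<open>auto simp: algebra_simps\<close>)
  next
    case 2
    show ?thesis by (rule ev[OF char_poly_columns(2)[OF root']]) (use 2 in \<open>auto simp: algebra_simps\<close>)
  next
    case 3
    show ?thesis by (rule ev[of 1 0]) (use 3 in auto)
  qed
qed

text \<open>Two positive eigenvalues have a positive product, so the determinant is 1; their sum
  then exceeds 2, which separates them. The left eigenvector for \<open>l\<close> is (r, l - p).
  Left eigenvectors are needed because \<open>h\<close> acts on functionals by composition.\<close>

lemma hyperbolic_left_eigenvectors:
  fixes A :: "int^2^2"
  assumes hyp: "hyperbolic_monodromy A" and unt: "untwisted_monodromy A"
    and d: "\<bar>A $ 1 $ 1 * A $ 2 $ 2 - A $ 1 $ 2 * A $ 2 $ 1\<bar> = 1"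
  obtains l1 l2 u1 u2 w1 w2 :: real where "l1 > 0" "l2 > 0"
    "u1 * A $ 1 $ 1 + w1 * A $ 2 $ 1 = l1 * u1" "u1 * A $ 1 $ 2 + w1 * A $ 2 $ 2 = l1 * w1"
    "u2 * A $ 1 $ 1 + w2 * A $ 2 $ 1 = l2 * u2" "u2 * A $ 1 $ 2 + w2 * A $ 2 $ 2 = l2 * w2"
    "u1 * w2 \<noteq> u2 * w1"
proof -
  define p q r s where "p = real_of_int (A $ 1 $ 1)" "q = real_of_int (A $ 1 $ 2)"
    "r = real_of_int (A $ 2 $ 1)" "s = real_of_int (A $ 2 $ 2)"
  note pqrs = this
  define t where "t = p + s"
  have tr: "\<bar>t\<bar> > 2" using hyp unfolding hyperbolic_monodromy_def trace_def t_def pqrs by (simp add: sum_2)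
  have dabs: "\<bar>p * s - q * r\<bar> = 1"
  proof -
    have "p * s - q * r = of_int (A $ 1 $ 1 * A $ 2 $ 2 - A $ 1 $ 2 * A $ 2 $ 1)" by (simp add: pqrs)
    then show ?thesis using d by (metis of_int_1 of_int_abs)
  qed
  have pos: "Im z = 0 \<and> Re z > 0" if "z * z - complex_of_real t * z + complex_of_real (p * s - q * r) = 0" for z
  proof -
    have "eigenvalue_of A z" by (rule eigenvalue_of_root) (use that in \<open>simp add: t_def pqrs\<close>)
    then have "z \<in> \<real> \<and> Re z > 0" using unt by (simp add: untwisted_monodromy_def)
    then show ?thesis by (simp add: complex_is_Real_iff)
  qed
  define c where "c = csqrt (complex_of_real (t * t - 4 * (p * s - q * r)))"
  have cc: "c * c = complex_of_real (t * t - 4 * (p * s - q * r))"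
    unfolding c_def by (metis power2_csqrt power2_eq_square)
  define z1 z2 where "z1 = (of_real t + c) / 2" "z2 = (of_real t - c) / 2"
  have z12: "z1 + z2 = of_real t" "z1 * z2 = of_real (p * s - q * r)"
    unfolding z1_z2_def using cc by (auto simp: field_simps)
  have r1: "z1 * z1 - of_real t * z1 + of_real (p * s - q * r) = 0" and r2: "z2 * z2 - of_real t * z2 + of_real (p * s - q * r) = 0"
    unfolding z12[symmetric] by (auto simp: algebra_simps)
  note P1 = pos[OF r1] and P2 = pos[OF r2]
  define l1 l2 where "l1 = Re z1" "l2 = Re z2"
  note ll = this
  have e: "z1 = of_real l1" "z2 = of_real l2" using P1 P2 by (auto simp: ll complex_eq_iff)
  have l: "l1 > 0" "l2 > 0" using P1 P2 by (auto simp: ll)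
  have sum: "l1 + l2 = t" and prod: "l1 * l2 = p * s - q * r"
    using z12 unfolding e by (metis of_real_add of_real_eq_iff, metis of_real_mult of_real_eq_iff)
  have one: "p * s - q * r = 1" using dabs prod l mult_pos_pos[OF l] by linarith
  have t2: "t > 2" using tr sum l by linarith
  have "l1 \<noteq> l2"
  proof
    assume "l1 = l2"
    then have "l1 * l1 = 1" "l1 > 1" using prod one sum t2 by auto
    then show False using less_1_mult[of l1 l1] by simp
  qed
  \<comment> \<open>A triangular integer matrix of determinant 1 has both diagonal entries 1 or both
    -1, hence trace 2 or -2.\<close>
  have "r \<noteq> 0"
  proof
    assume "r = 0"
    then have ps: "p * s = 1" using one by simp
    then have "A $ 1 $ 1 * A $ 2 $ 2 = 1" unfolding pqrs by (metis of_int_mult of_int_eq_1_iff)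
    then have "A $ 1 $ 1 = 1 \<and> A $ 2 $ 2 = 1 \<or> A $ 1 $ 1 = -1 \<and> A $ 2 $ 2 = -1"
      by (rule zmult_eq_1_iff[THEN iffD1])
    then show False using t2 unfolding t_def pqrs by auto
  qed
  have ch: "l * l - t * l + 1 = 0" if "l = l1 \<or> l = l2" for l
    using that sum prod one by (auto simp: algebra_simps)
  have q: "r * q + (l - p) * s = l * (l - p)" if "l = l1 \<or> l = l2" for l
    using ch[OF that] one unfolding t_def by (simp add: algebra_simps)
  show ?thesis
  proof (rule that[OF l, of r "l1 - p" r "l2 - p"])
    show "r * (l2 - p) \<noteq> r * (l1 - p)" using \<open>r \<noteq> 0\<close> \<open>l1 \<noteq> l2\<close> by simp
    show "r * real_of_int (A $ 1 $ 2) + (l1 - p) * real_of_int (A $ 2 $ 2) = l1 * (l1 - p)"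
      using q[of l1] by (simp add: pqrs)
    show "r * real_of_int (A $ 1 $ 2) + (l2 - p) * real_of_int (A $ 2 $ 2) = l2 * (l2 - p)"
      using q[of l2] by (simp add: pqrs)
  qed (auto simp: pqrs algebra_simps)
qed

section \<open>Characters scaled by the monodromy\<close>

definition real_add_group :: "real monoid" where
  "real_add_group = \<lparr>carrier = UNIV, mult = (+), one = 0\<rparr>"

lemma group_real_add: "group real_add_group"
proof (rule groupI)
  fix x :: real
  show "\<exists>y\<in>carrier real_add_group. y \<otimes>\<^bsub>real_add_group\<^esub> x = \<one>\<^bsub>real_add_group\<^esub>"
    by (rule bexI[of _ "- x"]) (auto simp: real_add_group_def)
qed (auto simp: real_add_group_def)

context spanning_paths
begin

lemma H1_fun_row:
  assumes ch: "character ch" and h: "continuous_map X X h" "h x = x"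
    and e: "e 1 \<in> carrier H1" "e 2 \<in> carrier H1"
    and A: "hom_induced 1 X {} X {} h (e j) = e 1 [^]\<^bsub>H1\<^esub> m \<otimes>\<^bsub>H1\<^esub> e 2 [^]\<^bsub>H1\<^esub> (n::int)" and ej: "e j \<in> carrier H1"
  shows "H1_fun (\<lambda>a. ch (fundamental_induced X x h a)) (e j) = of_int m * H1_fun ch (e 1) + of_int n * H1_fun ch (e 2)"
proof -
  interpret H: group H1 by (rule group_relative_homology_group)
  have "H1_fun (\<lambda>a. ch (fundamental_induced X x h a)) (e j) = H1_fun ch (e 1 [^]\<^bsub>H1\<^esub> m \<otimes>\<^bsub>H1\<^esub> e 2 [^]\<^bsub>H1\<^esub> n)"
    using H1_fun_induced[OF ch h ej] A by simp
  also have "\<dots> = H1_fun ch (e 1 [^]\<^bsub>H1\<^esub> m) + H1_fun ch (e 2 [^]\<^bsub>H1\<^esub> n)"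
    using e by (intro H1_fun_mult[OF ch]) auto
  also have "\<dots> = of_int m * H1_fun ch (e 1) + of_int n * H1_fun ch (e 2)"
    using additive_int_pow[OF H.is_group H1_fun_mult[OF ch]] e by simp
  finally show ?thesis .
qed

lemma H1_fun_cong:
  assumes "\<And>a. a \<in> carrier PI \<Longrightarrow> ch a = ch' a" "C \<in> carrier H1"
  shows "character ch \<Longrightarrow> H1_fun ch C = H1_fun ch' C"
proof -
  assume ch: "character ch"
  then have ch': "character ch'" using assms(1) by (auto simp: character_def)
  obtain c where c: "singular_relcycle 1 X {} c" "C = homologous_rel_set 1 X {} c"
    using assms by (auto simp: H1_carrier)
  then have k: "Poly_Mapping.keys c \<subseteq> singular_simplex_set (Suc 0) X"
    by (simp add: singular_cycle singular_chain_def)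
  show ?thesis unfolding c(2) H1_fun_eq[OF ch c(1)] H1_fun_eq[OF ch' c(1)]
    by (rule frag_sum_cong[OF k]) (simp add: weight_def assms(1) edge_path_pathin)
qed

lemma H1_basis_expand:
  assumes e: "H1_basis X e" and C: "C \<in> carrier H1"
  obtains m n :: int where "C = e 1 [^]\<^bsub>H1\<^esub> m \<otimes>\<^bsub>H1\<^esub> e 2 [^]\<^bsub>H1\<^esub> n"
proof -
  have "\<forall>c\<in>carrier H1. \<exists>!k :: int \<times> int. c = e 1 [^]\<^bsub>H1\<^esub> fst k \<otimes>\<^bsub>H1\<^esub> e 2 [^]\<^bsub>H1\<^esub> snd k"
    using e unfolding H1_basis_def by (rule conjunct2)
  from ex1_implies_ex[OF bspec[OF this C]] obtain k :: "int \<times> int"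
    where "C = e 1 [^]\<^bsub>H1\<^esub> fst k \<otimes>\<^bsub>H1\<^esub> e 2 [^]\<^bsub>H1\<^esub> snd k" ..
  then show thesis by (rule that)
qed

lemma H1_fun_zero_of_basis:
  assumes e: "H1_basis X e" and ch: "character ch" and z: "H1_fun ch (e 1) = 0" "H1_fun ch (e 2) = 0" and C: "C \<in> carrier H1"
  shows "H1_fun ch C = 0"
proof -
  interpret H: group H1 by (rule group_relative_homology_group)
  have ec: "e i \<in> carrier H1" for i using e by (simp add: H1_basis_def)
  obtain m n :: int where C_eq: "C = e 1 [^]\<^bsub>H1\<^esub> m \<otimes>\<^bsub>H1\<^esub> e 2 [^]\<^bsub>H1\<^esub> n"
    using H1_basis_expand[OF e C] .
  have "H1_fun ch C = H1_fun ch (e 1 [^]\<^bsub>H1\<^esub> m) + H1_fun ch (e 2 [^]\<^bsub>H1\<^esub> n)"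
    unfolding C_eq using ec by (intro H1_fun_mult[OF ch]) auto
  also have "\<dots> = of_int m * H1_fun ch (e 1) + of_int n * H1_fun ch (e 2)"
    using additive_int_pow[OF H.is_group H1_fun_mult[OF ch]] ec by simp
  finally show ?thesis using z by simp
qed

text \<open>Freeness provides a plane of characters, and evaluation on the homology basis identifies
  it with the plane of row vectors. On the latter the monodromy acts by \<open>A\<close>, so left
  eigenvectors of \<open>A\<close> give the characters.\<close>

theorem eigen_characters:
  assumes \<theta>: "\<theta> \<in> iso pt_group PI"
    and h: "homeomorphic_map X X h" "h x = x" and A: "H1_matrix X h A"
    and hyp: "hyperbolic_monodromy A" and unt: "untwisted_monodromy A"
  shows "\<exists>p1 p2 l1 l2. l1 > 0 \<and> l2 > 0 \<and> character p1 \<and> character p2 \<and>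
     (\<forall>a\<in>carrier PI. p1 (fundamental_induced X x h a) = l1 * p1 a) \<and>
     (\<forall>a\<in>carrier PI. p2 (fundamental_induced X x h a) = l2 * p2 a) \<and>
     p1 (\<theta> pt_a) * p2 (\<theta> pt_b) \<noteq> p1 (\<theta> pt_b) * p2 (\<theta> pt_a)"
proof -
  obtain e where e: "H1_basis X e" and Ae: "\<And>j. hom_induced 1 X {} X {} h (e j) = e 1 [^]\<^bsub>H1\<^esub> (A $ 1 $ j) \<otimes>\<^bsub>H1\<^esub> e 2 [^]\<^bsub>H1\<^esub> (A $ 2 $ j)"
    using A unfolding H1_matrix_def by blast
  have ec: "e i \<in> carrier H1" for i using e by (simp add: H1_basis_def)
  obtain h' where "homeomorphic_maps X X h h'" using h by (auto simp: homeomorphic_map_maps)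
  then have hc: "continuous_map X X h" and hc': "continuous_map X X h'" and hh': "\<And>y. y \<in> topspace X \<Longrightarrow> h (h' y) = y"
    and h'h: "\<And>y. y \<in> topspace X \<Longrightarrow> h' (h y) = y" by (auto simp: homeomorphic_maps_def)
  have h'x: "h' x = x" using h'h[OF base] h(2) by simp
  have "\<exists>m n. hom_induced 1 X {} X {} h' (e j) = e 1 [^]\<^bsub>H1\<^esub> (m::int) \<otimes>\<^bsub>H1\<^esub> e 2 [^]\<^bsub>H1\<^esub> (n::int)" for j
    using H1_basis_expand[OF e hom_induced_carrier[of 1 X "{}" X "{}" h' "e j"]] by metis
  then obtain m n :: "2 \<Rightarrow> int" where Ae': "\<And>j. hom_induced 1 X {} X {} h' (e j) = e 1 [^]\<^bsub>H1\<^esub> (m j) \<otimes>\<^bsub>H1\<^esub> e 2 [^]\<^bsub>H1\<^esub> (n j)"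
    by metis
  let ?\<phi> = "fundamental_induced X x h" and ?\<phi>' = "fundamental_induced X x h'"
  have \<phi>: "?\<phi> \<in> hom PI PI" "?\<phi>' \<in> hom PI PI" using fundamental_induced_hom[OF hc, of x] fundamental_induced_hom[OF hc', of x] h h'x by auto
  have ch\<phi>: "character (\<lambda>a. ch (?\<phi> a))" "character (\<lambda>a. ch (?\<phi>' a))" if "character ch" for ch
    using that \<phi> by (auto simp: character_def hom_def Pi_iff)
  have row: "H1_fun (\<lambda>a. ch (?\<phi> a)) (e j) = of_int (A $ 1 $ j) * H1_fun ch (e 1) + of_int (A $ 2 $ j) * H1_fun ch (e 2)"
    if "character ch" for ch j using H1_fun_row[OF that hc h(2) ec ec Ae ec] .
  have row': "H1_fun (\<lambda>a. ch (?\<phi>' a)) (e j) = of_int (m j) * H1_fun ch (e 1) + of_int (n j) * H1_fun ch (e 2)"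
    if "character ch" for ch j using H1_fun_row[OF that hc' h'x ec ec Ae' ec] .
  have \<phi>\<phi>': "?\<phi> (?\<phi>' a) = a" if "a \<in> carrier PI" for a
    using fundamental_induced_comp[OF hc' hc that] fundamental_induced_id[of X "h \<circ> h'" x a] hh' h(2) h'x that base by simp
  obtain \<psi> where \<psi>: "\<psi> \<in> iso PI pt_group" "\<And>a. a \<in> carrier pt_group \<Longrightarrow> \<psi> (\<theta> a) = a"
    using pt.PI.iso_set_sym[OF \<theta>] bij_betw_inv_into_left[of \<theta> "carrier pt_group" "carrier PI"] \<theta> by (auto simp: iso_def)
  have pab: "pt_a \<in> carrier pt_group" "pt_b \<in> carrier pt_group"
    using loop_a_loops loop_b_loops by (auto simp: fundamental_group_carrier)
  have ex: "\<exists>ch. character ch \<and> ch (\<theta> pt_a) = u \<and> ch (\<theta> pt_b) = w" for u w :: real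
  proof -
    obtain \<eta> where \<eta>: "\<eta> \<in> hom pt_group real_add_group" "\<eta> pt_a = u" "\<eta> pt_b = w"
      using pt_universal[OF group_real_add, of u w] by (auto simp: real_add_group_def)
    have "character (\<lambda>a. \<eta> (\<psi> a))"
      using \<eta>(1) \<psi>(1) unfolding character_def iso_def hom_def by (auto simp: Pi_iff real_add_group_def)
    then show ?thesis using \<eta> \<psi>(2) pab by (intro exI[of _ "\<lambda>a. \<eta> (\<psi> a)"]) auto
  qed
  obtain c1 c2 where c1: "character c1" "c1 (\<theta> pt_a) = 1" "c1 (\<theta> pt_b) = 0"
    and c2: "character c2" "c2 (\<theta> pt_a) = 0" "c2 (\<theta> pt_b) = 1" using ex by metis
  define ch where "ch s t = (\<lambda>a. s * c1 a + t * c2 a)" for s t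
  have chc: "character (ch s t)" for s t using c1(1) c2(1) by (auto simp: character_def ch_def algebra_simps)
  have chv: "ch s t (\<theta> pt_a) = s" "ch s t (\<theta> pt_b) = t" for s t using c1 c2 by (auto simp: ch_def)
  define x11 x12 x21 x22 where "x11 = H1_fun c1 (e 1)" "x12 = H1_fun c1 (e 2)" "x21 = H1_fun c2 (e 1)" "x22 = H1_fun c2 (e 2)"
  note xx = this
  have chx: "H1_fun (ch s t) (e 1) = s * x11 + t * x21" "H1_fun (ch s t) (e 2) = s * x12 + t * x22" for s t
    unfolding ch_def xx using H1_fun_linear[OF c1(1) c2(1) ec] by auto
  have tha: "\<theta> pt_a \<in> carrier PI" "\<theta> pt_b \<in> carrier PI" using pab \<theta> by (auto simp: iso_def hom_def)
  have inj: "s = 0 \<and> t = 0" if "s * x11 + t * x21 = 0" "s * x12 + t * x22 = 0" for s t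
  proof -
    have "ch s t a = 0" if "a \<in> carrier PI" for a
      by (rule H1_fun_faithful[OF chc _ that], rule H1_fun_zero_of_basis[OF e chc])
         (use chx \<open>s * x11 + t * x21 = 0\<close> \<open>s * x12 + t * x22 = 0\<close> in auto)
    then show ?thesis using chv[of s t] tha by metis
  qed
  \<comment> \<open>The determinant of the passage from values on the generators to values on the
    homology basis. It is nonzero because a character with zero functional vanishes.\<close>
  define D where "D = x11 * x22 - x12 * x21"
  have D: "D \<noteq> 0"
  proof
    assume "D = 0"
    then have "x22 = 0 \<and> - x12 = 0" "x21 = 0 \<and> - x11 = 0"
      using inj[of x22 "- x12"] inj[of x21 "- x11"] by (auto simp: D_def algebra_simps)
    then show False using inj[of 1 1] by simp
  qed
  have solve: "\<exists>s t. s * x11 + t * x21 = u \<and> s * x12 + t * x22 = w" for u w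
  proof (intro exI conjI)
    show "(u * x22 - w * x21) / D * x11 + (w * x11 - u * x12) / D * x21 = u"
      using D by (simp add: field_simps) (simp add: D_def algebra_simps)
    show "(u * x22 - w * x21) / D * x12 + (w * x11 - u * x12) / D * x22 = w"
      using D by (simp add: field_simps) (simp add: D_def algebra_simps)
  qed
  \<comment> \<open>The map \<open>h'\<close> also acts by an integer matrix; testing
    \<open>h \<circ> h' = id\<close> on characters with arbitrary values \<open>u\<close>,
    \<open>w\<close> shows that the two matrices are inverse. This is how the determinant of
    \<open>A\<close> is found to be 1 or -1.\<close>
  have AA': "of_int (m j) * (of_int (A $ 1 $ 1) * u + of_int (A $ 2 $ 1) * w) +
      of_int (n j) * (of_int (A $ 1 $ 2) * u + of_int (A $ 2 $ 2) * w) = (if j = 1 then u else w)" for j u and w :: real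
  proof -
    obtain s t where st: "s * x11 + t * x21 = u" "s * x12 + t * x22 = w" using solve by blast
    have "H1_fun (\<lambda>a. ch s t (?\<phi> (?\<phi>' a))) (e j) = H1_fun (ch s t) (e j)"
      by (rule H1_fun_cong) (use \<phi>\<phi>' ec ch\<phi>(2)[OF ch\<phi>(1)[OF chc[of s t]]] in auto)
    moreover have "j = 1 \<or> j = 2" by (rule exhaust_2)
    ultimately show ?thesis
      using row'[OF ch\<phi>(1)[OF chc[of s t]], of j] row[OF chc[of s t]] chx[of s t] st by auto
  qed
  have i: "m 1 * A $ 1 $ 1 + n 1 * A $ 1 $ 2 = 1" "m 1 * A $ 2 $ 1 + n 1 * A $ 2 $ 2 = 0"
     "m 2 * A $ 1 $ 1 + n 2 * A $ 1 $ 2 = 0" "m 2 * A $ 2 $ 1 + n 2 * A $ 2 $ 2 = 1"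
    using AA'[of 1 1 0] AA'[of 1 0 1] AA'[of 2 1 0] AA'[of 2 0 1]
    by (simp_all only: mult_1_right mult_zero_right add_0_right add_0_left if_True if_False simp_thms one_neq_zero
         flip: of_int_mult of_int_add) (simp_all add: of_int_eq_iff flip: of_int_mult of_int_add)
  have "(A $ 1 $ 1 * A $ 2 $ 2 - A $ 1 $ 2 * A $ 2 $ 1) * (m 1 * n 2 - n 1 * m 2) =
     (m 1 * A $ 1 $ 1 + n 1 * A $ 1 $ 2) * (m 2 * A $ 2 $ 1 + n 2 * A $ 2 $ 2) -
     (m 1 * A $ 2 $ 1 + n 1 * A $ 2 $ 2) * (m 2 * A $ 1 $ 1 + n 2 * A $ 1 $ 2)"
    by (simp add: algebra_simps)
  then have "(A $ 1 $ 1 * A $ 2 $ 2 - A $ 1 $ 2 * A $ 2 $ 1) * (m 1 * n 2 - n 1 * m 2) = 1" using i by simp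
  then have dd: "\<bar>A $ 1 $ 1 * A $ 2 $ 2 - A $ 1 $ 2 * A $ 2 $ 1\<bar> = 1"
    using zmult_eq_1_iff by fastforce
  obtain l1 l2 u1 u2 w1 w2 :: real where l: "l1 > 0" "l2 > 0"
    and E1: "u1 * A $ 1 $ 1 + w1 * A $ 2 $ 1 = l1 * u1" "u1 * A $ 1 $ 2 + w1 * A $ 2 $ 2 = l1 * w1"
    and E2: "u2 * A $ 1 $ 1 + w2 * A $ 2 $ 1 = l2 * u2" "u2 * A $ 1 $ 2 + w2 * A $ 2 $ 2 = l2 * w2"
    and ind: "u1 * w2 \<noteq> u2 * w1"
    using hyperbolic_left_eigenvectors[OF hyp unt dd] .
  \<comment> \<open>The difference of the two sides is a character whose functional vanishes on the
    basis.\<close>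
  have eig: "ch s t (?\<phi> a) = l * ch s t a" if a: "a \<in> carrier PI"
    and st: "s * x11 + t * x21 = u" "s * x12 + t * x22 = w"
    and E: "u * A $ 1 $ 1 + w * A $ 2 $ 1 = l * u" "u * A $ 1 $ 2 + w * A $ 2 $ 2 = l * w" for s t u w l a
  proof -
    let ?d = "\<lambda>a. 1 * ch s t (?\<phi> a) + (- l) * ch s t a"
    have cd: "character ?d" using ch\<phi>(1)[OF chc[of s t]] chc[of s t] by (simp add: character_def algebra_simps)
    have "H1_fun ?d (e j) = 0" for j
    proof -
      have "j = 1 \<or> j = 2" by (rule exhaust_2)
      then show ?thesis
        using H1_fun_linear[OF ch\<phi>(1)[OF chc[of s t]] chc[of s t] ec, of 1 "- l" j] row[OF chc[of s t], of j] chx[of s t] st E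
        by (auto simp: algebra_simps)
    qed
    then have "?d a = 0" using H1_fun_faithful[OF cd _ a] H1_fun_zero_of_basis[OF e cd] by blast
    then show ?thesis by simp
  qed
  obtain s1 t1 where st1: "s1 * x11 + t1 * x21 = u1" "s1 * x12 + t1 * x22 = w1" using solve by blast
  obtain s2 t2 where st2: "s2 * x11 + t2 * x21 = u2" "s2 * x12 + t2 * x22 = w2" using solve by blast
  have "u1 * w2 - u2 * w1 = (s1 * t2 - t1 * s2) * D"
    unfolding st1[symmetric] st2[symmetric] D_def by (simp add: algebra_simps)
  then have "s1 * t2 \<noteq> t1 * s2" using ind by auto
  then have "ch s1 t1 (\<theta> pt_a) * ch s2 t2 (\<theta> pt_b) \<noteq> ch s1 t1 (\<theta> pt_b) * ch s2 t2 (\<theta> pt_a)"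
    by (simp add: chv)
  then show ?thesis
    using l chc eig[OF _ st1 E1] eig[OF _ st2 E2] by blast
qed

end

section \<open>Non-commutative power series in two variables\<close>

text \<open>The Cauchy product for noncommuting variables: the sum over all ways to cut the word in
  two, computed by recursion on the first letter.\<close>

fun conv :: "(bool list \<Rightarrow> real) \<Rightarrow> (bool list \<Rightarrow> real) \<Rightarrow> bool list \<Rightarrow> real" where
  "conv f g [] = f [] * g []"
| "conv f g (i # w) = f [] * g (i # w) + conv (\<lambda>v. f (i # v)) g w"

lemma conv_add_left: "conv (\<lambda>v. f v + f' v) g w = conv f g w + conv f' g w"
  by (induction w arbitrary: f f') (auto simp: algebra_simps)

lemma conv_scale_left: "conv (\<lambda>v. c * f v) g w = c * conv f g w"
  by (induction w arbitrary: f) (auto simp: algebra_simps)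

lemma conv_add_right: "conv f (\<lambda>v. g v + g' v) w = conv f g w + conv f g' w"
  by (induction w arbitrary: f) (auto simp: algebra_simps)

lemma conv_scale_right: "conv f (\<lambda>v. c * g v) w = c * conv f g w"
  by (induction w arbitrary: f) (auto simp: algebra_simps)

lemma conv_zero_left [simp]: "conv (\<lambda>_. 0) g w = 0"
  by (induction w) auto

lemma conv_one_left: "conv (\<lambda>w. if w = [] then 1 else 0) g w = g w"
  by (cases w) auto

lemma conv_one_right: "conv f (\<lambda>w. if w = [] then 1 else 0) w = f w"
  by (induction w arbitrary: f) auto

lemma conv_assoc: "conv (conv f g) h w = conv f (conv g h) w"
  by (induction w arbitrary: f) (auto simp: conv_add_left conv_scale_left algebra_simps)

typedef ncseries = "UNIV :: (bool list \<Rightarrow> real) set"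
  morphisms coef Series by simp

lemma coef_Series [simp]: "coef (Series f) = f"
  by (simp add: Series_inverse)

lemma ncseries_eqI: "(\<And>w. coef f w = coef g w) \<Longrightarrow> f = g"
  by (metis coef_inject ext)

instantiation ncseries :: real_algebra_1
begin

definition "zero_ncseries = Series (\<lambda>_. 0)"
definition "one_ncseries = Series (\<lambda>w. if w = [] then 1 else 0)"
definition "plus_ncseries f g = Series (\<lambda>w. coef f w + coef g w)"
definition "minus_ncseries f g = Series (\<lambda>w. coef f w - coef g w)"
definition "uminus_ncseries f = Series (\<lambda>w. - coef f w)"
definition "times_ncseries f g = Series (conv (coef f) (coef g))"
definition "scaleR_ncseries c f = Series (\<lambda>w. c * coef f w)"

instance
proof
  fix a b c :: ncseries and r s :: real
  note d = plus_ncseries_def minus_ncseries_def uminus_ncseries_def times_ncseries_def zero_ncseries_def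
    one_ncseries_def scaleR_ncseries_def
  show "a + b + c = a + (b + c)" "a + b = b + a" "0 + a = a" "- a + a = 0" "a - b = a + - b"
    by (auto simp: d intro!: ncseries_eqI)
  show "a * b * c = a * (b * c)" "1 * a = a" "a * 1 = a"
    by (auto simp: d conv_assoc conv_one_left conv_one_right intro!: ncseries_eqI)
  show "(a + b) * c = a * c + b * c" "a * (b + c) = a * b + a * c"
    by (auto simp: d conv_add_left conv_add_right intro!: ncseries_eqI)
  show "r *\<^sub>R (a + b) = r *\<^sub>R a + r *\<^sub>R b" "(r + s) *\<^sub>R a = r *\<^sub>R a + s *\<^sub>R a"
    "r *\<^sub>R s *\<^sub>R a = (r * s) *\<^sub>R a" "1 *\<^sub>R a = a"
    by (auto simp: d algebra_simps intro!: ncseries_eqI)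
  show "r *\<^sub>R a * b = r *\<^sub>R (a * b)" "a * r *\<^sub>R b = r *\<^sub>R (a * b)"
    by (auto simp: d conv_scale_left conv_scale_right intro!: ncseries_eqI)
  show "(0 :: ncseries) \<noteq> 1"
  proof
    assume "(0 :: ncseries) = 1"
    then have "coef (Series (\<lambda>_. 0)) [] = coef (Series (\<lambda>w. if w = [] then 1 else 0)) []" by (simp add: d)
    then show False by simp
  qed
qed

end

lemma coef_simps [simp]:
  "coef 0 w = 0" "coef (f + g) w = coef f w + coef g w" "coef (f - g) w = coef f w - coef g w"
  "coef (- f) w = - coef f w" "coef (c *\<^sub>R f) w = c * coef f w"
  by (auto simp: plus_ncseries_def minus_ncseries_def uminus_ncseries_def zero_ncseries_def scaleR_ncseries_def)

lemma coef_one: "coef 1 w = (if w = [] then 1 else 0)"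
  by (simp add: one_ncseries_def)

lemma coef_mult: "coef (f * g) w = conv (coef f) (coef g) w"
  by (simp add: times_ncseries_def)

lemma coef_mult_Nil [simp]: "coef (f * g) [] = coef f [] * coef g []"
  by (simp add: coef_mult)

text \<open>Left division by a variable: a series is its constant term plus the sum of
  \<open>var i * shift i f\<close>. This decomposition drives the inductions below.\<close>

definition shift :: "bool \<Rightarrow> ncseries \<Rightarrow> ncseries" where
  "shift i f = Series (\<lambda>w. coef f (i # w))"

lemma coef_shift [simp]: "coef (shift i f) w = coef f (i # w)"
  by (simp add: shift_def)

lemma coef_mult_Cons: "coef (f * g) (i # w) = coef f [] * coef g (i # w) + coef (shift i f * g) w"
  by (simp add: coef_mult shift_def)

lemma shift_simps [simp]:
  "shift i 0 = 0" "shift i (f + g) = shift i f + shift i g" "shift i (c *\<^sub>R f) = c *\<^sub>R shift i f" "shift i 1 = 0"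
  by (auto intro!: ncseries_eqI simp: coef_one)

lemma shift_mult: "shift i (f * g) = coef f [] *\<^sub>R shift i g + shift i f * g"
  by (auto intro!: ncseries_eqI simp: coef_mult_Cons)

definition var :: "bool \<Rightarrow> ncseries" where
  "var i = Series (\<lambda>w. if w = [i] then 1 else 0)"

lemma coef_var: "coef (var i) w = (if w = [i] then 1 else 0)"
  by (simp add: var_def)

lemma shift_var: "shift j (var i) = (if i = j then 1 else 0)"
  by (auto intro!: ncseries_eqI simp: coef_var coef_one)

subsection \<open>Series of order at least n\<close>

definition of_order :: "nat \<Rightarrow> ncseries set" where
  "of_order n = {f. \<forall>w. length w < n \<longrightarrow> coef f w = 0}"

lemma of_order_0 [simp]: "f \<in> of_order 0" by (simp add: of_order_def)

lemma of_order_zero [simp]: "0 \<in> of_order n" by (simp add: of_order_def)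

lemma of_order_add: "f \<in> of_order n \<Longrightarrow> g \<in> of_order n \<Longrightarrow> f + g \<in> of_order n"
  by (simp add: of_order_def)

lemma of_order_diff: "f \<in> of_order n \<Longrightarrow> g \<in> of_order n \<Longrightarrow> f - g \<in> of_order n"
  by (simp add: of_order_def)

lemma of_order_uminus: "f \<in> of_order n \<Longrightarrow> - f \<in> of_order n"
  by (simp add: of_order_def)

lemma of_order_scaleR: "f \<in> of_order n \<Longrightarrow> c *\<^sub>R f \<in> of_order n"
  by (simp add: of_order_def)

lemma of_order_mono: "f \<in> of_order n \<Longrightarrow> m \<le> n \<Longrightarrow> f \<in> of_order m"
  by (simp add: of_order_def)

lemma conv_order:
  "(\<And>w. length w < m \<Longrightarrow> f w = 0) \<Longrightarrow> (\<And>w. length w < n \<Longrightarrow> g w = 0) \<Longrightarrow> length w < m + n \<Longrightarrow> conv f g w = 0"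
proof (induction w arbitrary: f m)
  case Nil
  then show ?case by (cases m) auto
next
  case (Cons i w)
  have "f [] * g (i # w) = 0" using Cons.prems by (cases m) auto
  moreover have "conv (\<lambda>v. f (i # v)) g w = 0"
    by (rule Cons.IH[of "m - 1"]) (use Cons.prems in auto)
  ultimately show ?case by simp
qed

lemma of_order_mult: "f \<in> of_order m \<Longrightarrow> g \<in> of_order n \<Longrightarrow> f * g \<in> of_order (m + n)"
  unfolding of_order_def by (auto simp: coef_mult intro: conv_order)

lemma of_order_mult_left: "f \<in> of_order n \<Longrightarrow> g * f \<in> of_order n"
  using of_order_mult[of g 0 f n] by simp

lemma of_order_mult_right: "f \<in> of_order n \<Longrightarrow> f * g \<in> of_order n"
  using of_order_mult[of f n g 0] by simp

lemma coef_mult_lowest: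
  fixes w :: "bool list" and f g :: ncseries
  assumes "g \<in> of_order (length w)" shows "coef (f * g) w = coef f [] * coef g w"
proof (cases w)
  case (Cons i v)
  have "shift i f * g \<in> of_order (length w)" by (rule of_order_mult_left[OF assms])
  then show ?thesis using Cons by (simp add: coef_mult_Cons of_order_def)
qed simp

lemma of_order_1: "f \<in> of_order (Suc 0) \<longleftrightarrow> coef f [] = 0"
  by (auto simp: of_order_def)

lemma of_order_all_eq: "(\<And>n. f - g \<in> of_order (Suc n)) \<Longrightarrow> f = g"
proof (rule ncseries_eqI)
  fix w :: "bool list" assume "\<And>n. f - g \<in> of_order (Suc n)"
  then have "f - g \<in> of_order (Suc (length w))" .
  then show "coef f w = coef g w" by (simp add: of_order_def)
qed

subsection \<open>Units\<close>

definition unit_group :: "ncseries monoid" where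
  "unit_group = \<lparr>carrier = {f. \<exists>g. f * g = 1 \<and> g * f = 1}, mult = (*), one = 1\<rparr>"

lemma unit_group_simps [simp]: "mult unit_group = (*)" "one unit_group = 1"
  by (auto simp: unit_group_def)

lemma group_unit_group: "group unit_group"
proof (rule groupI)
  fix f g assume "f \<in> carrier unit_group" "g \<in> carrier unit_group"
  then obtain f' g' where "f * f' = 1" "f' * f = 1" "g * g' = 1" "g' * g = 1" by (auto simp: unit_group_def)
  then have "(f * g) * (g' * f') = 1" "(g' * f') * (f * g) = 1"
    by (metis mult.assoc mult_1_right)+
  then show "f \<otimes>\<^bsub>unit_group\<^esub> g \<in> carrier unit_group" by (auto simp: unit_group_def)
next
  fix f assume "f \<in> carrier unit_group"
  then show "\<exists>g\<in>carrier unit_group. g \<otimes>\<^bsub>unit_group\<^esub> f = \<one>\<^bsub>unit_group\<^esub>" by (auto simp: unit_group_def)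
qed (auto simp: unit_group_def mult.assoc)

definition lin :: "(bool \<Rightarrow> real) \<Rightarrow> ncseries" where
  "lin l = l True *\<^sub>R var True + l False *\<^sub>R var False"

text \<open>The geometric series of \<open>- lin l\<close>, that is, the inverse of
  \<open>1 + lin l\<close>.\<close>

definition geo :: "(bool \<Rightarrow> real) \<Rightarrow> ncseries" where
  "geo l = Series (\<lambda>w. prod_list (map (\<lambda>i. - l i) w))"

lemma coef_lin: "coef (lin l) w = (case w of [i] \<Rightarrow> l i | _ \<Rightarrow> 0)"
  by (auto simp: lin_def coef_var split: list.splits)

lemma coef_geo: "coef (geo l) w = prod_list (map (\<lambda>i. - l i) w)"
  by (simp add: geo_def)

lemma shift_lin: "shift i (lin l) = l i *\<^sub>R 1"
  by (cases i) (auto simp: lin_def shift_var)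

lemma shift_geo: "shift i (geo l) = - l i *\<^sub>R geo l"
  by (auto intro!: ncseries_eqI simp: coef_geo)

lemma lin_mult_geo: "(1 + lin l) * geo l = 1"
proof (rule ncseries_eqI)
  fix w
  show "coef ((1 + lin l) * geo l) w = coef 1 w"
  proof (cases w)
    case Nil then show ?thesis by (simp add: coef_one coef_lin coef_geo)
  next
    case (Cons i v)
    then show ?thesis by (simp add: coef_mult_Cons shift_lin coef_lin coef_one coef_geo)
  qed
qed

lemma geo_mult_lin_coef: "coef (geo l * lin l) w = (if w = [] then 0 else - coef (geo l) w)"
proof (induction w)
  case (Cons i w)
  then show ?case by (simp add: coef_mult_Cons shift_geo coef_geo coef_lin split: list.splits)
qed (simp add: coef_lin)

lemma geo_mult_lin: "geo l * (1 + lin l) = 1"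
  by (auto intro!: ncseries_eqI simp: distrib_left geo_mult_lin_coef coef_one coef_geo)

lemma lin_unit: "1 + lin l \<in> carrier unit_group"
  using lin_mult_geo geo_mult_lin by (auto simp: unit_group_def)

subsection \<open>Substitution, modulo high order\<close>

text \<open>Replaces the variables by the series \<open>W\<close>, cut off after words of length
  \<open>n\<close>; the truncation avoids infinite sums, and statements about it hold modulo order
  \<open>Suc n\<close>.\<close>

primrec sub :: "(bool \<Rightarrow> ncseries) \<Rightarrow> nat \<Rightarrow> ncseries \<Rightarrow> ncseries" where
  "sub W 0 f = coef f [] *\<^sub>R 1"
| "sub W (Suc n) f = coef f [] *\<^sub>R 1 + W True * sub W n (shift True f) + W False * sub W n (shift False f)"

lemma sub_add: "sub W n (f + g) = sub W n f + sub W n g"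
  by (induction n arbitrary: f g) (auto simp: algebra_simps)

lemma sub_scaleR: "sub W n (c *\<^sub>R f) = c *\<^sub>R sub W n f"
  by (induction n arbitrary: f) (auto simp: algebra_simps)

lemma sub_zero [simp]: "sub W n 0 = 0"
  by (induction n) auto

lemma sub_one [simp]: "sub W n 1 = 1"
  by (cases n) (auto simp: coef_one)

lemma sub_var: "sub W (Suc n) (var i) = W i"
  by (cases i) (auto simp: shift_var coef_var)

lemma sub_lin: "sub W (Suc n) (1 + lin l) = 1 + l True *\<^sub>R W True + l False *\<^sub>R W False"
  unfolding lin_def sub_add sub_scaleR sub_var by simp

context
  fixes W :: "bool \<Rightarrow> ncseries"
  assumes W: "\<And>i. W i \<in> of_order (Suc 0)"
begin

lemma W_mult: "f \<in> of_order n \<Longrightarrow> W i * f \<in> of_order (Suc n)"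
  using of_order_mult[OF W[of i], of f n] by simp

lemma sub_Suc: "sub W (Suc n) f - sub W n f \<in> of_order (Suc n)"
proof (induction n arbitrary: f)
  case 0
  show ?case by (auto intro!: of_order_add of_order_scaleR W)
next
  case (Suc n)
  have "sub W (Suc (Suc n)) f - sub W (Suc n) f =
     W True * (sub W (Suc n) (shift True f) - sub W n (shift True f)) +
     W False * (sub W (Suc n) (shift False f) - sub W n (shift False f))"
    by (simp add: algebra_simps)
  also have "\<dots> \<in> of_order (Suc (Suc n))" by (intro of_order_add W_mult Suc)
  finally show ?case .
qed

text \<open>Truncation destroys exact multiplicativity. The error is carried along the product rule
  of \<open>shift\<close>, and each factor \<open>W i\<close> of positive order gains one
  degree.\<close>

lemma sub_mult: "sub W n (f * g) - sub W n f * sub W n g \<in> of_order (Suc n)"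
proof (induction n arbitrary: f g)
  case 0
  show ?case by (simp add: mult.commute)
next
  case (Suc n)
  let ?s = "sub W n" and ?S = "sub W (Suc n)"
  have "?S (f * g) - ?S f * ?S g =
      W True * ((?s (shift True f * g) - ?s (shift True f) * ?s g) - ?s (shift True f) * (?S g - ?s g)) +
      W False * ((?s (shift False f * g) - ?s (shift False f) * ?s g) - ?s (shift False f) * (?S g - ?s g))"
    by (simp add: shift_mult sub_add sub_scaleR algebra_simps)
  also have "\<dots> \<in> of_order (Suc (Suc n))"
    by (intro of_order_add W_mult of_order_diff Suc of_order_mult_left sub_Suc)
  finally show ?case .
qed

text \<open>The lowest-degree part of a series sees only the linear part of the substitution; when
  that is diagonal, each letter of a word contributes its own factor.\<close>

lemma sub_diagonal:
  assumes d: "\<And>i j. coef (W i) [j] = (if i = j then l i else 0)"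
  shows "m \<le> n \<Longrightarrow> f \<in> of_order m \<Longrightarrow>
     sub W n f \<in> of_order m \<and> (\<forall>w. length w = m \<longrightarrow> coef (sub W n f) w = prod_list (map l w) * coef f w)"
proof (induction n arbitrary: m f)
  case 0
  then show ?case by (auto simp: coef_one)
next
  case (Suc n)
  show ?case
  proof (cases m)
    case 0
    have "coef (W i) [] = 0" for i using W[of i] by (simp add: of_order_1)
    then show ?thesis using 0 by (simp add: coef_one)
  next
    case (Suc m')
    have c0: "coef f [] = 0" using Suc.prems Suc by (simp add: of_order_def)
    have sh: "shift i f \<in> of_order m'" for i using Suc.prems Suc by (simp add: of_order_def)
    have IH: "sub W n (shift i f) \<in> of_order m'"
      "\<And>w. length w = m' \<Longrightarrow> coef (sub W n (shift i f)) w = prod_list (map l w) * coef f (i # w)" for i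
      using Suc.IH[OF _ sh[of i]] Suc.prems Suc by auto
    have e: "sub W (Suc n) f = W True * sub W n (shift True f) + W False * sub W n (shift False f)"
      using c0 by simp
    have 1: "sub W (Suc n) f \<in> of_order m" unfolding e Suc by (intro of_order_add W_mult IH)
    have "coef (sub W (Suc n) f) w = prod_list (map l w) * coef f w" if w: "length w = m" for w
    proof -
      obtain j v where jv: "w = j # v" "length v = m'" using w Suc by (cases w) auto
      have t: "coef (W i * sub W n (shift i f)) (j # v) = (if i = j then l i else 0) * coef (sub W n (shift i f)) v" for i
        using W[of i] IH(1)[of i] jv coef_mult_lowest[of "sub W n (shift i f)" v "shift j (W i)"]
        by (simp add: coef_mult_Cons of_order_1 d)
      show ?thesis unfolding e jv(1) coef_simps(2) t using IH(2)[OF jv(2)] by (cases j) auto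
    qed
    with 1 show ?thesis by blast
  qed
qed

end

subsection \<open>The sign of the leading coefficient\<close>

definition deglex :: "(bool list \<times> bool list) set" where
  "deglex = lenlex {(False, True)}"

text \<open>The sign of the coefficient at the least word, where shorter words come first.\<close>

definition ncpos :: "ncseries \<Rightarrow> bool" where
  "ncpos f \<longleftrightarrow> (\<exists>w. coef f w > 0 \<and> (\<forall>v. (v, w) \<in> deglex \<longrightarrow> coef f v = 0))"

lemma wf_deglex: "wf deglex"
proof -
  have "wf {(False, True)}" by (simp add: wf_insert)
  then show ?thesis unfolding deglex_def by (rule wf_lenlex)
qed

lemma deglex_total: "(v, w) \<in> deglex \<or> v = w \<or> (w, v) \<in> deglex"
proof -
  have "total {(False, True)}" by (auto simp: total_on_def)
  then have "total deglex" unfolding deglex_def by (rule total_lenlex)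
  then show ?thesis by (auto simp: total_on_def)
qed

lemma deglex_trans: "(u, v) \<in> deglex \<Longrightarrow> (v, w) \<in> deglex \<Longrightarrow> (u, w) \<in> deglex"
proof -
  have "trans {(False, True)}" by (auto simp: trans_def)
  then show "(u, v) \<in> deglex \<Longrightarrow> (v, w) \<in> deglex \<Longrightarrow> (u, w) \<in> deglex"
    unfolding deglex_def by (meson lenlex_transI transD)
qed

lemma deglex_length: "(v, w) \<in> deglex \<Longrightarrow> length v \<le> length w"
  by (auto simp: deglex_def lenlex_conv)

lemma deglex_shorter: "length v < length w \<Longrightarrow> (v, w) \<in> deglex"
  by (auto simp: deglex_def lenlex_conv)

lemma ncpos_leading:
  assumes "f \<noteq> 0"
  obtains w where "coef f w \<noteq> 0" "\<And>v. (v, w) \<in> deglex \<Longrightarrow> coef f v = 0"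
proof -
  have "\<exists>w. coef f w \<noteq> 0" using assms ncseries_eqI[of f 0] by auto
  then obtain w where "w \<in> {w. coef f w \<noteq> 0}" "\<And>v. (v, w) \<in> deglex \<Longrightarrow> v \<notin> {w. coef f w \<noteq> 0}"
    using wfE_min[OF wf_deglex, of _ "{w. coef f w \<noteq> 0}"] by (metis mem_Collect_eq)
  then show thesis using that by auto
qed

lemma not_ncpos_zero: "\<not> ncpos 0" by (simp add: ncpos_def)

lemma ncpos_order:
  assumes "coef f w > 0" "\<And>v. (v, w) \<in> deglex \<Longrightarrow> coef f v = 0"
  shows "f \<in> of_order (length w)"
  using assms by (auto simp: of_order_def deglex_shorter)

text \<open>The leading word has the least length that occurs in \<open>f\<close>, so control of the
  lowest-degree part of \<open>g\<close> is enough.\<close>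

lemma ncpos_scaled:
  assumes f: "ncpos f"
    and g: "\<And>m. f \<in> of_order m \<Longrightarrow> g \<in> of_order m \<and> (\<forall>w. length w = m \<longrightarrow> coef g w = s w * coef f w)"
    and s: "\<And>w. s w > 0"
  shows "ncpos g"
proof -
  obtain w where w: "coef f w > 0" "\<And>v. (v, w) \<in> deglex \<Longrightarrow> coef f v = 0" using f by (auto simp: ncpos_def)
  have g': "g \<in> of_order (length w)" "\<And>v. length v = length w \<Longrightarrow> coef g v = s v * coef f v"
    using g[OF ncpos_order[OF w]] by auto
  have "coef g w > 0" using g'(2)[of w] w s by simp
  moreover have "coef g v = 0" if "(v, w) \<in> deglex" for v
    using deglex_length[OF that] g' w(2)[OF that] by (cases "length v = length w") (auto simp: of_order_def)
  ultimately show ?thesis by (auto simp: ncpos_def)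
qed

text \<open>The series is \<open>(1 + f) * (1 + g) - 1\<close>; the term \<open>f * g\<close> has
  larger order than either leading word, so leading terms behave as in a sum.\<close>

lemma ncpos_mult:
  assumes f: "ncpos f" "coef f [] = 0" and g: "ncpos g" "coef g [] = 0"
  shows "ncpos (f + g + f * g)"
proof -
  obtain w where w: "coef f w > 0" "\<And>v. (v, w) \<in> deglex \<Longrightarrow> coef f v = 0" using f by (auto simp: ncpos_def)
  obtain z where z: "coef g z > 0" "\<And>v. (v, z) \<in> deglex \<Longrightarrow> coef g v = 0" using g by (auto simp: ncpos_def)
  have fg: "f * g \<in> of_order (length w + length z)"
    by (intro of_order_mult ncpos_order w z)
  have "length w > 0" "length z > 0" using w z f g by (auto intro!: Nat.gr0I)
  then have 0: "coef (f * g) v = 0" if "length v \<le> length w \<or> length v \<le> length z" for v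
  proof -
    have "length v < length w + length z" using that \<open>length w > 0\<close> \<open>length z > 0\<close> by linarith
    then show ?thesis using fg by (simp add: of_order_def)
  qed
  consider "w = z" | "(w, z) \<in> deglex" | "(z, w) \<in> deglex" using deglex_total by blast
  then show ?thesis
  proof cases
    case 1
    then show ?thesis unfolding ncpos_def using w z 0 deglex_length
      by (intro exI[of _ w]) (auto dest: deglex_length)
  next
    case 2
    then show ?thesis unfolding ncpos_def using w z 0 deglex_trans[OF _ 2]
      by (intro exI[of _ w]) (auto dest: deglex_length)
  next
    case 3
    then show ?thesis unfolding ncpos_def using w z 0 deglex_trans[OF _ 3]
      by (intro exI[of _ z]) (auto dest: deglex_length)
  qed
qed

text \<open>From \<open>g = - f - f * g\<close>, the two series have opposite coefficients up to the
  length of the leading word of \<open>f\<close>.\<close>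

lemma ncpos_inverse:
  assumes f: "coef f [] = 0" "f \<noteq> 0" and inv: "(1 + f) * (1 + g) = 1" and g: "coef g [] = 0"
  shows "ncpos f \<or> ncpos g"
proof -
  obtain w where w: "coef f w \<noteq> 0" "\<And>v. (v, w) \<in> deglex \<Longrightarrow> coef f v = 0" using ncpos_leading[OF f(2)] by blast
  have fo: "f \<in> of_order (length w)" using w by (auto simp: of_order_def deglex_shorter)
  have ge: "g = - f - f * g" using inv by (simp add: algebra_simps eq_neg_iff_add_eq_0)
  have "f * g \<in> of_order (length w + Suc 0)"
    using of_order_mult[OF fo, of g "Suc 0"] g by (simp add: of_order_1)
  then have "coef (f * g) v = 0" if "length v \<le> length w" for v using that by (simp add: of_order_def)
  then have gv: "coef g v = - coef f v" if "length v \<le> length w" for v using that ge by (metis coef_simps(3,4) diff_zero)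
  show ?thesis
  proof (cases "coef f w > 0")
    case True then show ?thesis using w by (auto simp: ncpos_def)
  next
    case False
    then have "coef g w > 0" using gv[of w] w by simp
    moreover have "coef g v = 0" if "(v, w) \<in> deglex" for v using gv[OF deglex_length[OF that]] w(2)[OF that] by simp
    ultimately show ?thesis by (auto simp: ncpos_def)
  qed
qed

subsection \<open>Products of powers of the generators\<close>

text \<open>What is remembered of the image of the \<open>e\<close>-th power of a generator: a
  series in one variable with constant term 1 and linear coefficient \<open>e\<close>.\<close>

definition power_like :: "bool \<Rightarrow> real \<Rightarrow> ncseries \<Rightarrow> bool" where
  "power_like i e f \<longleftrightarrow> coef f [] = 1 \<and> coef f [i] = e \<and> (\<forall>w. \<not> set w \<subseteq> {i} \<longrightarrow> coef f w = 0)"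

lemma conv_support:
  "(\<And>w. \<not> set w \<subseteq> {i} \<Longrightarrow> f w = 0) \<Longrightarrow> (\<And>w. \<not> set w \<subseteq> {i} \<Longrightarrow> g w = 0) \<Longrightarrow> \<not> set w \<subseteq> {i} \<Longrightarrow> conv f g w = 0"
proof (induction w arbitrary: f)
  case (Cons j w)
  show ?case
  proof (cases "j = i")
    case True
    then have "\<not> set w \<subseteq> {i}" using Cons.prems(3) by auto
    then have "conv (\<lambda>v. f (j # v)) g w = 0" by (intro Cons.IH) (use Cons.prems in auto)
    then show ?thesis using Cons.prems(2)[of "j # w"] Cons.prems(3) by simp
  next
    case False
    then have "(\<lambda>v. f (j # v)) = (\<lambda>_. 0)" "g (j # w) = 0" using Cons.prems by auto
    then show ?thesis by simp
  qed
qed simp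

lemma power_like_mult:
  assumes f: "power_like i e f" and g: "power_like i e' g"
  shows "power_like i (e + e') (f * g)"
  unfolding power_like_def
proof (intro conjI allI impI)
  show "coef (f * g) [] = 1" using f g by (simp add: power_like_def)
  show "coef (f * g) [i] = e + e'" using f g by (simp add: power_like_def coef_mult_Cons)
  fix w assume "\<not> set w \<subseteq> {i}"
  then show "coef (f * g) w = 0"
    unfolding coef_mult using f g by (intro conv_support[of i]) (simp_all add: power_like_def)
qed

lemma power_like_one: "power_like i 0 1"
  by (auto simp: power_like_def coef_one)

lemma power_like_gen: "power_like i 1 (1 + lin (\<lambda>j. if j = i then 1 else 0))"
  by (auto simp: power_like_def coef_one coef_lin split: list.splits)

lemma power_like_inv: "power_like i (-1) (geo (\<lambda>j. if j = i then 1 else 0))"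
proof -
  have "prod_list (map (\<lambda>j. - (if j = i then 1 else 0 :: real)) w) = 0" if "\<not> set w \<subseteq> {i}" for w
    using that by (auto simp: prod_list_zero_iff)
  then show ?thesis by (simp add: power_like_def coef_geo)
qed

text \<open>In a word without equal neighbours, a prefix that is a power of one letter has length at
  most 1, so only the constant and the linear coefficient of \<open>f\<close> contribute.\<close>

lemma power_like_coef:
  assumes f: "power_like i e f" and w: "distinct_adj (j # w)"
  shows "coef (f * g) (j # w) = coef g (j # w) + (if j = i then e * coef g w else 0)"
proof (cases "j = i")
  case False
  then have "shift j f = 0" using f by (intro ncseries_eqI) (auto simp: power_like_def)
  then show ?thesis using False f by (simp add: coef_mult_Cons power_like_def)
next
  case True
  have "coef (shift i f * g) w = e * coef g w"
  proof (cases w)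
    case Nil then show ?thesis using f by (simp add: power_like_def)
  next
    case (Cons j' v)
    then have "j' \<noteq> i" using w True by auto
    then have "shift j' (shift i f) = 0" using f by (intro ncseries_eqI) (auto simp: power_like_def)
    then show ?thesis using f Cons by (simp add: coef_mult_Cons power_like_def)
  qed
  then show ?thesis using True f by (simp add: coef_mult_Cons power_like_def)
qed

section \<open>Exponential polynomials\<close>

inductive exp_poly :: "(real \<Rightarrow> real) \<Rightarrow> bool" where
  monomial: "exp_poly (\<lambda>s. c * exp (s * k))"
| add: "exp_poly f \<Longrightarrow> exp_poly g \<Longrightarrow> exp_poly (\<lambda>s. f s + g s)"

lemma exp_poly_const: "exp_poly (\<lambda>s. c)"
  using monomial[of c 0] by simp

lemma exp_poly_mult: "exp_poly f \<Longrightarrow> exp_poly (\<lambda>s. c * exp (s * k) * f s)"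
proof (induction rule: exp_poly.induct)
  case (monomial d j)
  have "(\<lambda>s. c * exp (s * k) * (d * exp (s * j))) = (\<lambda>s. (c * d) * exp (s * (k + j)))"
    by (auto simp: exp_add distrib_left)
  then show ?case using exp_poly.monomial[of "c * d" "k + j"] by (simp only:)
next
  case (add f g)
  then show ?case using exp_poly.add[OF add.IH] by (simp add: algebra_simps)
qed

lemma exp_poly_continuous: "exp_poly f \<Longrightarrow> continuous_on A f"
  by (induction rule: exp_poly.induct) (auto intro!: continuous_intros)

lemma exp_poly_sum:
  assumes "exp_poly f"
  shows "\<exists>K c. finite K \<and> f = (\<lambda>s. \<Sum>k\<in>K. c k * exp (s * k))"
  using assms
proof (induction rule: exp_poly.induct)
  case (monomial c k)
  show ?case by (rule exI[of _ "{k}"], rule exI[of _ "\<lambda>_. c"]) simp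
next
  case (add f g)
  then obtain K c L d where K: "finite K" "f = (\<lambda>s. \<Sum>k\<in>K. c k * exp (s * k))"
    and L: "finite L" "g = (\<lambda>s. \<Sum>k\<in>L. d k * exp (s * k))" by blast
  define e where "e k = (if k \<in> K then c k else 0) + (if k \<in> L then d k else 0)" for k
  have "(\<Sum>k\<in>K. c k * exp (s * k)) = (\<Sum>k\<in>K \<union> L. (if k \<in> K then c k else 0) * exp (s * k))"
    "(\<Sum>k\<in>L. d k * exp (s * k)) = (\<Sum>k\<in>K \<union> L. (if k \<in> L then d k else 0) * exp (s * k))" for s
    using K(1) L(1) by (auto intro!: sum.mono_neutral_cong_left)
  then have "(\<lambda>s. f s + g s) = (\<lambda>s. \<Sum>k\<in>K \<union> L. e k * exp (s * k))"
    unfolding K(2) L(2) e_def by (simp add: sum.distrib algebra_simps)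
  then show ?case using K(1) L(1) by blast
qed

text \<open>The term with the largest exponent dominates; if its coefficient is 0, it is dropped.
  The alternative to a strict eventual sign is vanishing everywhere.\<close>

lemma exp_sum_sign:
  fixes c :: "real \<Rightarrow> real"
  assumes "finite K"
  shows "(\<forall>s. (\<Sum>k\<in>K. c k * exp (s * k)) = 0) \<or> (\<forall>\<^sub>F s in at_top. (\<Sum>k\<in>K. c k * exp (s * k)) > 0) \<or>
     (\<forall>\<^sub>F s in at_top. (\<Sum>k\<in>K. c k * exp (s * k)) < 0)"
  using assms
proof (induction rule: finite_linorder_max_induct)
  case (insert m K)
  have m: "m \<notin> K" using insert by auto
  show ?case
  proof (cases "c m = 0")
    case True then show ?thesis using insert m by simp
  next
    case False
    have "((\<lambda>s. exp (s * (k - m))) \<longlongrightarrow> 0) at_top" if "k \<in> K" for k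
    proof -
      have "k - m < 0" using insert that by auto
      then have "filterlim (\<lambda>s. (k - m) * s) at_bot at_top"
        by (intro filterlim_tendsto_neg_mult_at_bot[OF tendsto_const _ filterlim_ident])
      then have "filterlim (\<lambda>s. s * (k - m)) at_bot at_top" by (simp only: mult.commute)
      then show ?thesis by (rule filterlim_compose[OF exp_at_bot])
    qed
    then have "((\<lambda>s. c m + (\<Sum>k\<in>K. c k * exp (s * (k - m)))) \<longlongrightarrow> c m + (\<Sum>k\<in>K. c k * 0)) at_top"
      by (intro tendsto_intros) auto
    then have lim: "((\<lambda>s. c m + (\<Sum>k\<in>K. c k * exp (s * (k - m)))) \<longlongrightarrow> c m) at_top" by simp
    have e: "(\<Sum>k\<in>insert m K. c k * exp (s * k)) = exp (s * m) * (c m + (\<Sum>k\<in>K. c k * exp (s * (k - m))))" for s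
      using insert m by (simp add: distrib_left sum_distrib_left exp_diff right_diff_distrib mult.commute)
    show ?thesis
    proof (cases "c m > 0")
      case True
      then have "\<forall>\<^sub>F s in at_top. c m + (\<Sum>k\<in>K. c k * exp (s * (k - m))) > 0" using order_tendstoD(1)[OF lim] by blast
      then show ?thesis unfolding e by (auto elim: eventually_mono)
    next
      case neg: False
      then have "\<forall>\<^sub>F s in at_top. c m + (\<Sum>k\<in>K. c k * exp (s * (k - m))) < 0" using order_tendstoD(2)[OF lim] False by simp
      then show ?thesis unfolding e by (auto elim: eventually_mono simp: mult_less_0_iff)
    qed
  qed
qed simp

lemma exp_poly_sign:
  assumes "exp_poly f"
  shows "(\<forall>s. f s = 0) \<or> (\<forall>\<^sub>F s in at_top. f s > 0) \<or> (\<forall>\<^sub>F s in at_top. f s < 0)"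
proof -
  obtain K c where K: "finite K" "f = (\<lambda>s. \<Sum>k\<in>K. c k * exp (s * k))" using exp_poly_sum[OF assms] by blast
  show ?thesis unfolding K(2) by (rule exp_sum_sign[OF K(1)])
qed

lemma eventually_scale:
  assumes "l > (0::real)" "eventually P at_top" shows "\<forall>\<^sub>F s in at_top. P (l * s)"
proof -
  have "filterlim (\<lambda>s. l * s) at_top at_top"
    using assms(1) by (intro filterlim_tendsto_pos_mult_at_top[OF tendsto_const _ filterlim_ident])
  then show ?thesis using assms(2) by (simp add: filterlim_iff)
qed

text \<open>The pair (u, v) is the map sending t to u t + v. A homomorphism into this group is a
  positive character together with a crossed homomorphism for it.\<close>

definition affine_group :: "(real \<times> real) monoid" where
  "affine_group = \<lparr>carrier = {(u, v). u > 0}, mult = (\<lambda>(u, v) (u', v'). (u * u', v + u * v')), one = (1, 0)\<rparr>"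

lemma group_affine_group: "group affine_group"
proof (rule groupI)
  fix x assume "x \<in> carrier affine_group"
  then obtain u v where x: "x = (u, v)" "u > 0" by (auto simp: affine_group_def)
  then show "\<exists>y\<in>carrier affine_group. y \<otimes>\<^bsub>affine_group\<^esub> x = \<one>\<^bsub>affine_group\<^esub>"
    by (intro bexI[of _ "(1 / u, - v / u)"]) (auto simp: affine_group_def)
qed (auto simp: affine_group_def algebra_simps)

section \<open>A non-standard order on a free group with two eigen-characters\<close>

text \<open>Freeness enters as the extension property for the two target groups in use, since an
  assumption of a locale cannot range over groups of all types.\<close>

locale free_eigen = group G for G (structure) +
  fixes a b :: 'a and p1 p2 :: "'a \<Rightarrow> real"
  assumes a [simp]: "a \<in> carrier G" and b [simp]: "b \<in> carrier G"
    and gen: "generate G {a, b} = carrier G"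
    and p1: "\<And>g h. g \<in> carrier G \<Longrightarrow> h \<in> carrier G \<Longrightarrow> p1 (g \<otimes> h) = p1 g + p1 h"
    and p2: "\<And>g h. g \<in> carrier G \<Longrightarrow> h \<in> carrier G \<Longrightarrow> p2 (g \<otimes> h) = p2 g + p2 h"
    and indep: "p1 a * p2 b \<noteq> p1 b * p2 a"
    and free_series: "\<And>x y. x \<in> carrier unit_group \<Longrightarrow> y \<in> carrier unit_group \<Longrightarrow> \<exists>m\<in>hom G unit_group. m a = x \<and> m b = y"
    and free_affine: "\<And>x y. x \<in> carrier affine_group \<Longrightarrow> y \<in> carrier affine_group \<Longrightarrow> \<exists>m\<in>hom G affine_group. m a = x \<and> m b = y"
begin

lemma gen_induct:
  assumes g: "g \<in> carrier G" and "P a" "P b"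
    and inv: "\<And>g. g \<in> carrier G \<Longrightarrow> P g \<Longrightarrow> P (inv g)"
    and mult: "\<And>g h. g \<in> carrier G \<Longrightarrow> h \<in> carrier G \<Longrightarrow> P g \<Longrightarrow> P h \<Longrightarrow> P (g \<otimes> h)"
  shows "P g"
proof -
  have 1: "P \<one>" using mult[of a "inv a"] inv[of a] assms(2) by simp
  have "g \<in> generate G {a, b}" using g gen by simp
  then show ?thesis
  proof (induction rule: generate.induct)
    case (eng h1 h2)
    then show ?case using gen mult by simp
  qed (use 1 assms in auto)
qed

lemma p1_one [simp]: "p1 \<one> = 0" and p2_one [simp]: "p2 \<one> = 0"
  using p1[of \<one> \<one>] p2[of \<one> \<one>] by auto

lemma p1_inv [simp]: "g \<in> carrier G \<Longrightarrow> p1 (inv g) = - p1 g"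
  using p1[of g "inv g"] by simp

lemma p2_inv [simp]: "g \<in> carrier G \<Longrightarrow> p2 (inv g) = - p2 g"
  using p2[of g "inv g"] by simp

definition pl :: "'a \<Rightarrow> bool \<Rightarrow> real" where "pl g i = (if i then p1 g else p2 g)"

text \<open>A Magnus expansion after a linear change of variables, chosen so that the linear part of
  \<open>mu g\<close> is \<open>(p1 g, p2 g)\<close>; an automorphism that scales both characters
  then acts diagonally in degree 1.\<close>

definition mu :: "'a \<Rightarrow> ncseries" where
  "mu = (SOME m. m \<in> hom G unit_group \<and> m a = 1 + lin (pl a) \<and> m b = 1 + lin (pl b))"

lemma mu: "mu \<in> hom G unit_group" "mu a = 1 + lin (pl a)" "mu b = 1 + lin (pl b)"
proof -
  have "\<exists>m. m \<in> hom G unit_group \<and> m a = 1 + lin (pl a) \<and> m b = 1 + lin (pl b)"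
    using free_series[OF lin_unit lin_unit] by blast
  from someI_ex[OF this] show "mu \<in> hom G unit_group" "mu a = 1 + lin (pl a)" "mu b = 1 + lin (pl b)"
    unfolding mu_def by blast+
qed

lemma series_hom_mult: "r \<in> hom G unit_group \<Longrightarrow> g \<in> carrier G \<Longrightarrow> h \<in> carrier G \<Longrightarrow> r (g \<otimes> h) = r g * r h"
  by (simp add: hom_def)

lemma series_hom_one: "r \<in> hom G unit_group \<Longrightarrow> r \<one> = 1"
  using hom_one[OF _ is_group group_unit_group] by simp

lemma series_hom_inv: "r \<in> hom G unit_group \<Longrightarrow> g \<in> carrier G \<Longrightarrow> r g * r (inv g) = 1 \<and> r (inv g) * r g = 1"
  using series_hom_mult[of r g "inv g"] series_hom_mult[of r "inv g" g] series_hom_one[of r] by simp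

lemma const_one:
  assumes r: "r \<in> hom G unit_group" and "coef (r a) [] = 1" "coef (r b) [] = 1" and g: "g \<in> carrier G"
  shows "coef (r g) [] = 1"
  using g
proof (rule gen_induct)
  fix g assume "g \<in> carrier G" "coef (r g) [] = 1"
  then show "coef (r (inv g)) [] = 1"
    using series_hom_inv[OF r, of g] by (metis coef_mult_Nil coef_one mult_1)
qed (use assms in \<open>auto simp: series_hom_mult\<close>)

lemma mu_const: "g \<in> carrier G \<Longrightarrow> coef (mu g) [] = 1"
  by (rule const_one[OF mu(1)]) (auto simp: mu coef_one coef_lin)

lemma mu_linear: assumes g: "g \<in> carrier G" shows "coef (mu g) [i] = pl g i"
  using g
proof (rule gen_induct)
  have m: "coef (mu (g \<otimes> h)) [i] = coef (mu g) [i] + coef (mu h) [i]" if "g \<in> carrier G" "h \<in> carrier G" for g h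
    using that mu_const by (simp add: series_hom_mult[OF mu(1)] coef_mult_Cons)
  fix g h assume gh: "g \<in> carrier G" "h \<in> carrier G" "coef (mu g) [i] = pl g i" "coef (mu h) [i] = pl h i"
  then show "coef (mu (g \<otimes> h)) [i] = pl (g \<otimes> h) i" using m by (simp add: pl_def p1 p2)
next
  fix g assume g: "g \<in> carrier G" "coef (mu g) [i] = pl g i"
  have "coef (mu g * mu (inv g)) [i] = coef (mu g) [i] + coef (mu (inv g)) [i]"
    using g mu_const by (simp add: coef_mult_Cons)
  then show "coef (mu (inv g)) [i] = pl (inv g) i"
    using series_hom_inv[OF mu(1) g(1)] g by (simp add: coef_one pl_def split: if_splits)
qed (auto simp: mu coef_one coef_lin)

text \<open>Both sides agree on the generators and are multiplicative up to the stated order, which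
  propagates through products and inverses.\<close>

lemma sub_mu:
  assumes r: "r \<in> hom G unit_group" and W: "\<And>i. W i \<in> of_order (Suc 0)"
    and ra: "r a = 1 + p1 a *\<^sub>R W True + p2 a *\<^sub>R W False"
    and rb: "r b = 1 + p1 b *\<^sub>R W True + p2 b *\<^sub>R W False" and g: "g \<in> carrier G"
  shows "sub W n (mu g) - r g \<in> of_order (Suc n)"
  using g
proof (rule gen_induct)
  have "sub W n (1 + lin l) - (1 + l True *\<^sub>R W True + l False *\<^sub>R W False) \<in> of_order (Suc n)" for l
  proof (cases n)
    case 0
    then show ?thesis using W by (simp add: of_order_1 coef_one coef_lin)
  next
    case (Suc k)
    then show ?thesis using sub_lin[of W k l] by simp
  qed
  then show "sub W n (mu a) - r a \<in> of_order (Suc n)" "sub W n (mu b) - r b \<in> of_order (Suc n)"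
    unfolding mu ra rb by (metis (full_types) pl_def)+
next
  fix g h assume gh: "g \<in> carrier G" "h \<in> carrier G" and IH: "sub W n (mu g) - r g \<in> of_order (Suc n)" "sub W n (mu h) - r h \<in> of_order (Suc n)"
  have "sub W n (mu (g \<otimes> h)) - r (g \<otimes> h) = (sub W n (mu g * mu h) - sub W n (mu g) * sub W n (mu h))
     + (sub W n (mu g) - r g) * sub W n (mu h) + r g * (sub W n (mu h) - r h)"
    by (simp add: series_hom_mult[OF mu(1)] series_hom_mult[OF r] gh algebra_simps)
  also have "\<dots> \<in> of_order (Suc n)"
    by (intro of_order_add sub_mult W of_order_mult_right of_order_mult_left IH)
  finally show "sub W n (mu (g \<otimes> h)) - r (g \<otimes> h) \<in> of_order (Suc n)" .
next
  fix g assume g: "g \<in> carrier G" and IH: "sub W n (mu g) - r g \<in> of_order (Suc n)"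
  let ?s = "sub W n (mu (inv g))"
  \<comment> \<open>It suffices that \<open>?s\<close> is a left inverse of \<open>r g\<close> up to
    high order; there \<open>r g\<close> may be exchanged for \<open>sub W n (mu g)\<close>.\<close>
  have "?s - r (inv g) = (?s * r g - 1) * r (inv g)"
    using series_hom_inv[OF r g] by (simp add: left_diff_distrib mult.assoc)
  also have "?s * r g - 1 = (?s * sub W n (mu g) - sub W n (mu (inv g) * mu g)) - ?s * (sub W n (mu g) - r g)"
    using series_hom_inv[OF mu(1) g] by (simp add: algebra_simps)
  also have "\<dots> = - (sub W n (mu (inv g) * mu g) - ?s * sub W n (mu g)) - ?s * (sub W n (mu g) - r g)" by simp
  finally have "?s - r (inv g) = (- (sub W n (mu (inv g) * mu g) - ?s * sub W n (mu g)) - ?s * (sub W n (mu g) - r g)) * r (inv g)" .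
  also have "\<dots> \<in> of_order (Suc n)"
    by (intro of_order_mult_right of_order_diff of_order_uminus sub_mult W of_order_mult_left IH)
  finally show "?s - r (inv g) \<in> of_order (Suc n)" .
qed

definition dt :: real where "dt = p1 a * p2 b - p1 b * p2 a"

lemma dt: "dt \<noteq> 0" using indep by (simp add: dt_def)

text \<open>By \<open>sub_mu\<close>, every representation by series is obtained from \<open>mu\<close> by substituting these
  series for the variables.\<close>

definition solve :: "ncseries \<Rightarrow> ncseries \<Rightarrow> bool \<Rightarrow> ncseries" where
  "solve A B i = (if i then (p2 b / dt) *\<^sub>R A - (p2 a / dt) *\<^sub>R B else (p1 a / dt) *\<^sub>R B - (p1 b / dt) *\<^sub>R A)"

lemma solve_eq:
  "A = p1 a *\<^sub>R solve A B True + p2 a *\<^sub>R solve A B False"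
  "B = p1 b *\<^sub>R solve A B True + p2 b *\<^sub>R solve A B False"
proof -
  have e: "(p1 a * p2 b - p2 a * p1 b) / dt = 1" "(p1 a * p2 b - p1 b * p2 a) / dt = 1"
    using dt by (simp_all add: dt_def mult.commute)
  have "p1 a *\<^sub>R solve A B True + p2 a *\<^sub>R solve A B False = ((p1 a * p2 b - p2 a * p1 b) / dt) *\<^sub>R A"
    "p1 b *\<^sub>R solve A B True + p2 b *\<^sub>R solve A B False = ((p1 a * p2 b - p1 b * p2 a) / dt) *\<^sub>R B"
    by (auto intro!: ncseries_eqI simp: solve_def field_simps diff_divide_distrib)
  then show "A = p1 a *\<^sub>R solve A B True + p2 a *\<^sub>R solve A B False"
    "B = p1 b *\<^sub>R solve A B True + p2 b *\<^sub>R solve A B False" unfolding e by simp_all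
qed

lemma sub_mu_solve:
  assumes r: "r \<in> hom G unit_group" and c: "coef (r a) [] = 1" "coef (r b) [] = 1" and g: "g \<in> carrier G"
  shows "solve (r a - 1) (r b - 1) i \<in> of_order (Suc 0)"
    "sub (solve (r a - 1) (r b - 1)) n (mu g) - r g \<in> of_order (Suc n)"
proof -
  let ?W = "solve (r a - 1) (r b - 1)"
  show W: "?W i \<in> of_order (Suc 0)" for i using c by (simp add: solve_def of_order_1 coef_one)
  show "sub ?W n (mu g) - r g \<in> of_order (Suc n)"
    by (rule sub_mu[OF r W _ _ g]) (use solve_eq[where A = "r a - 1" and B = "r b - 1"] in \<open>simp_all add: algebra_simps\<close>)
qed

subsection \<open>Faithfulness of the Magnus representation\<close>

definition gn :: "bool \<Rightarrow> 'a" where "gn i = (if i then a else b)"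

lemma gn [simp]: "gn i \<in> carrier G" by (simp add: gn_def)

definition ev :: "(bool \<times> int) list \<Rightarrow> 'a" where
  "ev s = foldr (\<lambda>(i, e) h. gn i [^] e \<otimes> h) s \<one>"

lemma ev_simps [simp]: "ev [] = \<one>" "ev ((i, e) # s) = gn i [^] e \<otimes> ev s"
  by (auto simp: ev_def)

lemma ev_closed [simp]: "ev s \<in> carrier G"
  by (induction s) auto

definition good :: "(bool \<times> int) list \<Rightarrow> bool" where
  "good s \<longleftrightarrow> distinct_adj (map fst s) \<and> (\<forall>(i, e)\<in>set s. e \<noteq> 0)"

lemma good_step: assumes s: "good s" shows "\<exists>t. good t \<and> gn i [^] (e::int) \<otimes> ev s = ev t"
proof (cases "e = 0")
  case True then show ?thesis using s by auto
next
  case e: False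
  show ?thesis
  proof (cases s)
    case Nil then show ?thesis using e by (intro exI[of _ "[(i, e)]"]) (auto simp: good_def)
  next
    case (Cons x s')
    obtain j k where x: "x = (j, k)" by fastforce
    show ?thesis
    proof (cases "j = i")
      case False
      then show ?thesis using s e Cons x by (intro exI[of _ "(i, e) # s"]) (auto simp: good_def)
    next
      case True
      have m: "gn i [^] e \<otimes> ev s = gn i [^] (e + k) \<otimes> ev s'"
        using Cons x True by (simp add: int_pow_mult m_assoc)
      have "good s'" using s Cons by (auto simp: good_def distinct_adj_Cons)
      show ?thesis
      proof (cases "e + k = 0")
        case True
        then show ?thesis using m \<open>good s'\<close> by (intro exI[of _ s']) simp
      next
        case False
        have "good ((i, e + k) # s')" using s Cons x True False \<open>j = i\<close> by (auto simp: good_def distinct_adj_Cons)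
        then show ?thesis using m by (intro exI[of _ "(i, e + k) # s'"]) simp
      qed
    qed
  qed
qed

lemma good_mult: "good t \<Longrightarrow> \<exists>u. good u \<and> ev s \<otimes> ev t = ev u"
proof (induction s)
  case (Cons x s)
  obtain i e where x: "x = (i, e)" by fastforce
  obtain u where u: "good u" "ev s \<otimes> ev t = ev u" using Cons by blast
  obtain v where "good v" "gn i [^] e \<otimes> ev u = ev v" using good_step[OF u(1)] by blast
  then show ?case using u x by (auto simp: m_assoc)
qed auto

lemma good_exists: "g \<in> carrier G \<Longrightarrow> \<exists>s. good s \<and> g = ev s"
proof -
  assume "g \<in> carrier G"
  then have "g \<in> generate G {a, b}" using gen by simp
  then show ?thesis
  proof (induction rule: generate.induct)
    case one
    show ?case by (intro exI[of _ "[]"]) (auto simp: good_def)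
  next
    case (incl h)
    then obtain i where "h = gn i" by (metis (full_types) gn_def insertE singletonD)
    then show ?case by (intro exI[of _ "[(i, 1)]"]) (auto simp: good_def)
  next
    case (inv h)
    then obtain i where "h = gn i" by (metis (full_types) gn_def insertE singletonD)
    then show ?case by (intro exI[of _ "[(i, -1)]"]) (auto simp: good_def int_pow_neg)
  next
    case (eng g h)
    then obtain s t where "good s" "good t" "g = ev s" "h = ev t" by blast
    then show ?case using good_mult[of t s] by auto
  qed
qed

text \<open>Magnus's argument: for a reduced product of nonzero powers of alternating generators,
  the coefficient at the word of those generators is the product of the exponents.\<close>

lemma standard_magnus_faithful:
  assumes r: "r \<in> hom G unit_group" and ri: "\<And>i. r (gn i) = 1 + lin (\<lambda>j. if j = i then 1 else 0)"
    and g: "g \<in> carrier G" "r g = 1"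
  shows "g = \<one>"
proof -
  have inv: "r (inv (gn i)) = geo (\<lambda>j. if j = i then 1 else 0)" for i
    using series_hom_inv[OF r gn[of i]] geo_mult_lin[of "\<lambda>j. if j = i then 1 else 0"]
    unfolding ri by (metis mult.assoc mult_1_left mult_1_right)
  have nat: "power_like i (of_nat n) (r (gn i [^] (n::nat)))" "power_like i (- of_nat n) (r (inv (gn i) [^] (n::nat)))" for i n
  proof (induction n)
    case 0
    { case 1 show ?case using power_like_one by (simp add: series_hom_one[OF r]) }
    { case 2 show ?case using power_like_one by (simp add: series_hom_one[OF r]) }
  next
    case (Suc n)
    { case 1 show ?case using power_like_mult[OF Suc(1) power_like_gen[of i]]
        by (simp add: series_hom_mult[OF r] ri add.commute) }
    { case 2 show ?case using power_like_mult[OF Suc(2) power_like_inv[of i]]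
        by (simp add: series_hom_mult[OF r] inv add.commute) }
  qed
  have pw: "power_like i (of_int e) (r (gn i [^] (e::int)))" for i e
  proof (cases e rule: int_cases2)
    case (nonneg n)
    show ?thesis unfolding nonneg int_pow_int using nat(1) by simp
  next
    case (nonpos n)
    show ?thesis unfolding nonpos int_pow_neg_int[OF gn] using nat(2)[of i n] by (simp add: nat_pow_inv)
  qed
  \<comment> \<open>Each syllable absorbs at most one letter of a word without equal neighbours.
    This kills the unwanted term in \<open>main\<close>.\<close>
  have long: "distinct_adj w \<Longrightarrow> length w > length s \<Longrightarrow> coef (r (ev s)) w = 0" for s w
  proof (induction s arbitrary: w)
    case Nil
    then show ?case by (simp add: series_hom_one[OF r] coef_one)
  next
    case (Cons x s)
    obtain i e where x: "x = (i, e)" by fastforce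
    obtain j v where w: "w = j # v" using Cons.prems by (cases w) auto
    have "coef (r (ev s)) (j # v) = 0" "coef (r (ev s)) v = 0"
      using Cons.IH[of w] Cons.IH[of v] Cons.prems w by (auto simp: distinct_adj_Cons)
    then show ?case using power_like_coef[OF pw[of i e], of j v "r (ev s)"] Cons.prems
      unfolding w x by (simp add: series_hom_mult[OF r])
  qed
  have main: "good s \<Longrightarrow> coef (r (ev s)) (map fst s) = (\<Prod>(i, e)\<leftarrow>s. of_int e)" for s
  proof (induction s)
    case Nil
    then show ?case by (simp add: series_hom_one[OF r] coef_one)
  next
    case (Cons x s)
    obtain i e where x: "x = (i, e)" by fastforce
    have "good s" using Cons.prems by (auto simp: good_def distinct_adj_Cons)
    moreover have d: "distinct_adj (i # map fst s)" using Cons.prems x by (simp add: good_def)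
    ultimately show ?case
      using power_like_coef[OF pw[of i e] d, of "r (ev s)"] long[OF d, of s] Cons.IH x
      by (simp add: series_hom_mult[OF r])
  qed
  obtain s where s: "good s" "g = ev s" using good_exists[OF g(1)] by blast
  show ?thesis
  proof (cases s)
    case (Cons x t)
    have "(\<Prod>(i, e)\<leftarrow>s. real_of_int e) \<noteq> 0" using s(1) by (auto simp: good_def prod_list_zero_iff)
    then show ?thesis using main[OF s(1)] g(2) s(2) Cons by (simp add: coef_one)
  qed (use s in simp)
qed

text \<open>Independence of the characters makes the change of variables invertible, so the standard
  expansion is obtained from \<open>mu\<close> by substitution and inherits triviality to every
  order.\<close>

lemma mu_faithful: assumes g: "g \<in> carrier G" "mu g = 1" shows "g = \<one>"
proof -
  obtain r where r: "r \<in> hom G unit_group" "r a = 1 + lin (\<lambda>j. if j = True then 1 else 0)" "r b = 1 + lin (\<lambda>j. if j = False then 1 else 0)"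
    using free_series[OF lin_unit lin_unit] by blast
  have ri: "r (gn i) = 1 + lin (\<lambda>j. if j = i then 1 else 0)" for i
    using r(2,3) by (cases i) (simp_all add: gn_def)
  have c: "coef (r a) [] = 1" "coef (r b) [] = 1" by (simp_all add: r coef_one coef_lin)
  have "1 - r g \<in> of_order (Suc n)" for n
    using sub_mu_solve(2)[OF r(1) c g(1), of n] g(2) by simp
  then have "r g = 1" using of_order_all_eq[of 1 "r g"] by simp
  then show ?thesis using standard_magnus_faithful[OF r(1) ri g(1)] by simp
qed

end

context free_eigen
begin

text \<open>The right inverse \<open>f'\<close> gives surjectivity, which later prevents
  \<open>D s (f cc)\<close> from vanishing.\<close>

definition eigen_aut :: "('a \<Rightarrow> 'a) \<Rightarrow> real \<Rightarrow> real \<Rightarrow> bool" where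
  "eigen_aut f l1 l2 \<longleftrightarrow> f \<in> hom G G \<and> (\<exists>f'\<in>hom G G. \<forall>g\<in>carrier G. f (f' g) = g) \<and> l1 > 0 \<and> l2 > 0 \<and>
     (\<forall>g\<in>carrier G. p1 (f g) = l1 * p1 g \<and> p2 (f g) = l2 * p2 g)"

lemma eigen_autD:
  assumes "eigen_aut f l1 l2"
  shows "f \<in> hom G G" "l1 > 0" "l2 > 0" "g \<in> carrier G \<Longrightarrow> f g \<in> carrier G"
    "g \<in> carrier G \<Longrightarrow> p1 (f g) = l1 * p1 g" "g \<in> carrier G \<Longrightarrow> p2 (f g) = l2 * p2 g"
    "g \<in> carrier G \<Longrightarrow> h \<in> carrier G \<Longrightarrow> f (g \<otimes> h) = f g \<otimes> f h"
  using assms by (auto simp: eigen_aut_def hom_def)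

text \<open>The representation \<open>mu \<circ> f\<close> arises from \<open>mu\<close> by a
  substitution whose linear part is diagonal with entries \<open>l1\<close>, \<open>l2\<close>; the
  lowest-degree part is therefore rescaled word by word.\<close>

lemma mu_aut:
  assumes f: "eigen_aut f l1 l2" and g: "g \<in> carrier G" and m: "mu g - 1 \<in> of_order m"
  shows "mu (f g) - 1 \<in> of_order m \<and> (\<forall>w. length w = m \<longrightarrow>
     coef (mu (f g) - 1) w = prod_list (map (\<lambda>i. if i then l1 else l2) w) * coef (mu g - 1) w)"
proof -
  note F = eigen_autD[OF f]
  let ?r = "\<lambda>g. mu (f g)" and ?l = "\<lambda>i. if i then l1 else l2"
  have r: "?r \<in> hom G unit_group" using mu(1) F(1) by (auto simp: hom_def Pi_iff)
  have c: "coef (?r a) [] = 1" "coef (?r b) [] = 1" using mu_const F(4) by auto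
  let ?W = "solve (?r a - 1) (?r b - 1)"
  have W: "?W i \<in> of_order (Suc 0)" for i using sub_mu_solve(1)[OF r c g] .
  have d: "coef (?W i) [j] = (if i = j then ?l i else 0)" for i j
  proof -
    have e: "coef (?r a - 1) [j] = ?l j * pl a j" "coef (?r b - 1) [j] = ?l j * pl b j"
      using mu_linear F(4,5,6) by (auto simp: coef_one pl_def)
    have sv: "coef (solve A B i) w = (if i then (p2 b * coef A w - p2 a * coef B w) / dt
        else (p1 a * coef B w - p1 b * coef A w) / dt)" for A B w
      by (simp add: solve_def diff_divide_distrib)
    have "p2 b * (l * p1 a) - p2 a * (l * p1 b) = l * dt" "p1 a * (l * p2 b) - p1 b * (l * p2 a) = l * dt" for l
      by (simp_all add: dt_def algebra_simps)
    then show ?thesis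
      unfolding sv e using dt by (cases i; cases j) (simp_all add: pl_def)
  qed
  have "sub ?W m (mu g - 1) \<in> of_order m \<and> (\<forall>w. length w = m \<longrightarrow> coef (sub ?W m (mu g - 1)) w = prod_list (map ?l w) * coef (mu g - 1) w)"
    by (rule sub_diagonal[OF W d order_refl m])
  moreover have "sub ?W m (mu g - 1) = sub ?W m (mu g) - 1"
    using sub_add[of ?W m "mu g" "(-1) *\<^sub>R 1"] sub_scaleR[of ?W m "-1" 1] by simp
  moreover have D: "sub ?W m (mu g) - ?r g \<in> of_order (Suc m)" using sub_mu_solve(2)[OF r c g] .
  ultimately have 1: "sub ?W m (mu g) - 1 \<in> of_order m"
    "\<And>w. length w = m \<Longrightarrow> coef (sub ?W m (mu g) - 1) w = prod_list (map ?l w) * coef (mu g - 1) w" by auto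
  have e: "?r g - 1 = (sub ?W m (mu g) - 1) - (sub ?W m (mu g) - ?r g)" by simp
  have "?r g - 1 \<in> of_order m" unfolding e
    by (rule of_order_diff[OF 1(1) of_order_mono[OF D]]) simp
  moreover have "coef (?r g - 1) w = prod_list (map ?l w) * coef (mu g - 1) w" if "length w = m" for w
    unfolding e coef_simps(3) using 1(2)[OF that] D that by (simp add: of_order_def)
  ultimately show ?thesis by blast
qed

subsection \<open>The metabelian level\<close>

text \<open>The group acts on the reals through \<open>exp (s * p1 g)\<close>. The values of the cocycle \<open>D s\<close> on the
  generators are orthogonal to those of the principal cocycle \<open>\<lambda>g. exp (s * p1 g) - 1\<close>, so that
  \<open>D s\<close> does not vanish on the commutator of \<open>a\<close> and \<open>b\<close>.\<close>

definition coc :: "real \<Rightarrow> 'a \<Rightarrow> real \<times> real" where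
  "coc s = (SOME m. m \<in> hom G affine_group \<and> m a = (exp (s * p1 a), 1 - exp (s * p1 b)) \<and>
      m b = (exp (s * p1 b), exp (s * p1 a) - 1))"

definition D :: "real \<Rightarrow> 'a \<Rightarrow> real" where "D s g = snd (coc s g)"

lemma coc: "coc s \<in> hom G affine_group" "coc s a = (exp (s * p1 a), 1 - exp (s * p1 b))"
  "coc s b = (exp (s * p1 b), exp (s * p1 a) - 1)"
proof -
  have "\<exists>m. m \<in> hom G affine_group \<and> m a = (exp (s * p1 a), 1 - exp (s * p1 b)) \<and> m b = (exp (s * p1 b), exp (s * p1 a) - 1)"
    using free_affine[of "(exp (s * p1 a), 1 - exp (s * p1 b))" "(exp (s * p1 b), exp (s * p1 a) - 1)"]
    by (auto simp: affine_group_def)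
  from someI_ex[OF this] show "coc s \<in> hom G affine_group" "coc s a = (exp (s * p1 a), 1 - exp (s * p1 b))"
    "coc s b = (exp (s * p1 b), exp (s * p1 a) - 1)"
    unfolding coc_def by blast+
qed

lemma coc_mult: "g \<in> carrier G \<Longrightarrow> h \<in> carrier G \<Longrightarrow>
   coc s (g \<otimes> h) = (fst (coc s g) * fst (coc s h), snd (coc s g) + fst (coc s g) * snd (coc s h))"
  using coc(1)[of s] by (auto simp: hom_def affine_group_def case_prod_beta)

lemma coc_one: "coc s \<one> = (1, 0)"
  using hom_one[OF coc(1) is_group group_affine_group] by (simp add: affine_group_def)

lemma coc_fst: assumes g: "g \<in> carrier G" shows "fst (coc s g) = exp (s * p1 g)"
  using g
proof (rule gen_induct)
  fix g assume g: "g \<in> carrier G" "fst (coc s g) = exp (s * p1 g)"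
  have "fst (coc s (inv g)) * exp (s * p1 g) = 1"
    using coc_mult[of "inv g" g s] g coc_one by simp
  then show "fst (coc s (inv g)) = exp (s * p1 (inv g))" using g by (simp add: exp_minus field_simps)
qed (auto simp: coc coc_mult p1 distrib_left exp_add)

lemma D_a: "D s a = 1 - exp (s * p1 b)" and D_b: "D s b = exp (s * p1 a) - 1" and D_one [simp]: "D s \<one> = 0"
  by (auto simp: D_def coc coc_one)

lemma D_mult: "g \<in> carrier G \<Longrightarrow> h \<in> carrier G \<Longrightarrow> D s (g \<otimes> h) = D s g + exp (s * p1 g) * D s h"
  by (simp add: D_def coc_mult coc_fst)

lemma D_inv: "g \<in> carrier G \<Longrightarrow> D s (inv g) = - exp (s * - p1 g) * D s g"
  using D_mult[of "inv g" g s] by simp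

definition cc :: 'a where "cc = a \<otimes> b \<otimes> inv a \<otimes> inv b"

lemma cc [simp]: "cc \<in> carrier G" "p1 cc = 0" "p2 cc = 0"
  by (auto simp: cc_def p1 p2)

text \<open>Expand both sides of \<open>cc \<otimes> (b \<otimes> a) = a \<otimes> b\<close>, using
  that \<open>cc\<close> acts trivially.\<close>

lemma cocycle_cc:
  assumes F: "\<And>g h. g \<in> carrier G \<Longrightarrow> h \<in> carrier G \<Longrightarrow> F (g \<otimes> h) = F g + exp (s * p1 g) * F h"
  shows "F cc = (1 - exp (s * p1 b)) * F a + (exp (s * p1 a) - 1) * (F b :: real)"
proof -
  have "inv b \<otimes> (b \<otimes> a) = a" by (simp add: m_assoc[symmetric])
  then have "cc \<otimes> (b \<otimes> a) = a \<otimes> b" by (simp add: cc_def m_assoc)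
  then have "F (cc \<otimes> (b \<otimes> a)) = F (a \<otimes> b)" by simp
  then show ?thesis using F by (simp add: p1 algebra_simps)
qed

lemma cocycle_principal:
  assumes F: "\<And>g h. g \<in> carrier G \<Longrightarrow> h \<in> carrier G \<Longrightarrow> F (g \<otimes> h) = F g + exp (s * p1 g) * (F h :: real)"
    and k: "F a = k * (exp (s * p1 a) - 1)" "F b = k * (exp (s * p1 b) - 1)" and g: "g \<in> carrier G"
  shows "F g = k * (exp (s * p1 g) - 1)"
  using g
proof (rule gen_induct)
  fix g assume g: "g \<in> carrier G" "F g = k * (exp (s * p1 g) - 1)"
  have "F \<one> = 0" using F[of \<one> \<one>] by simp
  then have "F (inv g) + exp (s * - p1 g) * F g = 0" using F[of "inv g" g] g by simp
  then have "F (inv g) = - (exp (s * - p1 g) * (k * (exp (s * p1 g) - 1)))" using g by simp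
  also have "\<dots> = k * (exp (s * p1 (inv g)) - 1)"
    using exp_add[of "s * - p1 g" "s * p1 g"] g by (simp add: algebra_simps)
  finally show "F (inv g) = k * (exp (s * p1 (inv g)) - 1)" .
next
  fix g h assume gh: "g \<in> carrier G" "h \<in> carrier G" and IH: "F g = k * (exp (s * p1 g) - 1)" "F h = k * (exp (s * p1 h) - 1)"
  show "F (g \<otimes> h) = k * (exp (s * p1 (g \<otimes> h)) - 1)"
    unfolding F[OF gh] IH p1[OF gh] distrib_left exp_add by (simp add: algebra_simps)
qed (fact k)+

lemma p1_nontrivial: "p1 a \<noteq> 0 \<or> p1 b \<noteq> 0"
  using indep by auto

text \<open>On the kernel of the character, the cocycles form a line: a cocycle vanishing on \<open>cc\<close> is
  principal.\<close>

lemma cocycle_proportional: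
  assumes F: "\<And>g h. g \<in> carrier G \<Longrightarrow> h \<in> carrier G \<Longrightarrow> F (g \<otimes> h) = F g + exp (s * p1 g) * (F h :: real)"
    and s: "s \<noteq> 0" and g: "g \<in> carrier G" "p1 g = 0"
  shows "F g * D s cc = D s g * F cc"
proof -
  define E where "E g = D s cc * F g - F cc * D s g" for g
  have E: "E (g \<otimes> h) = E g + exp (s * p1 g) * E h" if "g \<in> carrier G" "h \<in> carrier G" for g h
    using that F[OF that] D_mult[OF that] by (simp add: E_def algebra_simps)
  have "E cc = 0" by (simp add: E_def)
  then have r: "(exp (s * p1 b) - 1) * E a = (exp (s * p1 a) - 1) * E b"
    using cocycle_cc[of E s] E by (simp add: algebra_simps)
  define k where "k = (if p1 a \<noteq> 0 then E a / (exp (s * p1 a) - 1) else E b / (exp (s * p1 b) - 1))"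
  have nz: "exp (s * t) - 1 \<noteq> 0" if "t \<noteq> 0" for t using that s by simp
  have "E a = k * (exp (s * p1 a) - 1)"
    using nz[of "p1 a"] nz[of "p1 b"] p1_nontrivial r by (cases "p1 a = 0") (auto simp: k_def)
  moreover have "E b = k * (exp (s * p1 b) - 1)"
  proof (cases "p1 a = 0")
    case True then show ?thesis using nz[of "p1 b"] p1_nontrivial by (simp add: k_def)
  next
    case False then show ?thesis using nz[of "p1 a"] r by (simp add: k_def field_simps)
  qed
  ultimately have "E g = k * (exp (s * p1 g) - 1)" by (intro cocycle_principal[OF E _ _ g(1)])
  then show ?thesis using g by (simp add: E_def mult.commute)
qed

lemma D_cc: "D s cc = (1 - exp (s * p1 b))\<^sup>2 + (exp (s * p1 a) - 1)\<^sup>2"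
  using cocycle_cc[of "D s" s] D_mult by (simp add: D_a D_b power2_eq_square)

lemma D_cc_pos: assumes "s \<noteq> 0" shows "D s cc > 0"
proof -
  have "1 - exp (s * p1 b) \<noteq> 0 \<or> exp (s * p1 a) - 1 \<noteq> 0" using p1_nontrivial assms by auto
  then show ?thesis unfolding D_cc using sum_power2_gt_zero_iff by blast
qed

lemma D_exp_poly: assumes g: "g \<in> carrier G" shows "exp_poly (\<lambda>s. D s g)"
  using g
proof (rule gen_induct)
  have "exp_poly (\<lambda>s. 1 + (-1) * exp (s * p1 b))" "exp_poly (\<lambda>s. 1 * exp (s * p1 a) + (-1))"
    by (intro exp_poly.add exp_poly_const exp_poly.monomial)+
  then show "exp_poly (\<lambda>s. D s a)" "exp_poly (\<lambda>s. D s b)" by (simp_all add: D_a D_b)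
next
  fix g h assume gh: "g \<in> carrier G" "h \<in> carrier G" "exp_poly (\<lambda>s. D s g)" "exp_poly (\<lambda>s. D s h)"
  show "exp_poly (\<lambda>s. D s (g \<otimes> h))"
    using exp_poly.add[OF gh(3) exp_poly_mult[OF gh(4), of 1 "p1 g"]] gh by (simp add: D_mult)
next
  fix g assume g: "g \<in> carrier G" "exp_poly (\<lambda>s. D s g)"
  show "exp_poly (\<lambda>s. D s (inv g))"
    using exp_poly_mult[OF g(2), of "-1" "- p1 g"] g by (simp add: D_inv)
qed

text \<open>At \<open>s = 0\<close> the action is trivial and \<open>D 0\<close> is zero, so the
  first-order term of the cocycle is an ordinary additive character.\<close>

lemma D_deriv_0:
  assumes w: "\<And>g h. g \<in> carrier G \<Longrightarrow> h \<in> carrier G \<Longrightarrow> w (g \<otimes> h) = w g + w h" "w a = - p1 b" "w b = p1 a"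
    and g: "g \<in> carrier G"
  shows "((\<lambda>s. D s g) has_real_derivative w g) (at 0) \<and> D 0 g = 0"
  using g
proof (rule gen_induct)
  show "((\<lambda>s. D s a) has_real_derivative w a) (at 0) \<and> D 0 a = 0"
    "((\<lambda>s. D s b) has_real_derivative w b) (at 0) \<and> D 0 b = 0"
    by (auto simp: D_a D_b w intro!: derivative_eq_intros)
next
  fix g h assume gh: "g \<in> carrier G" "h \<in> carrier G" and
    i: "((\<lambda>s. D s g) has_real_derivative w g) (at 0) \<and> D 0 g = 0" "((\<lambda>s. D s h) has_real_derivative w h) (at 0) \<and> D 0 h = 0"
  have "((\<lambda>s. D s g + exp (s * p1 g) * D s h) has_real_derivative w g + w h) (at 0)"
    using i by (auto intro!: derivative_eq_intros)
  then show "((\<lambda>s. D s (g \<otimes> h)) has_real_derivative w (g \<otimes> h)) (at 0) \<and> D 0 (g \<otimes> h) = 0"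
    using gh i by (simp add: D_mult w)
next
  fix g assume g: "g \<in> carrier G" and i: "((\<lambda>s. D s g) has_real_derivative w g) (at 0) \<and> D 0 g = 0"
  have "w \<one> = 0" using w(1)[of \<one> \<one>] by simp
  then have wi: "w (inv g) = - w g" using w(1)[of g "inv g"] g by simp
  have "((\<lambda>s. - exp (s * - p1 g) * D s g) has_real_derivative - w g) (at 0)"
    using i by (auto intro!: derivative_eq_intros)
  then show "((\<lambda>s. D s (inv g)) has_real_derivative w (inv g)) (at 0) \<and> D 0 (inv g) = 0"
    using g i by (simp add: D_inv wi)
qed

text \<open>Since \<open>p1 \<circ> f\<close> is \<open>l1\<close> times \<open>p1\<close>, the
  function \<open>D s \<circ> f\<close> is a cocycle for the parameter \<open>l1 * s\<close>, hence
  proportional to \<open>D (l1 * s)\<close> on the kernel.\<close>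

lemma D_aut:
  assumes f: "eigen_aut f l1 l2" and s: "s > 0" and g: "g \<in> carrier G" "p1 g = 0"
  shows "D s (f g) * D (l1 * s) cc = D (l1 * s) g * D s (f cc)"
proof (rule cocycle_proportional)
  note F = eigen_autD[OF f]
  fix g h assume "g \<in> carrier G" "h \<in> carrier G"
  then show "D s (f (g \<otimes> h)) = D s (f g) + exp (l1 * s * p1 g) * D s (f h)"
    using F by (simp add: D_mult mult.commute mult.left_commute)
qed (use g s eigen_autD[OF f] in auto)

text \<open>Positivity holds for small \<open>s\<close> by the second-order expansion at 0, and a
  sign change is excluded by nonvanishing and continuity in \<open>s\<close>.\<close>

lemma D_aut_cc_pos:
  assumes f: "eigen_aut f l1 l2" and s: "s > 0"
  shows "D s (f cc) > 0"
proof -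
  note F = eigen_autD[OF f]
  \<comment> \<open>By Cramer's rule, \<open>r1\<close> and \<open>r2\<close> are the coordinates,
    with respect to \<open>p1\<close> and \<open>p2\<close>, of the additive function with values
    \<open>- p1 b\<close> at \<open>a\<close> and \<open>p1 a\<close> at \<open>b\<close>.\<close>
  define r1 where "r1 = (- p1 b * p2 b - p1 a * p2 a) / dt"
  define r2 where "r2 = ((p1 a)\<^sup>2 + (p1 b)\<^sup>2) / dt"
  define w where "w g = r1 * p1 g + r2 * p2 g" for g
  have w: "w (g \<otimes> h) = w g + w h" if "g \<in> carrier G" "h \<in> carrier G" for g h
    using that by (simp add: w_def p1 p2 algebra_simps)
  have wab: "w a = - p1 b" "w b = p1 a"
    unfolding w_def r1_def r2_def using dt
    by (simp add: field_simps, simp add: dt_def power2_eq_square algebra_simps)+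
  have der: "((\<lambda>s. D s g / s) \<longlongrightarrow> w g) (at_right 0)" if "g \<in> carrier G" for g
  proof -
    have "((\<lambda>s. (D s g - D 0 g) / (s - 0)) \<longlongrightarrow> w g) (at 0)"
      using conjunct1[OF D_deriv_0[OF w wab that]] unfolding has_field_derivative_iff .
    then have "((\<lambda>s. (D s g - D 0 g) / (s - 0)) \<longlongrightarrow> w g) (at_right 0)"
      by (rule filterlim_mono) (auto simp: at_le)
    moreover have "D 0 g = 0" using D_deriv_0[OF w wab that] by blast
    ultimately show ?thesis by simp
  qed
  have dexp: "((\<lambda>s. (exp (s * t) - 1) / s) \<longlongrightarrow> t) (at_right 0)" for t :: real
  proof -
    have "((\<lambda>s. exp (s * t)) has_real_derivative t) (at 0)" by (auto intro!: derivative_eq_intros)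
    then have "((\<lambda>s. (exp (s * t) - exp (0 * t)) / (s - 0)) \<longlongrightarrow> t) (at 0)" by (simp add: has_field_derivative_iff)
    then have "((\<lambda>s. (exp (s * t) - exp (0 * t)) / (s - 0)) \<longlongrightarrow> t) (at_right 0)"
      by (rule filterlim_mono) (auto simp: at_le)
    then show ?thesis by simp
  qed
  have Dcc: "D s (f cc) = (1 - exp (s * (l1 * p1 b))) * D s (f a) + (exp (s * (l1 * p1 a)) - 1) * D s (f b)" for s
  proof -
    have "D s (f (g \<otimes> h)) = D s (f g) + exp (s * l1 * p1 g) * D s (f h)" if "g \<in> carrier G" "h \<in> carrier G" for g h
      using that F by (simp add: D_mult mult.assoc)
    from cocycle_cc[of "\<lambda>g. D s (f g)" "s * l1", OF this] show ?thesis by (simp add: mult.assoc)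
  qed
  let ?L = "- (l1 * p1 b) * w (f a) + (l1 * p1 a) * w (f b)"
  \<comment> \<open>The \<open>r1\<close> part is a multiple of \<open>p1\<close> and cancels by
    antisymmetry; the \<open>r2\<close> part produces the determinant \<open>dt\<close>, which the
    denominator of \<open>r2\<close> removes.\<close>
  have L: "?L = l1 * l2 * ((p1 a)\<^sup>2 + (p1 b)\<^sup>2)"
  proof -
    have "?L = l1 * l2 * (r2 * dt)" using F(5,6) by (simp add: w_def dt_def algebra_simps)
    also have "r2 * dt = (p1 a)\<^sup>2 + (p1 b)\<^sup>2" using dt by (simp add: r2_def)
    finally show ?thesis .
  qed
  have Lpos: "?L > 0"
    unfolding L using F(2,3) p1_nontrivial by (intro mult_pos_pos) (simp_all add: sum_power2_gt_zero_iff)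
  have "((\<lambda>s. - ((exp (s * (l1 * p1 b)) - 1) / s) * (D s (f a) / s) + (exp (s * (l1 * p1 a)) - 1) / s * (D s (f b) / s))
      \<longlongrightarrow> ?L) (at_right 0)"
    by (intro tendsto_intros dexp der F(4) a b)
  then have "\<forall>\<^sub>F s in at_right 0. - ((exp (s * (l1 * p1 b)) - 1) / s) * (D s (f a) / s) + (exp (s * (l1 * p1 a)) - 1) / s * (D s (f b) / s) > 0"
    by (rule order_tendstoD) (rule Lpos)
  then obtain e where e: "e > 0" "\<And>s. 0 < s \<Longrightarrow> s < e \<Longrightarrow>
     - ((exp (s * (l1 * p1 b)) - 1) / s) * (D s (f a) / s) + (exp (s * (l1 * p1 a)) - 1) / s * (D s (f b) / s) > 0"
    by (auto simp: eventually_at_right_field)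
  have small: "D s (f cc) > 0" if "0 < s" "s < e" for s
  proof -
    have "D s (f cc) = s * s * (- ((exp (s * (l1 * p1 b)) - 1) / s) * (D s (f a) / s) + (exp (s * (l1 * p1 a)) - 1) / s * (D s (f b) / s))"
      unfolding Dcc using that by (simp add: field_simps)
    then show ?thesis using e(2)[OF that] that by simp
  qed
  obtain f' where f': "f' \<in> hom G G" "\<And>g. g \<in> carrier G \<Longrightarrow> f (f' g) = g" using f by (auto simp: eigen_aut_def)
  \<comment> \<open>If it vanished, proportionality applied to \<open>f' cc\<close> would make
    \<open>D s\<close> vanish at \<open>f (f' cc)\<close>, which is \<open>cc\<close>.\<close>
  have nz: "D s (f cc) \<noteq> 0" if "s > 0" for s
  proof
    assume z: "D s (f cc) = 0"
    have c': "f' cc \<in> carrier G" using f'(1) by (auto simp: hom_def)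
    have "l1 * p1 (f' cc) = 0" using F(5)[OF c'] f'(2)[of cc] by simp
    then have "D s (f (f' cc)) * D (l1 * s) cc = D (l1 * s) (f' cc) * D s (f cc)"
      using F(2) by (intro D_aut[OF f that c']) simp
    then show False using z f'(2)[of cc] D_cc_pos[of s] D_cc_pos[of "l1 * s"] that F(2) by simp
  qed
  show ?thesis
  proof (rule ccontr)
    assume n: "\<not> D s (f cc) > 0"
    define s0 where "s0 = min s e / 2"
    have s0: "0 < s0" "s0 < e" "s0 \<le> s" using s e(1) by (auto simp: s0_def)
    have "\<exists>x. s0 \<le> x \<and> x \<le> s \<and> D x (f cc) = 0"
      using small[OF s0(1,2)] n s0 exp_poly_continuous[OF D_exp_poly[OF F(4)[OF cc(1)]], of "{s0..s}"]
      by (intro IVT2') auto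
    then show False using nz s0 by force
  qed
qed

subsection \<open>The positive cone\<close>

text \<open>The three tests are applied lexicographically. Where \<open>p1\<close> vanishes,
  \<open>D s\<close> is additive by \<open>D_mult\<close>, so eventual signs add up as in an ordered
  group.\<close>

definition cone :: "'a set" where
  "cone = {g \<in> carrier G. p1 g > 0 \<or> p1 g = 0 \<and> ((\<forall>\<^sub>F s in at_top. D s g > 0) \<or>
     (\<forall>\<^sub>F s in at_top. D s g = 0) \<and> ncpos (mu g - 1))}"

lemma cone_aut:
  assumes f: "eigen_aut f l1 l2" and g: "g \<in> cone" shows "f g \<in> cone"
proof -
  note F = eigen_autD[OF f]
  have gc: "g \<in> carrier G" using g by (simp add: cone_def)
  have Ds: "D s (f g) = D (l1 * s) g * (D s (f cc) / D (l1 * s) cc)" if "s > 0" "p1 g = 0" for s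
    using D_aut[OF f that(1) gc that(2)] D_cc_pos[of "l1 * s"] that F(2) by (simp add: field_simps)
  have q: "D s (f cc) / D (l1 * s) cc > 0" if "s > 0" for s
    using D_aut_cc_pos[OF f that] D_cc_pos[of "l1 * s"] that F(2) by simp
  have "\<forall>\<^sub>F s in at_top. D s (f g) > 0" if "\<forall>\<^sub>F s in at_top. D s g > 0" "p1 g = 0"
    using eventually_scale[OF F(2) that(1)] eventually_gt_at_top[of 0]
    by eventually_elim (metis Ds[OF _ that(2)] q mult_pos_pos)
  moreover have "\<forall>\<^sub>F s in at_top. D s (f g) = 0" if "\<forall>\<^sub>F s in at_top. D s g = 0" "p1 g = 0"
    using eventually_scale[OF F(2) that(1)] eventually_gt_at_top[of 0]
    by eventually_elim (simp add: Ds[OF _ that(2)])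
  moreover have "ncpos (mu (f g) - 1)" if "ncpos (mu g - 1)"
  proof (rule ncpos_scaled[OF that mu_aut[OF f gc]])
    fix w :: "bool list" show "prod_list (map (\<lambda>i. if i then l1 else l2) w) > 0"
      using F(2,3) by (induction w) auto
  qed
  moreover have "p1 g > 0 \<Longrightarrow> p1 (f g) > 0" "p1 g = 0 \<Longrightarrow> p1 (f g) = 0" using F(2) F(5)[OF gc] by auto
  ultimately show ?thesis using g F(4)[OF gc] unfolding cone_def by auto
qed

lemma cone_mult: assumes g: "g \<in> cone" and h: "h \<in> cone" shows "g \<otimes> h \<in> cone"
proof -
  have gh: "g \<in> carrier G" "h \<in> carrier G" using assms by (auto simp: cone_def)
  note p = p1[OF gh]
  have pos: "p1 g \<ge> 0" "p1 h \<ge> 0" using assms by (auto simp: cone_def)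
  show ?thesis
  proof (cases "p1 g = 0 \<and> p1 h = 0")
    case False
    then have "p1 (g \<otimes> h) > 0" using p pos by auto
    then show ?thesis using gh by (simp add: cone_def)
  next
    case True
    have Dm: "D s (g \<otimes> h) = D s g + D s h" for s using D_mult[OF gh] True by simp
    have g': "(\<forall>\<^sub>F s in at_top. D s g > 0) \<or> (\<forall>\<^sub>F s in at_top. D s g = 0) \<and> ncpos (mu g - 1)"
      and h': "(\<forall>\<^sub>F s in at_top. D s h > 0) \<or> (\<forall>\<^sub>F s in at_top. D s h = 0) \<and> ncpos (mu h - 1)"
      using assms True by (auto simp: cone_def)
    have "(\<forall>\<^sub>F s in at_top. D s (g \<otimes> h) > 0) \<or> (\<forall>\<^sub>F s in at_top. D s (g \<otimes> h) = 0) \<and> ncpos (mu (g \<otimes> h) - 1)"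
    proof (cases "(\<forall>\<^sub>F s in at_top. D s g > 0) \<or> (\<forall>\<^sub>F s in at_top. D s h > 0)")
      case True
      have "(\<forall>\<^sub>F s in at_top. D s g \<ge> 0)" "(\<forall>\<^sub>F s in at_top. D s h \<ge> 0)"
        using g' h' by (auto elim: eventually_mono)
      with True have "\<forall>\<^sub>F s in at_top. D s (g \<otimes> h) > 0"
        unfolding Dm by (auto elim: eventually_elim2)
      then show ?thesis by blast
    next
      case False
      then have z: "\<forall>\<^sub>F s in at_top. D s g = 0" "\<forall>\<^sub>F s in at_top. D s h = 0" and n: "ncpos (mu g - 1)" "ncpos (mu h - 1)"
        using g' h' by auto
      have "\<forall>\<^sub>F s in at_top. D s (g \<otimes> h) = 0" using z unfolding Dm by eventually_elim simp
      moreover have "mu (g \<otimes> h) - 1 = (mu g - 1) + (mu h - 1) + (mu g - 1) * (mu h - 1)"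
        by (simp add: series_hom_mult[OF mu(1) gh] algebra_simps)
      moreover have "ncpos ((mu g - 1) + (mu h - 1) + (mu g - 1) * (mu h - 1))"
        using mu_const[OF gh(1)] mu_const[OF gh(2)] by (intro ncpos_mult n) (simp_all add: coef_one)
      ultimately show ?thesis by (simp only:) blast
    qed
    then show ?thesis using gh True p by (simp add: cone_def)
  qed
qed

lemma cone_one: "\<one> \<notin> cone"
  by (simp add: cone_def series_hom_one[OF mu(1)] not_ncpos_zero)

lemma cone_total: assumes g: "g \<in> carrier G" "g \<noteq> \<one>" shows "g \<in> cone \<or> inv g \<in> cone"
proof (cases "p1 g = 0")
  case False
  then show ?thesis using g by (auto simp: cone_def)
next
  case True
  have Di: "D s (inv g) = - D s g" for s using D_inv[OF g(1)] True by simp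
  \<comment> \<open>The sign trichotomy for exponential polynomials; identical vanishing is the case
    left to the Magnus expansion, which is faithful.\<close>
  consider "\<forall>s. D s g = 0" | "\<forall>\<^sub>F s in at_top. D s g > 0" | "\<forall>\<^sub>F s in at_top. D s g < 0"
    using exp_poly_sign[OF D_exp_poly[OF g(1)]] by blast
  then show ?thesis
  proof cases
    case 1
    have "mu g - 1 \<noteq> 0" using mu_faithful[OF g(1)] g(2) by auto
    then have "ncpos (mu g - 1) \<or> ncpos (mu (inv g) - 1)"
      using ncpos_inverse[of "mu g - 1" "mu (inv g) - 1"] mu_const[OF g(1)] mu_const[of "inv g"] g(1) series_hom_inv[OF mu(1) g(1)]
      by (simp add: coef_one)
    then show ?thesis using 1 True g(1) by (auto simp: cone_def Di)
  qed (use True g(1) in \<open>auto simp: cone_def Di\<close>)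
qed

subsection \<open>The order is not standard\<close>

lemma lcs_Suc: "lcs G (Suc (Suc n)) = generate G {x \<otimes> y \<otimes> inv x \<otimes> inv y | x y. x \<in> lcs G (Suc n) \<and> y \<in> carrier G}"
  by (simp add: commutator_subgroup_def)

lemma lcs_subset: "lcs G (Suc n) \<subseteq> carrier G"
proof (induction n)
  case (Suc n)
  show ?case unfolding lcs_Suc by (rule generate_incl) (use Suc in auto)
qed simp

lemma lcs_subgroup: "subgroup (lcs G (Suc n)) G"
proof (cases n)
  case 0 then show ?thesis by (simp add: subgroup_self)
next
  case (Suc m)
  show ?thesis unfolding Suc lcs_Suc by (rule generate_is_subgroup) (use lcs_subset[of m] in auto)
qed

lemma lcs_step: "lcs G (Suc (Suc n)) \<subseteq> lcs G (Suc n)"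
proof (induction n)
  case 0
  then show ?case using lcs_subset[of 1] by simp
next
  case (Suc n)
  have "generate G {x \<otimes> y \<otimes> inv x \<otimes> inv y | x y. x \<in> lcs G (Suc (Suc n)) \<and> y \<in> carrier G} \<subseteq>
      generate G {x \<otimes> y \<otimes> inv x \<otimes> inv y | x y. x \<in> lcs G (Suc n) \<and> y \<in> carrier G}"
    by (rule mono_generate) (use Suc in blast)
  then show ?case unfolding lcs_Suc[symmetric] .
qed

lemma lcs_antimono: "m \<le> n \<Longrightarrow> lcs G (Suc n) \<subseteq> lcs G (Suc m)"
  by (induction n rule: dec_induct) (use lcs_step in blast)+

lemma lcs_depth_eq:
  assumes "g \<in> lcs G (Suc n)" "g \<notin> lcs G (Suc (Suc n))" shows "lcs_depth G g = Suc n"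
  unfolding lcs_depth_def
proof (rule the_equality)
  show "1 \<le> Suc n \<and> g \<in> lcs G (Suc n) - lcs G (Suc (Suc n))" using assms by simp
  fix k assume k: "1 \<le> k \<and> g \<in> lcs G k - lcs G (Suc k)"
  then obtain m where m: "k = Suc m" by (cases k) auto
  have "\<not> Suc n \<le> m" using lcs_antimono[of "Suc n" m] k m assms by auto
  moreover have "\<not> Suc m \<le> n" using lcs_antimono[of "Suc m" n] k m assms by auto
  ultimately show "k = Suc n" using m by simp
qed

text \<open>A commutator with any element raises the order by one, because in
  \<open>mu x * mu y - mu y * mu x\<close> only products of the nonconstant parts survive.\<close>

lemma mu_lcs: "g \<in> lcs G (Suc n) \<Longrightarrow> mu g - 1 \<in> of_order (Suc n)"
proof (induction n arbitrary: g)
  case 0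
  then show ?case using mu_const by (simp add: of_order_1 coef_one)
next
  case (Suc n)
  have minv: "mu (inv x) - 1 \<in> of_order k" if "x \<in> carrier G" "mu x - 1 \<in> of_order k" for x k
  proof -
    have "mu (inv x) - 1 = - (mu (inv x) * (mu x - 1))"
      using series_hom_inv[OF mu(1) that(1)] by (simp add: algebra_simps)
    then show ?thesis using of_order_uminus[OF of_order_mult_left[OF that(2)]] by simp
  qed
  have comm: "mu (x \<otimes> y \<otimes> inv x \<otimes> inv y) - 1 \<in> of_order (Suc (Suc n))" if x: "x \<in> lcs G (Suc n)" and y: "y \<in> carrier G" for x y
  proof -
    have xc: "x \<in> carrier G" using x lcs_subset by blast
    let ?f = "mu x - 1" and ?h = "mu y - 1"
    have h: "?h \<in> of_order (Suc 0)" using mu_const[OF y] by (simp add: of_order_1 coef_one)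
    have "mu (x \<otimes> y \<otimes> inv x \<otimes> inv y) - 1 = mu x * mu y * mu (inv x) * mu (inv y) - mu y * (mu x * mu (inv x)) * mu (inv y)"
      using series_hom_inv[OF mu(1) xc] series_hom_inv[OF mu(1) y] xc y by (simp add: series_hom_mult[OF mu(1)])
    also have "\<dots> = (?f * ?h - ?h * ?f) * mu (inv x) * mu (inv y)" by (simp add: algebra_simps)
    also have "\<dots> \<in> of_order (Suc (Suc n))"
      using of_order_mult[OF Suc.IH[OF x] h] of_order_mult[OF h Suc.IH[OF x]]
      by (auto intro!: of_order_mult_right[OF of_order_mult_right] of_order_diff[of "?f * ?h" _ "?h * ?f"])
    finally show ?thesis .
  qed
  have cl: "x \<otimes> y \<otimes> inv x \<otimes> inv y \<in> carrier G" if "x \<in> lcs G (Suc n)" "y \<in> carrier G" for x y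
    using that lcs_subset[of n] by auto
  have "g \<in> carrier G \<and> mu g - 1 \<in> of_order (Suc (Suc n))"
    using Suc.prems unfolding lcs_Suc
  proof (induction rule: generate.induct)
    case one
    show ?case by (simp add: series_hom_one[OF mu(1)])
  next
    case (incl h) then show ?case using comm cl by auto
  next
    case (inv h)
    then have "h \<in> carrier G" "mu h - 1 \<in> of_order (Suc (Suc n))" using comm cl by auto
    then show ?case using minv by simp
  next
    case (eng g h)
    have "mu (g \<otimes> h) - 1 = (mu g - 1) * mu h + (mu h - 1)"
      using eng by (simp add: series_hom_mult[OF mu(1)] algebra_simps)
    also have "\<dots> \<in> of_order (Suc (Suc n))"
      using eng by (intro of_order_add[OF of_order_mult_right]) blast+
    finally show ?case using eng by simp
  qed
  then show ?case by blast
qed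

lemma cc_depth: "cc \<in> lcs G 2" "cc \<notin> lcs G 3"
proof -
  have "cc \<in> generate G {x \<otimes> y \<otimes> inv x \<otimes> inv y | x y. x \<in> lcs G (Suc 0) \<and> y \<in> carrier G}"
    unfolding cc_def using a b by (intro generate.incl CollectI exI[of _ a] exI[of _ b]) simp
  then show "cc \<in> lcs G 2" using lcs_Suc[of 0] by (simp add: eval_nat_numeral)
  show "cc \<notin> lcs G 3"
  proof
    assume "cc \<in> lcs G 3"
    then have 3: "mu cc - 1 \<in> of_order (Suc (Suc (Suc 0)))" using mu_lcs[of cc 2] by (simp add: eval_nat_numeral)
    have "inv b \<otimes> (b \<otimes> a) = a" by (simp add: m_assoc[symmetric])
    then have "cc \<otimes> (b \<otimes> a) = a \<otimes> b" by (simp add: cc_def m_assoc)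
    then have "mu (cc \<otimes> (b \<otimes> a)) = mu (a \<otimes> b)" by simp
    then have "mu cc * (mu b * mu a) = mu a * mu b" by (simp add: series_hom_mult[OF mu(1)])
    \<comment> \<open>The right side is the commutator of the linear parts; its coefficient at
      \<open>[True, False]\<close> is the nonzero determinant of the characters, so
      \<open>cc\<close> has order exactly 2.\<close>
    then have "(mu cc - 1) * (mu b * mu a) = lin (pl a) * lin (pl b) - lin (pl b) * lin (pl a)"
      by (simp add: mu algebra_simps)
    moreover have "coef ((mu cc - 1) * (mu b * mu a)) [True, False] = 0"
      using of_order_mult_right[OF 3, of "mu b * mu a"] by (simp add: of_order_def)
    ultimately have "coef (lin (pl a) * lin (pl b) - lin (pl b) * lin (pl a)) [True, False] = 0" by simp
    then show False using indep by (simp add: coef_mult_Cons shift_lin coef_lin pl_def)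
  qed
qed

theorem cone_not_standard:
  assumes r: "order_cone G r = cone" shows "\<not> standard_bi_ordering G r"
proof
  assume "standard_bi_ordering G r"
  then obtain P where P: "order_cone G r = {g \<in> carrier G. g \<noteq> \<one> \<and> lcs G (Suc (lcs_depth G g)) #> g \<in> P (lcs_depth G g)}"
    unfolding standard_bi_ordering_def by blast
  have "\<exists>x\<in>carrier G. p1 x > 0"
    using p1_nontrivial p1_inv[OF a] p1_inv[OF b] a b inv_closed by (metis neg_0_less_iff_less not_less_iff_gr_or_eq)
  then obtain x where x: "x \<in> carrier G" "p1 x > 0" by blast
  define k where "k = cc \<otimes> x \<otimes> inv cc \<otimes> inv x"
  define u where "u = k \<otimes> cc"
  have kc: "k \<in> carrier G" and uc: "u \<in> carrier G" using x by (auto simp: k_def u_def)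
  have k3: "k \<in> lcs G 3"
  proof -
    have "k \<in> generate G {x \<otimes> y \<otimes> inv x \<otimes> inv y | x y. x \<in> lcs G (Suc 1) \<and> y \<in> carrier G}"
      unfolding k_def using x(1) cc_depth(1)
      by (intro generate.incl CollectI exI[of _ cc] exI[of _ x]) (simp add: eval_nat_numeral)
    then show ?thesis using lcs_Suc[of 1] by (simp add: eval_nat_numeral)
  qed
  have sg3: "subgroup (lcs G 3) G" and sg2: "subgroup (lcs G 2) G"
    using lcs_subgroup[of 2] lcs_subgroup[of 1] by (simp_all add: eval_nat_numeral)
  have k2: "k \<in> lcs G 2" using lcs_step[of 1] k3 by (auto simp: eval_nat_numeral)
  have u2: "u \<in> lcs G 2" unfolding u_def by (rule subgroup.m_closed[OF sg2 k2 cc_depth(1)])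
  have u3: "u \<notin> lcs G 3"
  proof
    assume "u \<in> lcs G 3"
    then have "inv k \<otimes> u \<in> lcs G 3" using k3 subgroup.m_closed[OF sg3] subgroup.m_inv_closed[OF sg3] by blast
    moreover have "inv k \<otimes> u = cc" using kc by (simp add: u_def m_assoc[symmetric])
    ultimately show False using cc_depth(2) by simp
  qed
  have depth: "lcs_depth G u = 2" "lcs_depth G cc = 2"
    using lcs_depth_eq[of u 1] lcs_depth_eq[of cc 1] u2 u3 cc_depth by (simp_all add: eval_nat_numeral)
  \<comment> \<open>A standard order sees only this coset, because \<open>u\<close> and
    \<open>cc\<close> both have depth 2; it must give them the same sign.\<close>
  have coset: "lcs G 3 #> u = lcs G 3 #> cc"
    unfolding u_def using coset_mult_assoc[of "lcs G 3" k cc] lcs_subset[of 2] kc coset_join2[OF kc sg3 k3]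
    by (simp add: eval_nat_numeral)
  have ne: "u \<noteq> \<one>" "cc \<noteq> \<one>" using u3 cc_depth(2) subgroup.one_closed[OF sg3] by auto
  have "\<forall>\<^sub>F s in at_top. D s cc > 0"
    using eventually_gt_at_top[of "0::real"] by eventually_elim (rule D_cc_pos, simp)
  then have "cc \<in> cone" by (simp add: cone_def)
  then have "cc \<in> {g \<in> carrier G. g \<noteq> \<one> \<and> lcs G (Suc (lcs_depth G g)) #> g \<in> P (lcs_depth G g)}"
    unfolding P[symmetric] r .
  then have "lcs G 3 #> cc \<in> P 2" using depth by simp
  then have "u \<in> {g \<in> carrier G. g \<noteq> \<one> \<and> lcs G (Suc (lcs_depth G g)) #> g \<in> P (lcs_depth G g)}"
    using depth coset ne uc by simp
  then have "u \<in> cone" unfolding P[symmetric] r .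
  have pk: "p1 k = 0" and pu: "p1 u = 0" using x kc by (auto simp: k_def u_def p1)
  \<comment> \<open>Computed from \<open>k \<otimes> (x \<otimes> cc) = cc \<otimes> x\<close>,
    where \<open>k\<close> and \<open>cc\<close> act trivially while \<open>x\<close> acts by the
    factor \<open>exp (s * p1 x)\<close>.\<close>
  have Du: "D s u = (2 - exp (s * p1 x)) * D s cc" for s
  proof -
    have "D s (cc \<otimes> x) = D s cc + D s x" using x by (simp add: D_mult)
    moreover have "k \<otimes> (x \<otimes> cc) = cc \<otimes> x"
    proof -
      have "inv x \<otimes> (x \<otimes> cc) = cc" using x by (simp add: m_assoc[symmetric])
      then show ?thesis using x by (simp add: k_def m_assoc)
    qed
    then have "D s (k \<otimes> (x \<otimes> cc)) = D s (cc \<otimes> x)" by simp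
    then have "D s k + (D s x + exp (s * p1 x) * D s cc) = D s (cc \<otimes> x)" using x kc pk by (simp add: D_mult)
    moreover have "D s u = D s k + D s cc" unfolding u_def using kc pk by (simp add: D_mult)
    ultimately show ?thesis by (simp add: algebra_simps)
  qed
  have "filterlim (\<lambda>s. p1 x * s) at_top at_top"
    using x(2) by (intro filterlim_tendsto_pos_mult_at_top[OF tendsto_const _ filterlim_ident])
  then have "\<forall>\<^sub>F s in at_top. p1 x * s > 1" by (simp add: filterlim_at_top_dense)
  then have neg: "\<forall>\<^sub>F s in at_top. D s u < 0"
    using eventually_gt_at_top[of "0::real"]
  proof eventually_elim
    case (elim s)
    have "1 + s * p1 x \<le> exp (s * p1 x)" by (rule exp_ge_add_one_self)
    moreover have "s * p1 x > 1" using elim by (simp add: mult.commute)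
    ultimately have "2 < exp (s * p1 x)" by linarith
    then show ?case unfolding Du using D_cc_pos[of s] elim by (simp add: mult_less_0_iff)
  qed
  have "\<not> (\<forall>\<^sub>F s in at_top. D s u > 0)"
  proof
    assume "\<forall>\<^sub>F s in at_top. D s u > 0"
    with neg have "\<forall>\<^sub>F s in (at_top :: real filter). False" by eventually_elim simp
    then show False by simp
  qed
  moreover have "\<not> (\<forall>\<^sub>F s in at_top. D s u = 0)"
  proof
    assume "\<forall>\<^sub>F s in at_top. D s u = 0"
    with neg have "\<forall>\<^sub>F s in (at_top :: real filter). False" by eventually_elim simp
    then show False by simp
  qed
  ultimately show False using \<open>u \<in> cone\<close> pu by (simp add: cone_def)
qed

end

section \<open>Bi-orderings of extensions\<close>

lemma (in group) inv_mult_cancel: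
  assumes "a \<in> carrier G" "b \<in> carrier G"
  shows "inv a \<otimes> (a \<otimes> b) = b" "a \<otimes> (inv a \<otimes> b) = b"
  using assms by (simp_all add: m_assoc[symmetric])

lemma (in group) bi_ordering_of_cone:
  assumes Q: "Q \<subseteq> carrier G" and one: "\<one> \<notin> Q"
    and mult: "\<And>a b. a \<in> Q \<Longrightarrow> b \<in> Q \<Longrightarrow> a \<otimes> b \<in> Q"
    and total: "\<And>a. a \<in> carrier G \<Longrightarrow> a \<noteq> \<one> \<Longrightarrow> a \<in> Q \<or> inv a \<in> Q"
    and conj: "\<And>g a. g \<in> carrier G \<Longrightarrow> a \<in> Q \<Longrightarrow> g \<otimes> a \<otimes> inv g \<in> Q"
  shows "bi_ordering G {(u, v). u \<in> carrier G \<and> v \<in> carrier G \<and> inv u \<otimes> v \<in> Q}" (is "bi_ordering G ?r")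
proof -
  have "trans ?r"
  proof (rule transI)
    fix u v w assume "(u, v) \<in> ?r" "(v, w) \<in> ?r"
    then have c: "u \<in> carrier G" "v \<in> carrier G" "w \<in> carrier G" "inv u \<otimes> v \<in> Q" "inv v \<otimes> w \<in> Q" by auto
    have "(inv u \<otimes> v) \<otimes> (inv v \<otimes> w) = inv u \<otimes> w"
      using c by (simp add: m_assoc inv_mult_cancel)
    then show "(u, w) \<in> ?r" using mult[OF c(4,5)] c by simp
  qed
  moreover have "irrefl ?r" using one by (auto simp: irrefl_def)
  moreover have "total_on (carrier G) ?r"
  proof (rule total_onI)
    fix u v assume c: "u \<in> carrier G" "v \<in> carrier G" "u \<noteq> v"
    then have "inv u \<otimes> v \<noteq> \<one>" by (metis inv_equality inv_inv inv_closed)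
    moreover have "inv (inv u \<otimes> v) = inv v \<otimes> u" using c by (simp add: inv_mult_group)
    ultimately show "(u, v) \<in> ?r \<or> (v, u) \<in> ?r" using total[of "inv u \<otimes> v"] c by auto
  qed
  moreover have "(a \<otimes> u, a \<otimes> v) \<in> ?r \<and> (u \<otimes> a, v \<otimes> a) \<in> ?r"
    if "a \<in> carrier G" "(u, v) \<in> ?r" for a u v
  proof -
    have c: "a \<in> carrier G" "u \<in> carrier G" "v \<in> carrier G" "inv u \<otimes> v \<in> Q" using that by auto
    have "inv (a \<otimes> u) \<otimes> (a \<otimes> v) = inv u \<otimes> v"
      using c by (simp add: inv_mult_group m_assoc inv_mult_cancel)
    moreover have "inv (u \<otimes> a) \<otimes> (v \<otimes> a) = inv a \<otimes> (inv u \<otimes> v) \<otimes> inv (inv a)"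
      using c by (simp add: inv_mult_group m_assoc)
    ultimately show ?thesis using c conj[of "inv a", OF _ c(4)] by simp
  qed
  ultimately show ?thesis unfolding bi_ordering_def strict_linear_order_on_def by auto
qed

text \<open>Elements are compared first by \<open>w\<close>, then by \<open>C\<close> on the kernel.
  Invariance of \<open>C\<close> under all of \<open>G\<close>, not only under \<open>K\<close>,
  makes the union a positive cone.\<close>

lemma (in group) bi_ordering_extension:
  fixes w :: "'a \<Rightarrow> real"
  assumes w: "\<And>a b. a \<in> carrier G \<Longrightarrow> b \<in> carrier G \<Longrightarrow> w (a \<otimes> b) = w a + w b"
    and K: "K = {a \<in> carrier G. w a = 0}" and C: "C \<subseteq> K" and one: "\<one> \<notin> C"
    and mult: "\<And>a b. a \<in> C \<Longrightarrow> b \<in> C \<Longrightarrow> a \<otimes> b \<in> C"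
    and total: "\<And>a. a \<in> K \<Longrightarrow> a \<noteq> \<one> \<Longrightarrow> a \<in> C \<or> inv a \<in> C"
    and conj: "\<And>g a. g \<in> carrier G \<Longrightarrow> a \<in> C \<Longrightarrow> g \<otimes> a \<otimes> inv g \<in> C"
  shows "\<exists>r. bi_ordering G r \<and> order_cone (G\<lparr>carrier := K\<rparr>) (Restr r K) = C"
proof -
  let ?Q = "{a \<in> carrier G. w a > 0} \<union> C"
  let ?r = "{(u, v). u \<in> carrier G \<and> v \<in> carrier G \<and> inv u \<otimes> v \<in> ?Q}"
  have w1: "w \<one> = 0" using w[of "\<one>" "\<one>"] by simp
  have wi: "w (inv a) = - w a" if "a \<in> carrier G" for a using w[of a "inv a"] w1 that by simp
  have Cw: "a \<in> carrier G" "w a = 0" if "a \<in> C" for a using C K that by auto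
  have "bi_ordering G ?r"
  proof (rule bi_ordering_of_cone)
    show "a \<otimes> b \<in> ?Q" if "a \<in> ?Q" "b \<in> ?Q" for a b
      using that w[of a b] Cw[of a] Cw[of b] mult[of a b] by auto
    show "a \<in> ?Q \<or> inv a \<in> ?Q" if "a \<in> carrier G" "a \<noteq> \<one>" for a
      using total[of a] wi[of a] that K by (cases "w a" "0 :: real" rule: linorder_cases) auto
    show "g \<otimes> a \<otimes> inv g \<in> ?Q" if "g \<in> carrier G" "a \<in> ?Q" for g a
      using that conj[of g a] Cw[of a] w[of "g \<otimes> a" "inv g"] w[of g a] wi[of g] by auto
  qed (use one w1 Cw in auto)
  moreover have "order_cone (G\<lparr>carrier := K\<rparr>) (Restr ?r K) = C"
    using C K w1 by (auto simp: order_cone_def)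
  ultimately show ?thesis by blast
qed

text \<open>Scaling factors multiply under composition and invert under inverses; positive scaling
  thus has to be checked on generators only.\<close>

lemma (in group) scaling_subgroup:
  fixes p :: "'a \<Rightarrow> real"
  assumes K: "K \<lhd> G"
  shows "subgroup {g \<in> carrier G. \<exists>l>0. \<forall>k\<in>K. p (g \<otimes> k \<otimes> inv g) = l * p k} G" (is "subgroup ?S G")
proof -
  have Kc: "k \<in> carrier G" if "k \<in> K" for k using normal_invE(1)[OF K] subgroup.subset that by blast
  have Kn: "g \<otimes> k \<otimes> inv g \<in> K" if "g \<in> carrier G" "k \<in> K" for g k using normal_invE(2)[OF K that] .
  show ?thesis
  proof (rule subgroupI)
    have "\<one> \<in> ?S" using Kc by (auto intro!: exI[of _ 1])
    then show "?S \<noteq> {}" by blast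
    show "inv g \<in> ?S" if gS: "g \<in> ?S" for g
    proof -
      obtain l where l: "g \<in> carrier G" "l > 0" "\<forall>k\<in>K. p (g \<otimes> k \<otimes> inv g) = l * p k" using gS by blast
      have "p (inv g \<otimes> k \<otimes> inv (inv g)) = inverse l * p k" if k: "k \<in> K" for k
      proof -
        have "g \<otimes> (inv g \<otimes> k \<otimes> inv (inv g)) \<otimes> inv g = k"
          using l(1) Kc[OF k] by (simp add: m_assoc inv_mult_cancel)
        then show ?thesis using l(3)[rule_format, OF Kn[of "inv g" k]] l(1,2) k by simp
      qed
      then show ?thesis using l(1,2) by (auto intro!: exI[of _ "inverse l"])
    qed
    show "g \<otimes> g' \<in> ?S" if gS: "g \<in> ?S" "g' \<in> ?S" for g g'
    proof -
      obtain l where l: "g \<in> carrier G" "l > 0" "\<forall>k\<in>K. p (g \<otimes> k \<otimes> inv g) = l * p k" using gS by blast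
      obtain l' where l': "g' \<in> carrier G" "l' > 0" "\<forall>k\<in>K. p (g' \<otimes> k \<otimes> inv g') = l' * p k" using gS by blast
      have "p ((g \<otimes> g') \<otimes> k \<otimes> inv (g \<otimes> g')) = (l * l') * p k" if k: "k \<in> K" for k
      proof -
        have "(g \<otimes> g') \<otimes> k \<otimes> inv (g \<otimes> g') = g \<otimes> (g' \<otimes> k \<otimes> inv g') \<otimes> inv g"
          using l(1) l'(1) Kc[OF k] by (simp add: m_assoc inv_mult_group)
        then show ?thesis using l(3)[rule_format, OF Kn[OF l'(1) k]] l'(3)[rule_format, OF k] by simp
      qed
      then show ?thesis using l(1,2) l'(1,2) by (auto intro!: exI[of _ "l * l'"])
    qed
  qed auto
qed

section \<open>The non-standard bi-ordering\<close>

lemma free_eigen_punctured_torus: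
  fixes p1 p2 :: "'g \<Rightarrow> real"
  assumes G: "group G" and \<psi>: "\<psi> \<in> iso pt_group G"
    and p1: "\<And>g h. g \<in> carrier G \<Longrightarrow> h \<in> carrier G \<Longrightarrow> p1 (g \<otimes>\<^bsub>G\<^esub> h) = p1 g + p1 h"
    and p2: "\<And>g h. g \<in> carrier G \<Longrightarrow> h \<in> carrier G \<Longrightarrow> p2 (g \<otimes>\<^bsub>G\<^esub> h) = p2 g + p2 h"
    and indep: "p1 (\<psi> pt_a) * p2 (\<psi> pt_b) \<noteq> p1 (\<psi> pt_b) * p2 (\<psi> pt_a)"
  shows "free_eigen G (\<psi> pt_a) (\<psi> pt_b) p1 p2"
proof -
  interpret G: group G by fact
  have \<psi>h: "\<psi> \<in> hom pt_group G" "inj_on \<psi> (carrier pt_group)" "\<psi> ` carrier pt_group = carrier G"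
    using \<psi> by (auto simp: iso_def bij_betw_def)
  interpret h: group_hom pt_group G \<psi> by unfold_locales (rule \<psi>h(1))
  have ab: "pt_a \<in> carrier pt_group" "pt_b \<in> carrier pt_group"
    using loop_a_loops loop_b_loops by (auto simp: fundamental_group_carrier)
  let ?i = "inv_into (carrier pt_group) \<psi>"
  have i: "?i \<in> hom G pt_group" using pt.PI.iso_set_sym[OF \<psi>] by (simp add: iso_def)
  have free: "\<exists>m\<in>hom G \<Gamma>. m (\<psi> pt_a) = x \<and> m (\<psi> pt_b) = y"
    if \<Gamma>: "group \<Gamma>" "x \<in> carrier \<Gamma>" "y \<in> carrier \<Gamma>" for \<Gamma> :: "('k, 'm) monoid_scheme" and x y
  proof -
    obtain \<eta> where \<eta>: "\<eta> \<in> hom pt_group \<Gamma>" "\<eta> pt_a = x" "\<eta> pt_b = y" using pt_universal[OF \<Gamma>] by blast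
    have "\<eta> \<circ> ?i \<in> hom G \<Gamma>" by (rule hom_compose[OF i \<eta>(1)])
    then show ?thesis using \<eta> ab \<psi>h(2) by (intro bexI[of _ "\<eta> \<circ> ?i"]) auto
  qed
  show ?thesis
  proof unfold_locales
    have "generate G (\<psi> ` {pt_a, pt_b}) = \<psi> ` generate pt_group {pt_a, pt_b}"
      using ab by (intro h.generate_img) auto
    then show "generate G {\<psi> pt_a, \<psi> pt_b} = carrier G" using pt_generated \<psi>h(3) by simp
  qed (use ab p1 p2 indep free[OF group_unit_group] free[OF group_affine_group] in auto)
qed

theorem theorem1p5:
  fixes T :: "'a topology" and B :: "'a set" and x :: 'a and h :: "'a \<Rightarrow> 'a"
    and M :: "'b topology" and q :: "'a \<times> real \<Rightarrow> 'b" and A :: "int^2^2"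
  assumes "punctured_torus T B" and "x \<in> B"
    and "monodromy T B h"
    and "mapping_torus T h M q"
    and "H1_matrix T h A"
    and "hyperbolic_monodromy A"
    and "untwisted_monodromy A"
  shows "\<exists>r. bi_ordering (fundamental_group M (q (x, 0))) r \<and>
             \<not> standard_bundle_ordering T x M q r"
proof -
  obtain f where f: "homeomorphic_map T pt_top f" and xT: "x \<in> topspace T"
    using assms(1,2) by (auto simp: punctured_torus_def ptorus_def)
  have hx: "homeomorphic_map T T h" "h x = x" using assms(2,3) by (auto simp: monodromy_def)
  then obtain h' where h': "homeomorphic_maps T T h h'" by (auto simp: homeomorphic_map_maps)
  have "compact (std_torus \<inter> ({z. Re (fst z) \<le> 0} \<union> {z. Re (snd z) \<le> 0}))"
    by (intro compact_Int_closed closed_Un closed_Collect_le continuous_intros)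
       (simp add: std_torus_def compact_Times)
  also have "std_torus \<inter> ({z. Re (fst z) \<le> 0} \<union> {z. Re (snd z) \<le> 0}) = ptorus"
    by (auto simp: ptorus_def std_disc_def)
  finally have "compact ptorus" .
  then have comp: "compact_space T"
    using homeomorphic_compact_space[OF homeomorphic_map_imp_homeomorphic_space[OF f]]
    by (simp add: compact_space_subtopology)
  have fc: "continuous_map T euclidean f" "inj_on f (topspace T)"
    using f homeomorphic_imp_continuous_map[OF f] homeomorphic_imp_injective_map[OF f]
    by (auto simp: continuous_map_in_subtopology)
  interpret torus_bundle T h h' M q f x
    by unfold_locales (use comp fc h' assms(4) xT hx in auto)
  interpret PT: group PT by (rule fundamental_group_group[OF xT])
  interpret PM: group PM by (rule fundamental_group_group) (use fib_cont xT in \<open>auto simp: continuous_map_def\<close>)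
  obtain \<theta> where \<theta>: "\<theta> \<in> iso pt_group PT" using punctured_torus_iso(1)[OF assms(1) xT] by blast
  obtain k where "spanning_paths T x k" using spanning_paths_exist[OF punctured_torus_iso(2)[OF assms(1) xT] xT] by blast
  then interpret S: spanning_paths T x k .
  obtain p1 p2 l1 l2 where p: "l1 > 0" "l2 > 0" "S.character p1" "S.character p2"
      "\<And>a. a \<in> carrier PT \<Longrightarrow> p1 (fundamental_induced T x h a) = l1 * p1 a"
      "\<And>a. a \<in> carrier PT \<Longrightarrow> p2 (fundamental_induced T x h a) = l2 * p2 a"
      "p1 (\<theta> pt_a) * p2 (\<theta> pt_b) \<noteq> p1 (\<theta> pt_b) * p2 (\<theta> pt_a)"
    using S.eigen_characters[OF \<theta> hx assms(5-7)] by blast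
  define K where "K = incl ` carrier PT"
  have Kw: "K = {a \<in> carrier PM. winding a = 0}" unfolding K_def by (rule winding_kernel)
  have w1: "winding \<one>\<^bsub>PM\<^esub> = 0" using winding_mult[of "\<one>\<^bsub>PM\<^esub>" "\<one>\<^bsub>PM\<^esub>"] by simp
  have wi: "winding (inv\<^bsub>PM\<^esub> a) = - winding a" if "a \<in> carrier PM" for a
    using winding_mult[of a "inv\<^bsub>PM\<^esub> a"] w1 that by simp
  have Kn: "K \<lhd> PM" unfolding PM.normal_inv_iff
    by (auto simp: Kw w1 wi winding_mult intro!: PM.subgroupI exI[of _ "\<one>\<^bsub>PM\<^esub>"])
  have Ks: "subgroup K PM" using PM.normal_invE(1)[OF Kn] .
  define GK where "GK = PM\<lparr>carrier := K\<rparr>"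
  have GKs: "carrier GK = K" "mult GK = mult PM" "one GK = one PM" by (simp_all add: GK_def)
  interpret GK: group GK unfolding GK_def by (rule PM.subgroup_imp_group[OF Ks])
  have GKi: "inv\<^bsub>GK\<^esub> g = inv\<^bsub>PM\<^esub> g" if "g \<in> K" for g
    unfolding GK_def by (rule PM.m_inv_consistent[OF Ks that])
  have ii: "incl \<in> iso PT GK"
    using incl_hom incl_inj by (auto simp: iso_def bij_betw_def hom_def K_def GKs)
  define j where "j = inv_into (carrier PT) incl"
  have j: "j \<in> hom GK PT" using PT.iso_set_sym[OF ii] by (simp add: iso_def j_def)
  have ji: "j (incl a) = a" if "a \<in> carrier PT" for a using incl_inj that by (simp add: j_def)
  have ab: "\<theta> pt_a \<in> carrier PT" "\<theta> pt_b \<in> carrier PT"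
    using loop_a_loops loop_b_loops \<theta> by (auto simp: fundamental_group_carrier iso_def hom_def)
  have add: "ch (j (g \<otimes>\<^bsub>GK\<^esub> g')) = ch (j g) + ch (j g')"
    if "S.character ch" "g \<in> carrier GK" "g' \<in> carrier GK" for ch g g'
    using that hom_mult[OF j that(2,3)] hom_in_carrier[OF j that(2)] hom_in_carrier[OF j that(3)] by (simp add: S.character_def)
  interpret E: free_eigen GK "(incl \<circ> \<theta>) pt_a" "(incl \<circ> \<theta>) pt_b" "p1 \<circ> j" "p2 \<circ> j"
    by (rule free_eigen_punctured_torus[OF GK.is_group iso_set_trans[OF \<theta> ii]])
       (use add p ab ji in auto)
  \<comment> \<open>Elements of \<open>K\<close> scale by 1, since characters are invariant under
    inner automorphisms, and the stable letter scales because it induces the monodromy.\<close>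
  have scale: "\<exists>l>0. \<forall>k\<in>K. (ch \<circ> j) (g \<otimes>\<^bsub>PM\<^esub> k \<otimes>\<^bsub>PM\<^esub> inv\<^bsub>PM\<^esub> g) = l * (ch \<circ> j) k"
    if g: "g \<in> carrier PM" and ch: "S.character ch" and l: "l > 0"
      and eig: "\<And>a. a \<in> carrier PT \<Longrightarrow> ch (fundamental_induced T x h a) = l * ch a" for g ch l
  proof -
    let ?S = "{g \<in> carrier PM. \<exists>l>0. \<forall>k\<in>K. (ch \<circ> j) (g \<otimes>\<^bsub>PM\<^esub> k \<otimes>\<^bsub>PM\<^esub> inv\<^bsub>PM\<^esub> g) = l * (ch \<circ> j) k}"
    have S: "subgroup ?S PM" by (rule PM.scaling_subgroup[OF Kn])
    have KS: "g \<in> ?S" if g: "g \<in> K" for g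
    proof -
      have "(ch \<circ> j) (g \<otimes>\<^bsub>PM\<^esub> k \<otimes>\<^bsub>PM\<^esub> inv\<^bsub>PM\<^esub> g) = 1 * (ch \<circ> j) k" if k: "k \<in> K" for k
      proof -
        have gi: "inv\<^bsub>PM\<^esub> g \<in> K" "g \<otimes>\<^bsub>PM\<^esub> k \<in> K" using g k Ks by (auto simp: subgroup_def)
        have "ch (j \<one>\<^bsub>PM\<^esub>) = 0" using add[OF ch, of "\<one>\<^bsub>PM\<^esub>" "\<one>\<^bsub>PM\<^esub>"] GK.one_closed by (simp add: GKs)
        moreover have "g \<otimes>\<^bsub>PM\<^esub> inv\<^bsub>PM\<^esub> g = \<one>\<^bsub>PM\<^esub>" using g Kw by simp
        ultimately have "ch (j g) + ch (j (inv\<^bsub>PM\<^esub> g)) = 0" using add[OF ch, of g "inv\<^bsub>PM\<^esub> g"] g gi by (simp add: GKs)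
        then show ?thesis
          using add[OF ch, of "g \<otimes>\<^bsub>PM\<^esub> k" "inv\<^bsub>PM\<^esub> g"] add[OF ch, of g k] g k gi by (simp add: GKs)
      qed
      then show ?thesis using g Kw by (auto intro!: exI[of _ 1])
    qed
    \<comment> \<open>The inverse comes first: conjugation of the fibre group by it is
      \<open>h\<close> itself, as \<open>stable_letter_conj\<close> shows.\<close>
    have "inv\<^bsub>PM\<^esub> stable_letter \<in> ?S"
    proof -
      let ?s = "inv\<^bsub>PM\<^esub> stable_letter"
      have "(ch \<circ> j) (?s \<otimes>\<^bsub>PM\<^esub> k \<otimes>\<^bsub>PM\<^esub> inv\<^bsub>PM\<^esub> ?s) = l * (ch \<circ> j) k" if k: "k \<in> K" for k
      proof -
        obtain a where a: "a \<in> carrier PT" "k = incl a" using k unfolding K_def by blast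
        have ha: "fundamental_induced T x h a \<in> carrier PT"
          using fundamental_induced_hom[OF h(1), of x] a(1) hx(2) by (auto simp: hom_def)
        have ic: "incl a \<in> carrier PM" "incl (fundamental_induced T x h a) \<in> carrier PM" using incl_hom a ha by (auto simp: hom_def)
        have "?s \<otimes>\<^bsub>PM\<^esub> incl a \<otimes>\<^bsub>PM\<^esub> stable_letter = incl (fundamental_induced T x h a)"
          using stable_letter(1) ic by (simp add: PM.m_assoc PM.inv_mult_cancel flip: stable_letter_conj[OF a(1)])
        then show ?thesis using a ha eig ji stable_letter(1) by simp
      qed
      then show ?thesis using l stable_letter(1) by auto
    qed
    then have tS: "stable_letter \<in> ?S" using subgroup.m_inv_closed[OF S, of "inv\<^bsub>PM\<^esub> stable_letter"] stable_letter(1) by simp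
    \<comment> \<open>Dividing \<open>g\<close> by the \<open>n\<close>-th power of the stable
      letter leaves winding 0, an element of \<open>K\<close>.\<close>
    obtain n :: int where n: "winding g = of_int n" using winding_int[OF g] by (auto elim: Ints_cases)
    let ?t = "stable_letter [^]\<^bsub>PM\<^esub> n"
    have t: "?t \<in> ?S" by (rule PM.subgroup_int_pow_closed[OF S tS])
    have tc: "?t \<in> carrier PM" using stable_letter(1) by simp
    have "winding ?t = of_int n"
      using additive_int_pow[OF PM.is_group winding_mult stable_letter(1)] stable_letter(2) by simp
    then have "g \<otimes>\<^bsub>PM\<^esub> inv\<^bsub>PM\<^esub> ?t \<in> K" using g tc n by (simp add: Kw winding_mult wi)
    from subgroup.m_closed[OF S KS[OF this] t] have "g \<otimes>\<^bsub>PM\<^esub> inv\<^bsub>PM\<^esub> ?t \<otimes>\<^bsub>PM\<^esub> ?t \<in> ?S" .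
    then have "g \<in> ?S" using g tc by (simp add: PM.m_assoc)
    then show ?thesis by simp
  qed
  \<comment> \<open>Conjugation by \<open>g\<close>, restricted to \<open>K\<close>, is inverted by
    conjugation with the inverse and scales both characters positively, so \<open>E.cone_aut\<close>
    applies to every element of the bundle group.\<close>
  have conj: "g \<otimes>\<^bsub>PM\<^esub> c \<otimes>\<^bsub>PM\<^esub> inv\<^bsub>PM\<^esub> g \<in> E.cone" if g: "g \<in> carrier PM" and c: "c \<in> E.cone" for g c
  proof -
    let ?f = "\<lambda>g k. g \<otimes>\<^bsub>PM\<^esub> k \<otimes>\<^bsub>PM\<^esub> inv\<^bsub>PM\<^esub> g"
    have Kc: "k \<in> carrier PM" if "k \<in> K" for k using that Kw by simp
    have fh: "?f g \<in> hom GK GK" if "g \<in> carrier PM" for g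
    proof (rule homI)
      show "?f g k \<in> carrier GK" if "k \<in> carrier GK" for k
        using PM.normal_invE(2)[OF Kn] \<open>g \<in> carrier PM\<close> that by (simp add: GKs)
      fix k k' assume "k \<in> carrier GK" "k' \<in> carrier GK"
      then have "k \<in> carrier PM" "k' \<in> carrier PM" using Kc by (simp_all add: GKs)
      then show "?f g (k \<otimes>\<^bsub>GK\<^esub> k') = ?f g k \<otimes>\<^bsub>GK\<^esub> ?f g k'"
        using \<open>g \<in> carrier PM\<close> by (simp add: GKs PM.m_assoc PM.inv_mult_cancel)
    qed
    have "?f g (?f (inv\<^bsub>PM\<^esub> g) k) = k" if "k \<in> K" for k
      using g Kc[OF that] by (simp add: PM.m_assoc PM.inv_mult_cancel)
    then have "\<exists>f'\<in>hom GK GK. \<forall>k\<in>carrier GK. ?f g (f' k) = k"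
      using fh[of "inv\<^bsub>PM\<^esub> g"] g by (intro bexI[of _ "?f (inv\<^bsub>PM\<^esub> g)"]) (auto simp: GKs)
    moreover obtain s1 s2 where "s1 > 0" "s2 > 0" "\<forall>k\<in>K. (p1 \<circ> j) (?f g k) = s1 * (p1 \<circ> j) k" "\<forall>k\<in>K. (p2 \<circ> j) (?f g k) = s2 * (p2 \<circ> j) k"
      using scale[OF g p(3,1,5)] scale[OF g p(4,2,6)] by blast
    ultimately have "E.eigen_aut (?f g) s1 s2" unfolding E.eigen_aut_def using fh[OF g] by (simp add: GKs)
    then show ?thesis by (rule E.cone_aut[OF _ c])
  qed
  have CK: "E.cone \<subseteq> K" using E.cone_def GKs by auto
  have "\<exists>r. bi_ordering PM r \<and> order_cone (PM\<lparr>carrier := K\<rparr>) (Restr r K) = E.cone"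
  proof (rule PM.bi_ordering_extension[OF winding_mult Kw CK])
    show "\<one>\<^bsub>PM\<^esub> \<notin> E.cone" using E.cone_one by (simp add: GKs)
    show "a \<otimes>\<^bsub>PM\<^esub> b \<in> E.cone" if "a \<in> E.cone" "b \<in> E.cone" for a b using E.cone_mult[OF that] by (simp add: GKs)
    show "a \<in> E.cone \<or> inv\<^bsub>PM\<^esub> a \<in> E.cone" if "a \<in> K" "a \<noteq> \<one>\<^bsub>PM\<^esub>" for a
      using E.cone_total[of a] that GKi by (simp add: GKs)
  qed (assumption | rule conj)+
  then obtain r where r: "bi_ordering PM r" "order_cone GK (Restr r K) = E.cone" by (auto simp: GK_def)
  have "fibre_subgroup T x M q = K" by (simp add: fibre_subgroup_def K_def)
  then have "\<not> standard_bundle_ordering T x M q r"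
    using E.cone_not_standard[OF r(2)] by (simp add: standard_bundle_ordering_def GK_def)
  with r(1) show ?thesis by blast
qed

end
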